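(* Consider the following problem: given a connected undirected graph $G=(V,E)$ with $n=|V|$, $m=|E|$, edge weights $w\colon E\to\mathbb{N}_{\ge 0}$, edge lengths $\ell\colon E\to\mathbb{N}_{\ge 1}$, a stretch factor $\alpha\ge1$ and $\overline{W}\in\mathbb{N}$, decide whether $G$ has an $\alpha$-spanner $H=(V,F)$ with $w(E\setminus F)\ge\overline{W}$. (i) There is an FPT algorithm for this problem w.r.t. the combined parameter $(\overline{W},\ell_{\max},\alpha)$, where $\ell_{\max}$ is an upper bound on the edge lengths; its running time is $$\mathcal{T}\in\mathcal{O}\big(\overline{W}^{\,2\overline{W}+1}\tau^{2\overline{W}}\cdot\mathrm{SPSP}(n,m)+\mathrm{APSP}_2(n,m)\big)\quad\text{with } \tau=\alpha\,\ell_{\max}.$$ (ii) For coupled instances (i.e., $w(e)=\ell(e)>0$ for all $e\in E$), there is an FPT algorithm w.r.t. $(\overline{W},\alpha)$ with running time $\mathcal{T}$ given by the same expression with $\tau=\alpha\,\overline{W}$. In both cases, a witness (such a spanner $H$, if it exists) can be identified in $\mathcal{O}(\mathcal{T})$ time.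
   Context: For a subgraph $G'\subseteq G$ and $u,v\in V$, $\ell_{G'}[u,v]$ is the length of a shortest $u$-$v$-path in $G'$ w.r.t. $\ell$. A subgraph $H=(V,F)$, $F\subseteq E$, is an $\alpha$-spanner of $G$ if $\ell_H[u,v]\le\alpha\,\ell_G[u,v]$ for all $u,v\in V$; equivalently, for all $\{u,v\}\in E$. For a set $X$ of edges, $w(X)=\sum_{e\in X}w(e)$. As a preprocessing convention, edges that do not settle themselves (i.e., edges $\{u,v\}$ with $\ell(\{u,v\})>\alpha\,\ell_G[u,v]$) are assumed to have been removed from the instance. $\mathrm{SPSP}(n,m)$ and $\mathrm{APSP}_2(n,m)$ denote the running time of suitable algorithms for the single-pair shortest path problem and for the all-pairs-2-shortest-paths problem (two shortest paths for each node pair), respectively, on a graph with $n$ nodes and $m$ edges; $\mathrm{APSP}_2(n,m)\in\mathcal{O}(nm+n^2\log n)$. An algorithm is FPT w.r.t. a (possibly combined) parameter $k$ if on instance $I$ it runs in $\mathcal{O}(f(k)\cdot p(\langle I\rangle))$ time for a computable function $f$ and a polynomial $p$ in the encoding length $\langle I\rangle$. *)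

theory Defs
  imports
    Complex_Main
    "HOL-Library.Extended_Real"
    "HOL-Library.Log_Nat"
    "HOL-Computational_Algebra.Polynomial"
begin

section \<open>Paths, distances and spanners in undirected graphs\<close>

text \<open>A graph is given by its set of edges, each edge being a two-element set of nodes. A
  path is the list of its nodes, without repetition; the one-element list is the trivial path.\<close>

definition is_path :: "'v set set \<Rightarrow> 'v \<Rightarrow> 'v list \<Rightarrow> 'v \<Rightarrow> bool" where
  "is_path E u p v \<longleftrightarrow> p \<noteq> [] \<and> hd p = u \<and> last p = v \<and> distinct p
     \<and> (\<forall>i. Suc i < length p \<longrightarrow> {p ! i, p ! Suc i} \<in> E)"

definition path_length :: "('v set \<Rightarrow> nat) \<Rightarrow> 'v list \<Rightarrow> nat" where
  "path_length l p = (\<Sum>i<length p - 1. l {p ! i, p ! Suc i})"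

text \<open>The distance is infinite if there is no path.\<close>

definition distance :: "'v set set \<Rightarrow> ('v set \<Rightarrow> nat) \<Rightarrow> 'v \<Rightarrow> 'v \<Rightarrow> ereal" where
  "distance E l u v = (INF p\<in>{p. is_path E u p v}. ereal (real (path_length l p)))"

definition spanner ::
    "real \<Rightarrow> 'v set \<Rightarrow> 'v set set \<Rightarrow> ('v set \<Rightarrow> nat) \<Rightarrow> 'v set set \<Rightarrow> bool" where
  "spanner \<alpha> V E l F \<longleftrightarrow> F \<subseteq> E
     \<and> (\<forall>u\<in>V. \<forall>v\<in>V. distance F l u v \<le> ereal \<alpha> * distance E l u v)"


section \<open>A word RAM\<close>

text \<open>Memory consists of registers and of arrays; both are named by constants of the program,
  so that a program uses only finitely many of them.\<close>

record mem =
  reg :: "nat \<Rightarrow> nat"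
  arr :: "nat \<Rightarrow> nat \<Rightarrow> nat"

datatype expr =
    Const nat
  | Reg nat
  | Elem nat expr
  | Add expr expr
  | Sub expr expr
  | Mult expr expr
  | Div expr expr
  | Less expr expr

fun val :: "mem \<Rightarrow> expr \<Rightarrow> nat" where
  "val s (Const k) = k"
| "val s (Reg x) = reg s x"
| "val s (Elem a e) = arr s a (val s e)"
| "val s (Add e f) = val s e + val s f"
| "val s (Sub e f) = val s e - val s f"
| "val s (Mult e f) = val s e * val s f"
| "val s (Div e f) = val s e div val s f"
| "val s (Less e f) = (if val s e < val s f then 1 else 0)"

text \<open>A machine word holds a number below \<open>B\<close>. An expression whose evaluation overflows,
  also in an intermediate result, cannot be executed.\<close>

fun fits :: "nat \<Rightarrow> mem \<Rightarrow> expr \<Rightarrow> bool" where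
  "fits B s (Const k) \<longleftrightarrow> k < B"
| "fits B s (Reg x) \<longleftrightarrow> reg s x < B"
| "fits B s (Elem a e) \<longleftrightarrow> fits B s e \<and> arr s a (val s e) < B"
| "fits B s (Add e f) \<longleftrightarrow> fits B s e \<and> fits B s f \<and> val s e + val s f < B"
| "fits B s (Sub e f) \<longleftrightarrow> fits B s e \<and> fits B s f"
| "fits B s (Mult e f) \<longleftrightarrow> fits B s e \<and> fits B s f \<and> val s e * val s f < B"
| "fits B s (Div e f) \<longleftrightarrow> fits B s e \<and> fits B s f"
| "fits B s (Less e f) \<longleftrightarrow> fits B s e \<and> fits B s f \<and> 1 < B"

datatype com =
    Skip
  | Assign nat expr
  | Store nat expr expr
  | Seq com com
  | Cond expr com com
  | While expr com

text \<open>\<open>exec B c s t s'\<close>: on a machine with words below \<open>B\<close>, the program \<open>c\<close> started in \<open>s\<close> halts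
  in \<open>s'\<close> after \<open>t\<close> steps. Each command costs one step; as expressions are part of the program,
  this is up to a constant depending on the program the cost of evaluating them operation by
  operation.\<close>

inductive exec :: "nat \<Rightarrow> com \<Rightarrow> mem \<Rightarrow> nat \<Rightarrow> mem \<Rightarrow> bool" for B where
  Skip: "exec B Skip s 1 s"
| Assign: "fits B s e \<Longrightarrow> exec B (Assign x e) s 1 (s\<lparr>reg := (reg s)(x := val s e)\<rparr>)"
| Store: "fits B s i \<Longrightarrow> fits B s e \<Longrightarrow>
    exec B (Store a i e) s 1 (s\<lparr>arr := (arr s)(a := (arr s a)(val s i := val s e))\<rparr>)"
| Seq: "exec B c s t s' \<Longrightarrow> exec B d s' t' s'' \<Longrightarrow> exec B (Seq c d) s (t + t') s''"
| CondTrue: "fits B s e \<Longrightarrow> val s e \<noteq> 0 \<Longrightarrow> exec B c s t s' \<Longrightarrow>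
    exec B (Cond e c d) s (Suc t) s'"
| CondFalse: "fits B s e \<Longrightarrow> val s e = 0 \<Longrightarrow> exec B d s t s' \<Longrightarrow>
    exec B (Cond e c d) s (Suc t) s'"
| WhileFalse: "fits B s e \<Longrightarrow> val s e = 0 \<Longrightarrow> exec B (While e c) s 1 s"
| WhileTrue: "fits B s e \<Longrightarrow> val s e \<noteq> 0 \<Longrightarrow> exec B c s t s' \<Longrightarrow>
    exec B (While e c) s' t' s'' \<Longrightarrow> exec B (While e c) s (Suc (t + t')) s''"

text \<open>The input is the beginning of array 0, the output is in array 1. All other memory cells
  initially hold arbitrary words.\<close>

definition holds_input :: "nat list \<Rightarrow> mem \<Rightarrow> bool" where
  "holds_input xs s \<longleftrightarrow> (\<forall>i<length xs. arr s 0 i = xs ! i)"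

definition runs :: "nat \<Rightarrow> com \<Rightarrow> nat list \<Rightarrow> real \<Rightarrow> ((nat \<Rightarrow> nat) \<Rightarrow> bool) \<Rightarrow> bool" where
  "runs B c xs T ok \<longleftrightarrow>
     (\<forall>s. (\<forall>x. reg s x < B) \<and> (\<forall>a i. arr s a i < B) \<and> holds_input xs s \<longrightarrow>
        (\<exists>t s'. exec B c s t s' \<and> real t \<le> T \<and> ok (arr s' 1)))"

text \<open>\<open>solves_in_time c D enc ok T\<close>: on each instance \<open>I \<in> D\<close>, encoded as \<open>enc I\<close>, the program
  \<open>c\<close> produces an output satisfying \<open>ok I\<close> in at most \<open>T I\<close> steps, provided that the word length
  is at least a suitable constant times the logarithm of the size of the input and of the numbers
  in it.\<close>

definition solves_in_time ::
    "com \<Rightarrow> 'i set \<Rightarrow> ('i \<Rightarrow> nat list) \<Rightarrow> ('i \<Rightarrow> (nat \<Rightarrow> nat) \<Rightarrow> bool) \<Rightarrow> ('i \<Rightarrow> real) \<Rightarrow> bool" where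
  "solves_in_time c D enc ok T \<longleftrightarrow>
     (\<exists>k. \<forall>I\<in>D. \<forall>B \<ge> (sum_list (enc I) + length (enc I) + 2) ^ k.
        runs B c (enc I) (T I) (ok I))"

definition computable :: "(nat list \<Rightarrow> nat) \<Rightarrow> bool" where
  "computable f \<longleftrightarrow>
     (\<exists>c. \<forall>xs s. holds_input (length xs # xs) s \<longrightarrow>
        (\<exists>B t s'. exec B c s t s' \<and> arr s' 1 0 = f xs))"

definition encoding_length :: "nat list \<Rightarrow> nat" where
  "encoding_length xs = (\<Sum>x\<leftarrow>xs. floorlog 2 x + 1)"

definition fpt_algorithm ::
    "com \<Rightarrow> 'i set \<Rightarrow> ('i \<Rightarrow> nat list) \<Rightarrow> ('i \<Rightarrow> (nat \<Rightarrow> nat) \<Rightarrow> bool) \<Rightarrow> ('i \<Rightarrow> nat list) \<Rightarrow> bool" where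
  "fpt_algorithm c D enc ok par \<longleftrightarrow>
     (\<exists>f (p :: nat poly). computable f \<and>
        solves_in_time c D enc ok
          (\<lambda>I. real (f (par I)) * real (poly p (encoding_length (enc I)))))"


section \<open>Graph problems as inputs of the RAM\<close>

text \<open>The nodes are the numbers below \<open>size_nodes\<close>; \<open>edge_list\<close> lists each edge once, in any
  order and with any order of its end nodes.\<close>

record lgraph =
  size_nodes :: nat
  edge_list :: "(nat \<times> nat) list"
  len :: "nat set \<Rightarrow> nat"

definition nodes :: "'a lgraph_scheme \<Rightarrow> nat set" where
  "nodes G = {..<size_nodes G}"

definition edges :: "'a lgraph_scheme \<Rightarrow> nat set set" where
  "edges G = (\<lambda>(u, v). {u, v}) ` set (edge_list G)"

definition size_edges :: "'a lgraph_scheme \<Rightarrow> nat" where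
  "size_edges G = length (edge_list G)"

definition valid_graph :: "'a lgraph_scheme \<Rightarrow> bool" where
  "valid_graph G \<longleftrightarrow> size_nodes G \<ge> 1
     \<and> (\<forall>(u, v) \<in> set (edge_list G). u \<in> nodes G \<and> v \<in> nodes G \<and> u \<noteq> v)
     \<and> distinct (map (\<lambda>(u, v). {u, v}) (edge_list G))
     \<and> (\<forall>e \<in> edges G. len G e \<ge> 1)"

definition connected_graph :: "'a lgraph_scheme \<Rightarrow> bool" where
  "connected_graph G \<longleftrightarrow> (\<forall>u\<in>nodes G. \<forall>v\<in>nodes G. \<exists>p. is_path (edges G) u p v)"


subsection \<open>Single-pair shortest path\<close>

record spsp_instance = lgraph +
  source :: nat
  target :: nat

definition valid_spsp :: "spsp_instance \<Rightarrow> bool" where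
  "valid_spsp I \<longleftrightarrow> valid_graph I \<and> source I \<in> nodes I \<and> target I \<in> nodes I"

definition enc_spsp :: "spsp_instance \<Rightarrow> nat list" where
  "enc_spsp I = [size_nodes I, size_edges I, source I, target I]
     @ concat (map (\<lambda>(u, v). [u, v, len I {u, v}]) (edge_list I))"

text \<open>The output consists of the number of nodes of a shortest path, its length, and its nodes;
  the first entry is 0 if there is no path.\<close>

definition ok_spsp :: "spsp_instance \<Rightarrow> (nat \<Rightarrow> nat) \<Rightarrow> bool" where
  "ok_spsp I out \<longleftrightarrow>
     (if \<exists>p. is_path (edges I) (source I) p (target I)
      then \<exists>p. is_path (edges I) (source I) p (target I)
             \<and> (\<forall>q. is_path (edges I) (source I) q (target I) \<longrightarrow>
                  path_length (len I) p \<le> path_length (len I) q)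
             \<and> out 0 = length p \<and> out 1 = path_length (len I) p
             \<and> (\<forall>i<length p. out (2 + i) = p ! i)
      else out 0 = 0)"


subsection \<open>All-pairs two shortest paths\<close>

definition enc_apsp2 :: "lgraph \<Rightarrow> nat list" where
  "enc_apsp2 G = [size_nodes G, size_edges G]
     @ concat (map (\<lambda>(u, v). [u, v, len G {u, v}]) (edge_list G))"

text \<open>\<open>a\<close> and \<open>b\<close> are the lengths of two distinct paths such that no other path is shorter; 0
  stands for a path that does not exist, which is unambiguous for \<open>u \<noteq> v\<close> and positive edge
  lengths.\<close>

definition two_shortest ::
    "'v set set \<Rightarrow> ('v set \<Rightarrow> nat) \<Rightarrow> 'v \<Rightarrow> 'v \<Rightarrow> nat \<Rightarrow> nat \<Rightarrow> bool" where
  "two_shortest E l u v a b \<longleftrightarrow> (let P = {p. is_path E u p v} in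
     (P = {} \<and> a = 0 \<and> b = 0)
     \<or> (\<exists>p. P = {p} \<and> a = path_length l p \<and> b = 0)
     \<or> (\<exists>p\<in>P. \<exists>q\<in>P. p \<noteq> q \<and> a = path_length l p \<and> b = path_length l q \<and> a \<le> b
          \<and> (\<forall>r\<in>P - {p, q}. b \<le> path_length l r)))"

text \<open>Only the lengths of the two paths are asked for, since explicit lists of the nodes of all
  paths cannot be written in \<open>O(n m + n\<^sup>2 log n)\<close> time in general.\<close>

definition ok_apsp2 :: "lgraph \<Rightarrow> (nat \<Rightarrow> nat) \<Rightarrow> bool" where
  "ok_apsp2 G out \<longleftrightarrow> (\<forall>u\<in>nodes G. \<forall>v\<in>nodes G. u \<noteq> v \<longrightarrow>
     two_shortest (edges G) (len G) u v
       (out (2 * (u * size_nodes G + v))) (out (2 * (u * size_nodes G + v) + 1)))"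


subsection \<open>Spanners of large saved weight\<close>

record spanner_instance = lgraph +
  weight :: "nat set \<Rightarrow> nat"
  stretch :: rat
  goal :: nat

definition self_settled :: "spanner_instance \<Rightarrow> bool" where
  "self_settled I \<longleftrightarrow> (\<forall>(u, v) \<in> set (edge_list I).
     ereal (real (len I {u, v})) \<le> ereal (of_rat (stretch I)) * distance (edges I) (len I) u v)"

definition valid_spanner_instance :: "spanner_instance \<Rightarrow> bool" where
  "valid_spanner_instance I \<longleftrightarrow>
     valid_graph I \<and> connected_graph I \<and> stretch I \<ge> 1 \<and> self_settled I"

definition stretch_num :: "spanner_instance \<Rightarrow> nat" where
  "stretch_num I = nat (fst (quotient_of (stretch I)))"

definition stretch_den :: "spanner_instance \<Rightarrow> nat" where
  "stretch_den I = nat (snd (quotient_of (stretch I)))"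

definition enc_spanner :: "spanner_instance \<Rightarrow> nat list" where
  "enc_spanner I = [size_nodes I, size_edges I, goal I, stretch_num I, stretch_den I]
     @ concat (map (\<lambda>(u, v). [u, v, weight I {u, v}, len I {u, v}]) (edge_list I))"

definition witness :: "spanner_instance \<Rightarrow> nat set set \<Rightarrow> bool" where
  "witness I F \<longleftrightarrow> spanner (of_rat (stretch I)) (nodes I) (edges I) (len I) F
     \<and> sum (weight I) (edges I - F) \<ge> goal I"

text \<open>The first output entry is the decision. For yes-instances, the following entries mark the
  edges of a witness, in the order of the input.\<close>

definition ok_spanner :: "spanner_instance \<Rightarrow> (nat \<Rightarrow> nat) \<Rightarrow> bool" where
  "ok_spanner I out \<longleftrightarrow>
     (if \<exists>F. witness I F
      then out 0 = 1
         \<and> witness I {{u, v} |u v i. i < size_edges I \<and> edge_list I ! i = (u, v) \<and> out (Suc i) = 1}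
      else out 0 = 0)"

definition coupled :: "spanner_instance \<Rightarrow> bool" where
  "coupled I \<longleftrightarrow> (\<forall>e\<in>edges I. weight I e = len I e \<and> len I e > 0)"

definition running_time ::
    "(nat \<Rightarrow> nat \<Rightarrow> real) \<Rightarrow> (nat \<Rightarrow> nat \<Rightarrow> real) \<Rightarrow> real \<Rightarrow> spanner_instance \<Rightarrow> real" where
  "running_time SPSP APSP2 \<tau> I =
     real (goal I) ^ (2 * goal I + 1) * \<tau> ^ (2 * goal I) * SPSP (size_nodes I) (size_edges I)
     + APSP2 (size_nodes I) (size_edges I)"

text \<open>Instances together with an upper bound on the edge lengths; the bound is not part of the
  input.\<close>

definition bounded_spanner_instances :: "(spanner_instance \<times> nat) set" where
  "bounded_spanner_instances =
     {(I, lmax). valid_spanner_instance I \<and> (\<forall>e\<in>edges I. len I e \<le> lmax)}"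

definition coupled_spanner_instances :: "spanner_instance set" where
  "coupled_spanner_instances = {I. valid_spanner_instance I \<and> coupled I}"

end

theory Submission
  imports Defs
begin

text \<open>Deleting a set \<open>X\<close> of edges leaves an \<open>\<alpha>\<close>-spanner iff each \<open>e = {u, v} \<in> X\<close> has a detour, a
  \<open>u\<close>-\<open>v\<close>-path avoiding \<open>X\<close> of length at most \<open>\<alpha> \<cdot> \<ell> e\<close>. Hence subsets of solutions of sufficient weight
  are solutions, so that at most \<open>W\<close> edges of positive weight have to be deleted (\<open>W\<close> is the goal),
  and each of them can be deleted on its own. The second shortest \<open>u\<close>-\<open>v\<close>-path tells which edges these
  candidates are. If a candidate weighs at least \<open>W\<close>, it is a solution. Otherwise the
  detours of the candidates have at most \<open>\<tau>\<close> edges (for coupled instances because \<open>\<ell> e = w e < W\<close>),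
  so that any \<open>(2\<tau> + 1) W\<close> candidates contain \<open>W\<close> of them whose detours avoid each
  other, by a greedy choice of an independent set in a digraph of out-degree at most \<open>\<tau>\<close>. It therefore suffices
  to try all \<open>W\<close>-tuples of the first \<open>(2\<tau> + 1) W\<close> candidates, with at most \<open>W\<close> shortest path
  computations for each of them.\<close>

section \<open>Paths and spanners\<close>

text \<open>The machine model shapes the details. The program does not know \<tau>, since
  \<open>lmax\<close> is not part of the input; it uses the largest integer bound
  \<open>bound I e\<close> on a detour length among the candidates instead. Unless some candidate
  suffices on its own, this maximum is attained at an edge lighter than the goal, which is why one
  program serves both settings. The number of tuples may exceed every machine word, so a tuple is
  kept as an array of digits and incremented with carries. The subroutines are arbitrary programs
  with arbitrary time functions; all linear overhead of a call is charged to the lower bounds of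
  order n + m on these functions.

  The exponents leave room: at most (3 \<tau> W)^W tuples, each tested with W calls, need 3^W
  W^(W+1) \<tau>^W calls, and the spare factor W^W of the claimed bound absorbs 3^W up to the
  constant 27.\<close>

abbreviation walk :: "'v set set \<Rightarrow> 'v list \<Rightarrow> bool" where
  "walk E \<equiv> successively (\<lambda>x y. {x, y} \<in> E)"

lemma is_path_walk:
  "is_path E u p v \<longleftrightarrow> p \<noteq> [] \<and> hd p = u \<and> last p = v \<and> distinct p \<and> walk E p"
  by (auto simp: is_path_def successively_conv_nth)

lemma path_length_simps [simp]:
  "path_length l [] = 0"
  "path_length l [x] = 0"
  "path_length l (x # y # p) = l {x, y} + path_length l (y # p)"
  by (auto simp: path_length_def sum.lessThan_Suc_shift simp del: sum.lessThan_Suc)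

lemma path_length_drop: "path_length l q \<le> path_length l (p @ q)"
proof (induction p)
  case (Cons x p)
  have "path_length l (p @ q) \<le> path_length l (x # p @ q)" by (cases "p @ q") auto
  with Cons show ?case by simp
qed simp

text \<open>Shortcut argument: if \<open>x\<close> recurs on the simple path found for the rest, the
  part of that path before \<open>x\<close> is dropped, which cannot increase the length because
  lengths are natural numbers.\<close>

lemma walk_to_path:
  "p \<noteq> [] \<Longrightarrow> walk E p \<Longrightarrow> \<exists>q. is_path E (hd p) q (last p) \<and> path_length l q \<le> path_length l p"
proof (induction p)
  case (Cons x p)
  show ?case
  proof (cases "p = []")
    case True
    then show ?thesis by (intro exI[of _ "[x]"]) (auto simp: is_path_walk)
  next
    case False
    then obtain y p' where p: "p = y # p'" by (cases p) auto
    obtain q where q: "is_path E y q (last p)" "path_length l q \<le> path_length l p"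
      using Cons p by auto
    then obtain q' where q': "q = y # q'" by (cases q) (auto simp: is_path_walk)
    show ?thesis
    proof (cases "x \<in> set q")
      case False
      then show ?thesis using q q' p Cons.prems
        by (intro exI[of _ "x # q"]) (auto simp: is_path_walk)
    next
      case True
      then obtain a b where ab: "q = a @ x # b" by (auto simp: in_set_conv_decomp)
      have "is_path E x (x # b) (last p)"
        using q(1) unfolding ab by (auto simp: is_path_walk successively_append_iff)
      moreover have "path_length l (x # b) \<le> path_length l (x # p)"
        using q(2) path_length_drop[of l "x # b" a] p unfolding ab by auto
      ultimately show ?thesis using \<open>p \<noteq> []\<close> by auto
    qed
  qed
qed simp

lemma path_length_join:
  "p \<noteq> [] \<Longrightarrow> q \<noteq> [] \<Longrightarrow> last p = hd q \<Longrightarrow>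
    path_length l (p @ tl q) = path_length l p + path_length l q"
proof (induction p)
  case (Cons x p)
  show ?case
  proof (cases p)
    case Nil
    then show ?thesis using Cons.prems by (cases q) auto
  next
    case (Cons y p')
    then show ?thesis using Cons.IH Cons.prems by auto
  qed
qed simp

lemma walk_join:
  "p \<noteq> [] \<Longrightarrow> q \<noteq> [] \<Longrightarrow> last p = hd q \<Longrightarrow> walk E p \<Longrightarrow> walk E q \<Longrightarrow> walk E (p @ tl q)"
proof (induction p)
  case (Cons x p)
  show ?case
  proof (cases p)
    case Nil
    then show ?thesis using Cons.prems by (cases q) auto
  next
    case (Cons y p')
    then show ?thesis using Cons.IH Cons.prems by auto
  qed
qed simp

text \<open>The two paths may share nodes, so their concatenation is only a walk and has to be
  shortcut; hence an inequality for the lengths.\<close>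

lemma is_path_trans:
  assumes "is_path E u p v" "is_path E v q w"
  shows "\<exists>r. is_path E u r w \<and> path_length l r \<le> path_length l p + path_length l q"
proof -
  have pq: "p \<noteq> []" "q \<noteq> []" "last p = hd q" "walk E p" "walk E q" "hd p = u" "last q = w"
    using assms by (auto simp: is_path_walk)
  have "last (p @ tl q) = w" using pq by (cases q) auto
  moreover have "hd (p @ tl q) = u" using pq by simp
  ultimately show ?thesis
    using walk_to_path[of "p @ tl q" E l] walk_join[OF pq(1-5)] path_length_join[OF pq(1-3), of l] pq(1)
    by auto
qed

lemma path_length_rev: "path_length l (rev p) = path_length l p"
proof (induction p)
  case (Cons x p)
  show ?case
  proof (cases p)
    case (Cons y p')
    have "path_length l (rev p @ tl [y, x]) = path_length l (rev p) + path_length l [y, x]"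
      by (rule path_length_join) (use Cons in auto)
    then show ?thesis using Cons.IH Cons by (simp add: insert_commute)
  qed simp
qed simp

lemma is_path_rev: "is_path E u p v \<Longrightarrow> is_path E v (rev p) u"
  by (auto simp: is_path_walk hd_rev last_rev insert_commute)

lemma is_path_mono: "is_path E u p v \<Longrightarrow> E \<subseteq> F \<Longrightarrow> is_path F u p v"
  by (auto simp: is_path_def)

lemma is_path_edge: "{u, v} \<in> E \<Longrightarrow> u \<noteq> v \<Longrightarrow> is_path E u [u, v] v"
  by (auto simp: is_path_walk)

text \<open>Replace each edge of the path by its detour and shortcut the result. This reduces the
  spanner condition on all node pairs to one on the edges.\<close>

lemma path_stretch:
  assumes "\<And>x y. {x, y} \<in> E \<Longrightarrow> \<exists>q. is_path F x q y \<and> real (path_length l q) \<le> \<alpha> * real (l {x, y})"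
  shows "is_path E u p v \<Longrightarrow> \<exists>q. is_path F u q v \<and> real (path_length l q) \<le> \<alpha> * real (path_length l p)"
proof (induction p arbitrary: u)
  case (Cons x p)
  have [simp]: "u = x" using Cons.prems by (simp add: is_path_walk)
  show ?case
  proof (cases p)
    case Nil
    then show ?thesis using Cons.prems by (intro exI[of _ "[x]"]) (auto simp: is_path_walk)
  next
    case (Cons y p')
    have p: "is_path E y p v" "{x, y} \<in> E"
      using Cons.prems Cons by (auto simp: is_path_walk)
    obtain q1 where q1: "is_path F x q1 y" "real (path_length l q1) \<le> \<alpha> * real (l {x, y})"
      using assms p by blast
    obtain q2 where q2: "is_path F y q2 v" "real (path_length l q2) \<le> \<alpha> * real (path_length l p)"
      using Cons.IH p by blast
    obtain q where q: "is_path F x q v" "path_length l q \<le> path_length l q1 + path_length l q2"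
      using is_path_trans[OF q1(1) q2(1), of l] by blast
    have "real (path_length l q) \<le> real (path_length l q1) + real (path_length l q2)" using q(2) by linarith
    also have "\<dots> \<le> \<alpha> * real (path_length l (x # p))"
      using q1 q2 Cons by (simp add: distrib_left)
    finally show ?thesis using q by auto
  qed
qed (simp add: is_path_walk)

section \<open>Distances and the edgewise criterion for spanners\<close>

lemma distance_le: "is_path E u p v \<Longrightarrow> distance E l u v \<le> ereal (real (path_length l p))"
  unfolding distance_def by (rule INF_lower) simp

text \<open>Path lengths are natural numbers, so the infimum is a minimum as soon as there is a
  path.\<close>

lemma distance_attained:
  assumes "is_path E u p v"
  shows "\<exists>q. is_path E u q v \<and> distance E l u v = ereal (real (path_length l q))"
proof -
  obtain q where q: "is_path E u q v" "\<And>r. is_path E u r v \<Longrightarrow> path_length l q \<le> path_length l r"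
    using ex_has_least_nat[of "\<lambda>p. is_path E u p v" p "path_length l"] assms by blast
  have "distance E l u v = ereal (real (path_length l q))"
    unfolding distance_def by (rule INF_eqI) (use q in auto)
  with q show ?thesis by blast
qed

lemma distance_no_path: "\<nexists>p. is_path E u p v \<Longrightarrow> distance E l u v = \<infinity>"
  by (simp add: distance_def top_ereal_def)

lemma spannerI:
  assumes "F \<subseteq> E" "1 \<le> \<alpha>"
    and "\<And>x y. {x, y} \<in> E \<Longrightarrow> \<exists>q. is_path F x q y \<and> real (path_length l q) \<le> \<alpha> * real (l {x, y})"
  shows "spanner \<alpha> V E l F"
  unfolding spanner_def
proof (intro conjI ballI)
  fix u v
  show "distance F l u v \<le> ereal \<alpha> * distance E l u v"
  proof (cases "\<exists>p. is_path E u p v")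
    case True
    then obtain p0 where "is_path E u p0 v" by blast
    from distance_attained[OF this, of l] obtain p
      where p: "is_path E u p v" "distance E l u v = ereal (real (path_length l p))" by blast
    from path_stretch[OF assms(3) p(1)]
    obtain q where q: "is_path F u q v" "real (path_length l q) \<le> \<alpha> * real (path_length l p)"
      by blast
    then show ?thesis using distance_le[OF q(1), of l] p(2) by (auto intro: order_trans)
  next
    case False
    then show ?thesis using distance_no_path[of E u v l] assms(2) by simp
  qed
qed fact

lemma spannerD:
  assumes "spanner \<alpha> V E l F" "{u, v} \<in> E" "u \<noteq> v" "u \<in> V" "v \<in> V" "1 \<le> \<alpha>"
  shows "\<exists>q. is_path F u q v \<and> real (path_length l q) \<le> \<alpha> * real (l {u, v})"
proof -
  have "distance E l u v \<le> ereal (real (l {u, v}))"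
    using distance_le[OF is_path_edge[OF assms(2,3)], of l] by simp
  then have "ereal \<alpha> * distance E l u v \<le> ereal \<alpha> * ereal (real (l {u, v}))"
    using assms(6) by (intro ereal_mult_left_mono) auto
  moreover have "distance F l u v \<le> ereal \<alpha> * distance E l u v"
    using assms by (auto simp: spanner_def)
  ultimately have le: "distance F l u v \<le> ereal (\<alpha> * real (l {u, v}))" by simp
  \<comment> \<open>The right-hand side of \<open>le\<close> is finite, whereas a missing path would
    make the left-hand side infinite.\<close>
  have "\<exists>p. is_path F u p v"
  proof (rule ccontr)
    assume "\<not> ?thesis"
    from distance_no_path[OF this, of l] le show False by simp
  qed
  then obtain p where "is_path F u p v" by blast
  from distance_attained[OF this, of l] le show ?thesis by auto
qed

text \<open>Turns the length bound of a detour into a bound on the number of its edges, and thus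
  into the out-degree bound of the conflict digraph.\<close>

lemma path_length_ge_hops:
  assumes "\<And>e. e \<in> E \<Longrightarrow> 1 \<le> l e" "walk E p"
  shows "length p - 1 \<le> path_length l p"
proof -
  have "(\<Sum>i<length p - 1. 1) \<le> (\<Sum>i<length p - 1. l {p ! i, p ! Suc i})"
    using assms by (intro sum_mono) (auto simp: successively_conv_nth)
  then show ?thesis by (simp add: path_length_def)
qed

definition path_edges :: "'v list \<Rightarrow> 'v set set" where
  "path_edges p = (\<lambda>i. {p ! i, p ! Suc i}) ` {..<length p - 1}"

text \<open>Separates the shape of a path from the edges it uses, so that passing to another edge
  set becomes an inclusion.\<close>

lemma is_path_edges: "is_path E u p v \<longleftrightarrow> is_path UNIV u p v \<and> path_edges p \<subseteq> E"
  by (auto simp: is_path_def path_edges_def)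

lemma card_path_edges: "card (path_edges p) \<le> length p - 1"
  unfolding path_edges_def by (rule order_trans[OF card_image_le]) auto

text \<open>Here \<open>r\<close> will be the direct edge, itself within the limit. If
  \<open>r\<close> is one of the two reported paths, the other one is a best alternative; if it is
  not, both reported paths are alternatives no longer than \<open>r\<close>. In each case
  \<open>b \<le> L\<close> decides. Lengths of at least 1 keep genuine values of \<open>b\<close>
  apart from the default 0.\<close>

lemma two_shortest_le_iff:
  assumes "two_shortest E l u v a b" "is_path E u r v" "path_length l r \<le> L"
    and "\<And>p. is_path E u p v \<Longrightarrow> p \<noteq> r \<Longrightarrow> 1 \<le> path_length l p"
    and "1 \<le> path_length l r"
  shows "0 < b \<and> b \<le> L \<longleftrightarrow> (\<exists>p. is_path E u p v \<and> p \<noteq> r \<and> path_length l p \<le> L)"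
  using assms(1) unfolding two_shortest_def Let_def
proof (elim disjE exE conjE bexE)
  fix p q
  assume pq: "p \<in> {p. is_path E u p v}" "q \<in> {p. is_path E u p v}" "p \<noteq> q" "a = path_length l p"
    "b = path_length l q" "a \<le> b" "\<forall>r\<in>{p. is_path E u p v} - {p, q}. b \<le> path_length l r"
  have "0 < b" using pq assms(4)[of q] assms(5) by (cases "q = r") auto
  moreover have "\<exists>p. is_path E u p v \<and> p \<noteq> r \<and> path_length l p \<le> L" if "b \<le> L"
    by (rule exI[of _ "if p = r then q else p"]) (use pq that in auto)
  moreover have "b \<le> L" if "is_path E u t v" "t \<noteq> r" "path_length l t \<le> L" for t
  proof -
    \<comment> \<open>If \<open>t\<close> and \<open>r\<close> are the two reported paths, one of
      them is \<open>q\<close>, of length \<open>b\<close>; otherwise one of them is among the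
      remaining paths.\<close>
    have "b \<le> path_length l t \<or> b \<le> path_length l r"
      using pq that assms(2) by auto
    then show ?thesis using that assms(3) by linarith
  qed
  ultimately show ?thesis by blast
next
  assume "{p. is_path E u p v} = {}"
  with assms(2) show ?thesis by blast
next
  fix p assume "{p. is_path E u p v} = {p}" and b: "b = 0"
  then have "t = p" if "is_path E u t v" for t using that by blast
  with assms(2) have "t = r" if "is_path E u t v" for t using that by blast
  with b show ?thesis by blast
qed

text \<open>One edge of length \<open>Suc L\<close> already exceeds the budget, so a path within the
  budget under \<open>l'\<close> avoids \<open>X\<close> and has the same length under
  \<open>l\<close>. Deletion is thus simulated on an unchanged edge set.\<close>

lemma shortest_path_avoiding:
  assumes "\<And>e. l' e = (if e \<in> X then Suc L else l e)"
    and "is_path E u p v" "\<And>q. is_path E u q v \<Longrightarrow> path_length l' p \<le> path_length l' q"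
  shows "path_length l' p \<le> L \<longleftrightarrow> (\<exists>q. is_path (E - X) u q v \<and> path_length l q \<le> L)"
proof
  assume le: "path_length l' p \<le> L"
  have "{p ! i, p ! Suc i} \<notin> X" if "i < length p - 1" for i
  proof
    assume "{p ! i, p ! Suc i} \<in> X"
    then have "Suc L \<le> path_length l' p"
      unfolding path_length_def using that assms(1)
        member_le_sum[of i "{..<length p - 1}" "\<lambda>i. l' {p ! i, p ! Suc i}"] by simp
    with le show False by simp
  qed
  then have "is_path (E - X) u p v" "path_length l p = path_length l' p"
    using assms by (auto simp: is_path_def path_length_def)
  then show "\<exists>q. is_path (E - X) u q v \<and> path_length l q \<le> L" using le by auto
next
  assume "\<exists>q. is_path (E - X) u q v \<and> path_length l q \<le> L"
  then obtain q where q: "is_path (E - X) u q v" "path_length l q \<le> L" by blast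
  have "path_length l' q = path_length l q"
    unfolding path_length_def using q(1) assms(1) by (intro sum.cong) (auto simp: is_path_def)
  then show "path_length l' p \<le> L" using q assms(3)[of q] is_path_mono[of "E - X" u q v E] by auto
qed

section \<open>Independent sets in digraphs of bounded out-degree\<close>

text \<open>The out-degrees bound the number of arcs by d |V|, so some node \<open>v\<close> has
  in-degree at most \<open>d\<close>. Choosing \<open>v\<close> and discarding its at most 2 d
  neighbours costs 2 d + 1 nodes per chosen node, whence the constant. Out-neighbours outside
  \<open>V\<close> do not count, and loops are harmless.\<close>

lemma independent_set:
  fixes A :: "'i \<Rightarrow> 'i set"
  assumes "finite V" "\<And>v. v \<in> V \<Longrightarrow> card (A v \<inter> V) \<le> d" "(2 * d + 1) * k \<le> card V"
  shows "\<exists>J\<subseteq>V. card J = k \<and> (\<forall>i\<in>J. \<forall>j\<in>J. i \<noteq> j \<longrightarrow> j \<notin> A i)"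
  using assms
proof (induction k arbitrary: V)
  case 0
  then show ?case by (intro exI[of _ "{}"]) auto
next
  case (Suc k)
  have fin: "finite V" by fact
  define In where "In v = {u \<in> V. v \<in> A u}" for v
  \<comment> \<open>Double counting of the arcs inside \<open>V\<close>.\<close>
  have "(\<Sum>v\<in>V. card (In v)) = (\<Sum>v\<in>V. \<Sum>u\<in>V. if v \<in> A u then 1 else 0)"
    by (intro sum.cong refl) (auto simp: In_def card_eq_sum sum.inter_filter[OF fin] simp del: sum_constant intro!: sum.cong)
  also have "\<dots> = (\<Sum>u\<in>V. \<Sum>v\<in>V. if v \<in> A u then 1 else 0)" by (rule sum.swap)
  also have "\<dots> = (\<Sum>u\<in>V. card (A u \<inter> V))"
    by (intro sum.cong refl) (auto simp: card_eq_sum sum.inter_filter[OF fin, symmetric] Int_def conj_commute simp del: sum_constant intro!: arg_cong[where f = card])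
  also have "\<dots> \<le> (\<Sum>u\<in>V. d)" by (rule sum_mono) (use Suc in auto)
  finally have le: "(\<Sum>v\<in>V. card (In v)) \<le> d * card V" by (simp add: mult.commute)
  have "\<exists>v\<in>V. card (In v) \<le> d"
  proof (rule ccontr)
    assume "\<not> (\<exists>v\<in>V. card (In v) \<le> d)"
    then have "(\<Sum>v\<in>V. Suc d) \<le> (\<Sum>v\<in>V. card (In v))" by (intro sum_mono) auto
    then have "card V * Suc d \<le> d * card V" using le by (simp add: mult.commute)
    moreover have "0 < card V" using Suc.prems(3) by simp
    ultimately show False by simp
  qed
  then obtain v where v: "v \<in> V" "card (In v) \<le> d" by blast
  define V' where "V' = V - ({v} \<union> (A v \<inter> V) \<union> In v)"
  have "card ({v} \<union> (A v \<inter> V) \<union> In v) \<le> 1 + d + d"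
    using v Suc.prems(2)[OF v(1)] card_Un_le[of "{v} \<union> (A v \<inter> V)" "In v"] card_Un_le[of "{v}" "A v \<inter> V"]
    by simp
  then have "card V - (2 * d + 1) \<le> card V'"
    unfolding V'_def using diff_card_le_card_Diff[of "{v} \<union> (A v \<inter> V) \<union> In v" V] fin
    by (auto simp: In_def)
  then have "(2 * d + 1) * k \<le> card V'" using Suc.prems(3) by simp
  moreover have "card (A u \<inter> V') \<le> d" if "u \<in> V'" for u
    by (rule order_trans[OF card_mono Suc.prems(2)[of u]]) (use that fin in \<open>auto simp: V'_def\<close>)
  ultimately obtain J where J: "J \<subseteq> V'" "card J = k" "\<forall>i\<in>J. \<forall>j\<in>J. i \<noteq> j \<longrightarrow> j \<notin> A i"
    using Suc.IH[of V'] fin by (auto simp: V'_def)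
  have "v \<notin> J" "finite J" using J(1) fin by (auto simp: V'_def intro: finite_subset)
  then show ?case using J v by (intro exI[of _ "insert v J"]) (auto simp: V'_def In_def)
qed

section \<open>Enumeration of tuples\<close>

text \<open>Numbers the tuples: those of length r over a list of length b correspond to the numbers
  below b^r.\<close>

definition digit :: "nat \<Rightarrow> nat \<Rightarrow> nat \<Rightarrow> nat" where
  "digit b k j = k div b ^ j mod b"

lemma digits_surj:
  assumes "\<And>j. j < r \<Longrightarrow> d j < b"
  shows "\<exists>k < b ^ r. \<forall>j<r. digit b k j = d j"
  using assms
proof (induction r)
  case (Suc r)
  then obtain k where k: "k < b ^ r" "\<forall>j<r. digit b k j = d j" by auto
  have b: "0 < b" using Suc.prems[of r] by simp
  let ?k = "k + d r * b ^ r"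
  have "digit b ?k j = d j" if "j < Suc r" for j
  proof (cases "j = r")
    case True
    then show ?thesis using k b Suc.prems[of r] by (simp add: digit_def)
  next
    case False
    then have j: "j < r" using that by simp
    \<comment> \<open>The new top digit contributes a multiple of b^(j+1), which is invisible to
      digit \<open>j\<close>.\<close>
    then have "d r * b ^ r = b ^ j * (b * (d r * b ^ (r - Suc j)))"
      by (simp flip: power_Suc power_add)
    then have "?k div b ^ j = (k + b ^ j * (b * (d r * b ^ (r - Suc j)))) div b ^ j"
      by (rule arg_cong)
    also have "\<dots> = b * (d r * b ^ (r - Suc j)) + k div b ^ j"
      using b by (subst div_mult_self2) auto
    finally have "?k div b ^ j = b * (d r * b ^ (r - Suc j)) + k div b ^ j" .
    then have "digit b ?k j = digit b k j" by (simp add: digit_def)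
    then show ?thesis using k j by simp
  qed
  moreover have "?k < b ^ Suc r"
  proof -
    have "?k < b ^ r + d r * b ^ r" using k by simp
    also have "\<dots> = Suc (d r) * b ^ r" by simp
    also have "\<dots> \<le> b * b ^ r" using Suc.prems[of r] by (intro mult_right_mono) auto
    finally show ?thesis by simp
  qed
  ultimately show ?case by blast
qed simp

text \<open>Tuples may repeat entries, which is how one fixed length \<open>r\<close> also reaches
  smaller sets.\<close>

lemma tuple_enumeration:
  assumes "finite X" "card X \<le> r" "X \<noteq> {}" "X \<subseteq> set xs"
  shows "\<exists>k < length xs ^ r. (\<lambda>j. xs ! digit (length xs) k j) ` {..<r} = X"
proof -
  have "\<exists>f. f ` {..<r} = X"
  proof -
    obtain g where g: "bij_betw g {..<card X} X"
      using ex_bij_betw_nat_finite[OF assms(1)] by (auto simp: atLeast0LessThan)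
    obtain x where x: "x \<in> X" using assms by blast
    \<comment> \<open>Positions from \<open>card X\<close> on are padded with some element of
      \<open>X\<close>, which therefore must be nonempty.\<close>
    have "(\<lambda>j. if j < card X then g j else x) ` {..<r} = X"
    proof (intro equalityI subsetI)
      fix y assume "y \<in> X"
      then obtain j where "j < card X" "y = g j" using g by (auto simp: bij_betw_def)
      then show "y \<in> (\<lambda>j. if j < card X then g j else x) ` {..<r}"
        using assms(2) by (intro image_eqI[of _ _ j]) auto
    qed (use g x in \<open>auto simp: bij_betw_def split: if_splits\<close>)
    then show ?thesis by blast
  qed
  then obtain f where f: "f ` {..<r} = X" by blast
  have "\<forall>j. \<exists>i. j < r \<longrightarrow> i < length xs \<and> xs ! i = f j"
    using f assms(4) by (metis imageI in_set_conv_nth lessThan_iff subsetD)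
  then obtain d where d: "\<And>j. j < r \<Longrightarrow> d j < length xs \<and> xs ! d j = f j" by metis
  then obtain k where "k < length xs ^ r" "\<forall>j<r. digit (length xs) k j = d j"
    using digits_surj[of r d "length xs"] by blast
  moreover from this have "(\<lambda>j. xs ! digit (length xs) k j) ` {..<r} = f ` {..<r}"
    using d by (intro image_cong) auto
  ultimately show ?thesis using f by auto
qed

text \<open>\<open>c j\<close> is the carry into position \<open>j\<close> when \<open>k\<close> is incremented.\<close>

lemma digit_Suc_carry:
  fixes k :: nat
  assumes "0 < b"
  defines "c \<equiv> \<lambda>j::nat. Suc k div b ^ j - k div b ^ j"
  shows "(digit b k j + c j) div b = c (Suc j)" "(digit b k j + c j) mod b = digit b (Suc k) j"
proof -
  have le: "k div b ^ j \<le> Suc k div b ^ j" by (simp add: div_le_mono)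
  have eq: "k div b ^ j = b * (k div b ^ Suc j) + digit b k j"
    by (simp add: digit_def div_mult2_eq mult.commute[of b "b ^ j"])
  \<comment> \<open>Both quotients at level \<open>j\<close> share the multiple
    \<open>b * (k div b ^ Suc j)\<close>. For \<open>Suc k\<close>, digit plus carry is left over,
    and dividing this by \<open>b\<close> yields the next carry and the new digit.\<close>
  have eq': "Suc k div b ^ j = b * (k div b ^ Suc j) + (digit b k j + c j)"
    using le eq by (simp add: c_def)
  have "Suc k div b ^ Suc j = (b * (k div b ^ Suc j) + (digit b k j + c j)) div b"
    using eq' by (simp add: div_mult2_eq mult.commute[of b "b ^ j"])
  also have "\<dots> = k div b ^ Suc j + (digit b k j + c j) div b" using assms by simp
  finally show "(digit b k j + c j) div b = c (Suc j)" by (simp add: c_def)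
  show "(digit b k j + c j) mod b = digit b (Suc k) j" unfolding digit_def[of b "Suc k"] eq' by simp
qed

section \<open>Deletable edges\<close>

text \<open>Edges are addressed by their position in the input, as the program does. In a valid
  graph positions and edges correspond one to one (\<open>inj_on_edge_at\<close>), so sums and set
  differences carry over.\<close>

definition edge_at :: "'a lgraph_scheme \<Rightarrow> nat \<Rightarrow> nat set" where
  "edge_at G i = (case edge_list G ! i of (u, v) \<Rightarrow> {u, v})"

lemma edges_conv: "edges G = edge_at G ` {..<size_edges G}"
proof -
  have "set (edge_list G) = (!) (edge_list G) ` {..<size_edges G}"
    using arg_cong[OF map_nth[of "edge_list G"], of set]
    by (simp add: size_edges_def atLeast0LessThan)
  then show ?thesis by (auto simp: edges_def edge_at_def image_image)
qed

lemma inj_on_edge_at: "valid_graph G \<Longrightarrow> inj_on (edge_at G) {..<size_edges G}"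
  by (auto simp: valid_graph_def size_edges_def inj_on_def edge_at_def distinct_conv_nth)

lemma valid_graph_edge:
  assumes "valid_graph G" "i < size_edges G" "edge_list G ! i = (u, v)"
  shows "u < size_nodes G" "v < size_nodes G" "u \<noteq> v" "{u, v} \<in> edges G"
    "edge_at G i = {u, v}" "1 \<le> len G {u, v}"
proof -
  have "(u, v) \<in> set (edge_list G)" using assms by (metis nth_mem size_edges_def)
  then show "u < size_nodes G" "v < size_nodes G" "u \<noteq> v" "{u, v} \<in> edges G"
    "edge_at G i = {u, v}" "1 \<le> len G {u, v}"
    using assms by (auto simp: valid_graph_def nodes_def edges_def edge_at_def)
qed

text \<open>A simple path visits \<open>u\<close> only at its start and \<open>v\<close> only at its
  end, so it can use the edge between them only if it consists of that edge. Deleting the edge thus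
  excludes a single path, which is why two shortest paths carry enough information.\<close>

lemma is_path_avoiding_edge:
  assumes "is_path E u p v" "u \<noteq> v"
  shows "is_path (E - {{u, v}}) u p v \<longleftrightarrow> p \<noteq> [u, v]"
proof
  assume "p \<noteq> [u, v]"
  have p: "p \<noteq> []" "hd p = u" "last p = v" "distinct p" using assms by (auto simp: is_path_def)
  have "{p ! i, p ! Suc i} \<noteq> {u, v}" if i: "Suc i < length p" for i
  proof
    assume "{p ! i, p ! Suc i} = {u, v}"
    moreover have u: "p ! 0 = u" and v: "p ! (length p - 1) = v"
      using p by (auto simp: hd_conv_nth last_conv_nth)
    moreover have "p ! Suc i \<noteq> u" using u p i nth_eq_iff_index_eq[of p "Suc i" 0] by auto
    ultimately have "p ! i = p ! 0" "p ! Suc i = p ! (length p - 1)" by (auto simp: doubleton_eq_iff)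
    then have "i = 0" "Suc i = length p - 1"
      using p i nth_eq_iff_index_eq[of p i 0] nth_eq_iff_index_eq[of p "Suc i" "length p - 1"] by auto
    then have "length p = 2" by simp
    then obtain x y where "p = [x, y]" by (auto simp: length_Suc_conv numeral_2_eq_2)
    with p \<open>p \<noteq> [u, v]\<close> show False by auto
  qed
  then show "is_path (E - {{u, v}}) u p v" using assms by (auto simp: is_path_def)
next
  assume "is_path (E - {{u, v}}) u p v"
  then show "p \<noteq> [u, v]" by (intro notI) (simp add: is_path_walk)
qed

text \<open>The floor of stretch times edge length, in integer arithmetic. As path lengths are
  natural numbers, comparing with the floor is exact (\<open>le_bound_iff\<close>).\<close>

definition bound :: "spanner_instance \<Rightarrow> nat \<Rightarrow> nat" where
  "bound I i = stretch_num I * len I (edge_at I i) div stretch_den I"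

definition replaceable :: "spanner_instance \<Rightarrow> nat set \<Rightarrow> nat \<Rightarrow> bool" where
  "replaceable I J i \<longleftrightarrow> (case edge_list I ! i of (u, v) \<Rightarrow>
     \<exists>p. is_path (edges I - edge_at I ` J) u p v \<and> path_length (len I) p \<le> bound I i)"

definition feasible :: "spanner_instance \<Rightarrow> nat set \<Rightarrow> bool" where
  "feasible I J \<longleftrightarrow> (\<forall>i\<in>J. replaceable I J i)"

definition saved :: "spanner_instance \<Rightarrow> nat set \<Rightarrow> nat" where
  "saved I J = (\<Sum>i\<in>J. weight I (edge_at I i))"

text \<open>Weight 0 is excluded: deleting such an edge saves nothing, and weights of at least 1
  make \<open>W\<close> deleted edges sufficient.\<close>

definition deletable :: "spanner_instance \<Rightarrow> nat \<Rightarrow> bool" where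
  "deletable I i \<longleftrightarrow> 0 < weight I (edge_at I i) \<and> replaceable I {i} i"

lemma stretch_quotient:
  assumes "1 \<le> stretch I"
  shows "0 < stretch_den I" "stretch_den I \<le> stretch_num I"
    "(of_rat (stretch I) :: real) = real (stretch_num I) / real (stretch_den I)"
proof -
  obtain p q where pq: "quotient_of (stretch I) = (p, q)" by (cases "quotient_of (stretch I)")
  have q: "0 < q" using quotient_of_denom_pos[OF pq] .
  have r: "stretch I = of_int p / of_int q" using quotient_of_div[OF pq] .
  have le: "q \<le> p" using assms q unfolding r by (simp add: le_divide_eq)
  show "0 < stretch_den I" "stretch_den I \<le> stretch_num I"
    using pq q le by (auto simp: stretch_den_def stretch_num_def)
  show "(of_rat (stretch I) :: real) = real (stretch_num I) / real (stretch_den I)"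
    using pq q le by (simp add: r stretch_den_def stretch_num_def of_rat_divide)
qed

lemma le_bound_iff:
  assumes "1 \<le> stretch I"
  shows "x \<le> bound I i \<longleftrightarrow> real x \<le> of_rat (stretch I) * real (len I (edge_at I i))"
proof -
  note st = stretch_quotient[OF assms]
  have "x \<le> bound I i \<longleftrightarrow> x * stretch_den I \<le> stretch_num I * len I (edge_at I i)"
    unfolding bound_def using st(1) by (simp add: less_eq_div_iff_mult_less_eq)
  also have "\<dots> \<longleftrightarrow> real (x * stretch_den I) \<le> real (stretch_num I * len I (edge_at I i))"
    by (simp only: of_nat_le_iff)
  also have "\<dots> \<longleftrightarrow> real x \<le> of_rat (stretch I) * real (len I (edge_at I i))"
    using st by (simp add: le_divide_eq)
  finally show ?thesis .
qed

lemma len_le_bound: "1 \<le> stretch I \<Longrightarrow> len I (edge_at I i) \<le> bound I i"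
  unfolding le_bound_iff by (simp add: mult_le_cancel_right1)

text \<open>With fewer deletions every detour stays intact.\<close>

lemma feasible_subset: "feasible I J \<Longrightarrow> J' \<subseteq> J \<Longrightarrow> feasible I J'"
  unfolding feasible_def replaceable_def
  by (fastforce split: prod.splits elim: is_path_mono)

lemma feasible_deletable:
  assumes "feasible I J" "i \<in> J" "0 < weight I (edge_at I i)"
  shows "deletable I i"
  using feasible_subset[OF assms(1), of "{i}"] assms(2,3) by (simp add: feasible_def deletable_def)

text \<open>By the edgewise criterion only the deleted edges need a detour, since a kept edge is its
  own.\<close>

lemma witness_iff:
  assumes valid: "valid_spanner_instance I" and J: "J \<subseteq> {..<size_edges I}"
  shows "witness I (edges I - edge_at I ` J) \<longleftrightarrow> goal I \<le> saved I J \<and> feasible I J"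
proof -
  have vg: "valid_graph I" and st: "1 \<le> stretch I" using valid by (auto simp: valid_spanner_instance_def)
  let ?F = "edges I - edge_at I ` J"
  have "edges I - ?F = edge_at I ` J" using J by (auto simp: edges_conv)
  then have "sum (weight I) (edges I - ?F) = saved I J"
    using inj_on_subset[OF inj_on_edge_at[OF vg] J] by (simp add: saved_def sum.reindex)
  moreover have "spanner (of_rat (stretch I)) (nodes I) (edges I) (len I) ?F \<longleftrightarrow> feasible I J"
  proof
    assume sp: "spanner (of_rat (stretch I)) (nodes I) (edges I) (len I) ?F"
    show "feasible I J" unfolding feasible_def
    proof
      fix i assume "i \<in> J"
      then have i: "i < size_edges I" using J by auto
      obtain u v where uv: "edge_list I ! i = (u, v)" by (cases "edge_list I ! i")
      note e = valid_graph_edge[OF vg i uv]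
      obtain q where "is_path ?F u q v" "real (path_length (len I) q) \<le> of_rat (stretch I) * real (len I {u, v})"
        using spannerD[OF sp e(4,3)] e(1,2) st by (auto simp: nodes_def)
      then show "replaceable I J i" using le_bound_iff[OF st, of _ i] e(5) uv by (auto simp: replaceable_def)
    qed
  next
    assume fe: "feasible I J"
    show "spanner (of_rat (stretch I)) (nodes I) (edges I) (len I) ?F"
    proof (rule spannerI)
      fix x y assume xy: "{x, y} \<in> edges I"
      then obtain i where i: "i < size_edges I" "edge_at I i = {x, y}" by (auto simp: edges_conv)
      obtain u v where uv: "edge_list I ! i = (u, v)" by (cases "edge_list I ! i")
      note e = valid_graph_edge[OF vg i(1) uv]
      have le: "real n \<le> of_rat (stretch I) * real (len I {x, y})" if "n \<le> bound I i" for n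
        using that le_bound_iff[OF st, of n i] i by simp
      have "\<exists>q. is_path ?F u q v \<and> path_length (len I) q \<le> bound I i"
      proof (cases "i \<in> J")
        case True
        then have "replaceable I J i" using fe by (simp add: feasible_def)
        then show ?thesis using uv by (simp add: replaceable_def)
      next
        case False
        then have "{u, v} \<notin> edge_at I ` J"
          using inj_on_image_mem_iff[OF inj_on_edge_at[OF vg] _ J, of i] i e(5) by auto
        then have "is_path ?F u [u, v] v" using e by (intro is_path_edge) auto
        then show ?thesis using len_le_bound[OF st, of i] e(5) by force
      qed
      then obtain q where q: "is_path ?F u q v" "path_length (len I) q \<le> bound I i" by blast
      \<comment> \<open>The input may list the end nodes of edge \<open>i\<close> in the opposite
        order; then the detour is reversed.\<close>
      have "(x = u \<and> y = v) \<or> (x = v \<and> y = u)" using e(5) i(2) by (auto simp: doubleton_eq_iff)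
      then show "\<exists>q. is_path ?F x q y \<and> real (path_length (len I) q) \<le> of_rat (stretch I) * real (len I {x, y})"
        using q is_path_rev[OF q(1)] le path_length_rev[of "len I" q] by metis
    qed (use st in auto)
  qed
  ultimately show ?thesis by (auto simp: witness_def)
qed

lemma witness_feasible:
  assumes "valid_spanner_instance I" "witness I F"
  shows "\<exists>J\<subseteq>{..<size_edges I}. goal I \<le> saved I J \<and> feasible I J"
proof -
  let ?J = "{i \<in> {..<size_edges I}. edge_at I i \<notin> F}"
  have "F \<subseteq> edges I" using assms(2) by (auto simp: witness_def spanner_def)
  then have "edges I - edge_at I ` ?J = F" by (auto simp: edges_conv)
  then show ?thesis using witness_iff[OF assms(1), of ?J] assms(2) by (intro exI[of _ ?J]) auto
qed

text \<open>By \<open>is_path_avoiding_edge\<close> the detours of an edge are exactly the paths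
  other than the edge itself, so the second of the two shortest lengths decides.\<close>

lemma deletable_iff_two_shortest:
  assumes "valid_graph I" "1 \<le> stretch I" "i < size_edges I" "edge_list I ! i = (u, v)"
    and "two_shortest (edges I) (len I) u v a b"
  shows "deletable I i \<longleftrightarrow> 0 < weight I (edge_at I i) \<and> 0 < b \<and> b \<le> bound I i"
proof -
  note e = valid_graph_edge[OF assms(1,3,4)]
  have "0 < b \<and> b \<le> bound I i \<longleftrightarrow>
    (\<exists>p. is_path (edges I) u p v \<and> p \<noteq> [u, v] \<and> path_length (len I) p \<le> bound I i)"
  proof (rule two_shortest_le_iff[OF assms(5)])
    show "is_path (edges I) u [u, v] v" using e by (intro is_path_edge) auto
    show "path_length (len I) [u, v] \<le> bound I i" using len_le_bound[OF assms(2), of i] e by simp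
    fix p assume p: "is_path (edges I) u p v"
    have "length p \<noteq> 1" using p e(3) by (auto simp: is_path_def length_Suc_conv)
    then have "1 \<le> length p - 1" using p by (cases p) (auto simp: is_path_def Suc_le_eq)
    also have "\<dots> \<le> path_length (len I) p"
      using path_length_ge_hops[of "edges I" "len I" p] p assms(1)
      by (auto simp: valid_graph_def is_path_walk)
    finally show "1 \<le> path_length (len I) p" .
  qed (use e in simp)
  also have "\<dots> \<longleftrightarrow> replaceable I {i} i"
    using is_path_avoiding_edge[of "edges I" u _ v] e(3,5) assms(4) is_path_mono[of "edges I - {{u,v}}" u _ v "edges I"]
    by (auto simp: replaceable_def)
  finally show ?thesis by (auto simp: deletable_def)
qed

text \<open>Completeness of \<open>xs\<close> for the search, phrased with tuple numbers because
  these are what the loop runs through. If all tuples fail, there is no witness.\<close>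

definition covers :: "spanner_instance \<Rightarrow> nat list \<Rightarrow> bool" where
  "covers I xs \<longleftrightarrow> ((\<exists>F. witness I F) \<longrightarrow>
     (\<exists>k < length xs ^ goal I. let X = (\<lambda>j. xs ! digit (length xs) k j) ` {..<goal I}
        in goal I \<le> saved I X \<and> feasible I X))"

lemma coversI:
  assumes "1 \<le> goal I"
    and "(\<exists>F. witness I F) \<Longrightarrow> \<exists>X\<subseteq>set xs. card X \<le> goal I \<and> goal I \<le> saved I X \<and> feasible I X"
  shows "covers I xs"
  unfolding covers_def Let_def
proof
  assume "\<exists>F. witness I F"
  then obtain X where X: "X \<subseteq> set xs" "card X \<le> goal I" "goal I \<le> saved I X" "feasible I X"
    using assms(2) by blast
  \<comment> \<open>A goal of at least 1 excludes the empty solution, which padded tuples of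
    positive length cannot represent.\<close>
  have "X \<noteq> {}" using X(3) assms(1) by (auto simp: saved_def)
  moreover have "finite X" using X(1) finite_subset by blast
  ultimately show "\<exists>k < length xs ^ goal I.
    goal I \<le> saved I ((\<lambda>j. xs ! digit (length xs) k j) ` {..<goal I}) \<and>
    feasible I ((\<lambda>j. xs ! digit (length xs) k j) ` {..<goal I})"
    using tuple_enumeration[OF _ X(2) _ X(1)] X(3,4) by metis
qed

lemma covers_single:
  assumes "1 \<le> goal I" "deletable I i" "goal I \<le> weight I (edge_at I i)"
  shows "covers I [i]"
  by (rule coversI, fact, intro exI[of _ "{i}"])
    (use assms in \<open>auto simp: saved_def feasible_def deletable_def\<close>)

text \<open>From any solution drop the edges of weight 0; each remaining edge is deletable by
  itself. If more than \<open>W\<close> remain, any \<open>W\<close> of them already weigh at least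
  \<open>W\<close>.\<close>

lemma covers_deletable:
  assumes "valid_spanner_instance I" "1 \<le> goal I"
  shows "covers I (filter (deletable I) [0..<size_edges I])"
proof (rule coversI, fact)
  assume "\<exists>F. witness I F"
  then obtain J where J: "J \<subseteq> {..<size_edges I}" "goal I \<le> saved I J" "feasible I J"
    using witness_feasible[OF assms(1)] by blast
  have finJ: "finite J" using J(1) finite_subset by blast
  define P where "P = {i \<in> J. 0 < weight I (edge_at I i)}"
  have P: "P \<subseteq> {i. i < size_edges I \<and> deletable I i}"
    using feasible_deletable[OF J(3)] J(1) by (auto simp: P_def)
  have "saved I P = saved I J"
    unfolding saved_def using finJ by (intro sum.mono_neutral_left) (auto simp: P_def)
  then have sP: "goal I \<le> saved I P" using J by simp
  have fP: "feasible I P" by (rule feasible_subset[OF J(3)]) (auto simp: P_def)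
  show "\<exists>X\<subseteq>set (filter (deletable I) [0..<size_edges I]). card X \<le> goal I \<and> goal I \<le> saved I X \<and> feasible I X"
  proof (cases "card P \<le> goal I")
    case True
    then show ?thesis using P sP fP by (intro exI[of _ P]) auto
  next
    case False
    then obtain X where X: "X \<subseteq> P" "card X = goal I" using obtain_subset_with_card_n[of "goal I" P] by auto
    have "card X \<le> saved I X" unfolding saved_def card_eq_sum
      using X(1) by (intro sum_mono) (auto simp: P_def)
    then show ?thesis using X P feasible_subset[OF fP] by (intro exI[of _ X]) auto
  qed
qed

text \<open>So many candidates make the instance solvable outright. In the digraph with an arc from
  \<open>i\<close> to \<open>j\<close> if the chosen detour of \<open>i\<close> runs through edge
  \<open>j\<close>, an independent set of size \<open>W\<close> can be deleted at once.\<close>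

lemma covers_many:
  assumes vg: "valid_graph I" and W: "1 \<le> goal I" and d: "distinct xs"
    and xs: "\<And>i. i \<in> set xs \<Longrightarrow> i < size_edges I \<and> deletable I i \<and> bound I i \<le> d"
    and len: "(2 * d + 1) * goal I \<le> length xs"
  shows "covers I xs"
proof (rule coversI, fact)
  have "\<exists>p. i \<in> set xs \<longrightarrow> (is_path (edges I - {edge_at I i}) (fst (edge_list I ! i)) p (snd (edge_list I ! i))
      \<and> path_length (len I) p \<le> bound I i)" for i
    using xs[of i] by (auto simp: deletable_def replaceable_def split: prod.splits)
  then obtain p where p: "\<And>i. i \<in> set xs \<Longrightarrow>
     is_path (edges I - {edge_at I i}) (fst (edge_list I ! i)) (p i) (snd (edge_list I ! i))
      \<and> path_length (len I) (p i) \<le> bound I i" by metis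
  define A where "A i = {j. edge_at I j \<in> path_edges (p i)}" for i
  have "card (A i \<inter> set xs) \<le> d" if i: "i \<in> set xs" for i
  proof -
    \<comment> \<open>Distinct positions are distinct edges of the detour, whose length of at most
      \<open>d\<close> bounds their number.\<close>
    have "inj_on (edge_at I) (A i \<inter> set xs)"
      by (rule inj_on_subset[OF inj_on_edge_at[OF vg]]) (use xs in auto)
    then have "card (A i \<inter> set xs) \<le> card (path_edges (p i))"
      by (rule card_inj_on_le) (auto simp: A_def path_edges_def)
    also have "\<dots> \<le> length (p i) - 1" by (rule card_path_edges)
    also have "\<dots> \<le> path_length (len I) (p i)"
      using p[OF i] vg by (intro path_length_ge_hops[of "edges I"])
        (auto simp: valid_graph_def is_path_walk intro: successively_mono)
    also have "\<dots> \<le> d" using p[OF i] xs[OF i] by linarith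
    finally show ?thesis .
  qed
  then obtain J where J: "J \<subseteq> set xs" "card J = goal I" "\<And>i j. i \<in> J \<Longrightarrow> j \<in> J \<Longrightarrow> i \<noteq> j \<Longrightarrow> j \<notin> A i"
    using independent_set[of "set xs" A d "goal I"] len distinct_card[OF d] by auto
  have "card J \<le> saved I J" unfolding saved_def card_eq_sum
    using J(1) xs by (intro sum_mono) (auto simp: deletable_def Suc_le_eq)
  moreover have "feasible I J" unfolding feasible_def
  proof
    fix i assume i: "i \<in> J"
    obtain u v where uv: "edge_list I ! i = (u, v)" by (cases "edge_list I ! i")
    have pi: "is_path (edges I - {edge_at I i}) u (p i) v" "path_length (len I) (p i) \<le> bound I i"
      using p[of i] i J(1) uv by auto
    \<comment> \<open>The detour avoids its own edge by choice and the other edges of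
      \<open>J\<close> by independence.\<close>
    have "is_path (edges I - edge_at I ` J) u (p i) v"
      using pi(1) J(3)[OF i] unfolding is_path_edges[of "edges I - {edge_at I i}"]
        is_path_edges[of "edges I - edge_at I ` J"] by (auto simp: A_def)
    then show "replaceable I J i" using pi(2) uv by (auto simp: replaceable_def)
  qed
  ultimately show "\<exists>X\<subseteq>set xs. card X \<le> goal I \<and> goal I \<le> saved I X \<and> feasible I X"
    using J by auto
qed

section \<open>Reasoning about RAM programs\<close>

text \<open>Preserved by every execution (\<open>exec_bounded\<close>), so that reading memory never
  overflows and only constants, sums and products have to be estimated.\<close>

definition bounded :: "nat \<Rightarrow> mem \<Rightarrow> bool" where
  "bounded B s \<longleftrightarrow> (\<forall>x. reg s x < B) \<and> (\<forall>a i. arr s a i < B)"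

lemma boundedD: "bounded B s \<Longrightarrow> reg s x < B" "bounded B s \<Longrightarrow> arr s a i < B"
  by (auto simp: bounded_def)

text \<open>Syntactic bounds on the effect of a program. They also apply to the subroutines, whose
  code is arbitrary.\<close>

fun written_regs :: "com \<Rightarrow> nat set" where
  "written_regs Skip = {}"
| "written_regs (Assign x e) = {x}"
| "written_regs (Store a i e) = {}"
| "written_regs (Seq c d) = written_regs c \<union> written_regs d"
| "written_regs (Cond e c d) = written_regs c \<union> written_regs d"
| "written_regs (While e c) = written_regs c"

fun written_arrs :: "com \<Rightarrow> nat set" where
  "written_arrs Skip = {}"
| "written_arrs (Assign x e) = {}"
| "written_arrs (Store a i e) = {a}"
| "written_arrs (Seq c d) = written_arrs c \<union> written_arrs d"
| "written_arrs (Cond e c d) = written_arrs c \<union> written_arrs d"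
| "written_arrs (While e c) = written_arrs c"

definition frame :: "nat set \<Rightarrow> nat set \<Rightarrow> mem \<Rightarrow> mem \<Rightarrow> bool" where
  "frame R A s s' \<longleftrightarrow> (\<forall>x. x \<notin> R \<longrightarrow> reg s' x = reg s x) \<and> (\<forall>a. a \<notin> A \<longrightarrow> arr s' a = arr s a)"

lemma frameD:
  assumes "frame R A s s'"
  shows "x \<notin> R \<Longrightarrow> reg s' x = reg s x" "a \<notin> A \<Longrightarrow> arr s' a = arr s a"
  using assms by (auto simp: frame_def)

lemma exec_frame: "exec B c s t s' \<Longrightarrow> frame (written_regs c) (written_arrs c) s s'"
  by (induction rule: exec.induct) (auto simp: frame_def)

lemma val_less: "fits B s e \<Longrightarrow> val s e < B"
proof (induction e)
  case (Div e f)
  then show ?case by (auto intro: le_less_trans[OF div_le_dividend])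
qed auto

lemma exec_bounded: "exec B c s t s' \<Longrightarrow> bounded B s \<Longrightarrow> bounded B s'"
  by (induction rule: exec.induct) (auto simp: bounded_def dest: val_less)

text \<open>Total correctness with a time budget \<open>T\<close>, real because the time functions
  are. In a sequence, the second command gets what the first one leaves.\<close>

definition wp :: "nat \<Rightarrow> com \<Rightarrow> mem \<Rightarrow> real \<Rightarrow> (mem \<Rightarrow> bool) \<Rightarrow> bool" where
  "wp B c s T Q \<longleftrightarrow> (\<exists>t s'. exec B c s t s' \<and> real t \<le> T \<and> Q s')"

text \<open>Boundedness and the frame are added to each postcondition here, so that specifications
  need not repeat them.\<close>

lemma wp_conseq:
  assumes "wp B c s T Q" "bounded B s" "T \<le> T'"
    and "\<And>s'. bounded B s' \<Longrightarrow> frame (written_regs c) (written_arrs c) s s' \<Longrightarrow> Q s' \<Longrightarrow> Q' s'"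
  shows "wp B c s T' Q'"
  using assms exec_bounded exec_frame unfolding wp_def by (meson order_trans)

lemma wp_Skip: "1 \<le> T \<Longrightarrow> Q s \<Longrightarrow> wp B Skip s T Q"
  unfolding wp_def by (metis exec.Skip of_nat_1)

lemma wp_Assign_upd:
  "fits B s e \<Longrightarrow> 1 \<le> T \<Longrightarrow> Q (s\<lparr>reg := (reg s)(x := val s e)\<rparr>) \<Longrightarrow> wp B (Assign x e) s T Q"
  unfolding wp_def by (metis exec.Assign of_nat_1)

lemma wp_Store_upd:
  "fits B s i \<Longrightarrow> fits B s e \<Longrightarrow> 1 \<le> T \<Longrightarrow>
    Q (s\<lparr>arr := (arr s)(a := (arr s a)(val s i := val s e))\<rparr>) \<Longrightarrow> wp B (Store a i e) s T Q"
  unfolding wp_def by (metis exec.Store of_nat_1)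

lemma wp_Assign:
  assumes "bounded B s" "fits B s e" "1 \<le> T"
    and "\<And>s'. bounded B s' \<Longrightarrow> reg s' = (reg s)(x := val s e) \<Longrightarrow> arr s' = arr s \<Longrightarrow> Q s'"
  shows "wp B (Assign x e) s T Q"
  by (rule wp_Assign_upd) (use assms exec_bounded[OF exec.Assign[of B s e x]] in simp_all)

lemma wp_Store:
  assumes "bounded B s" "fits B s i" "fits B s e" "1 \<le> T"
    and "\<And>s'. bounded B s' \<Longrightarrow> reg s' = reg s \<Longrightarrow>
      arr s' = (arr s)(a := (arr s a)(val s i := val s e)) \<Longrightarrow> Q s'"
  shows "wp B (Store a i e) s T Q"
  by (rule wp_Store_upd) (use assms exec_bounded[OF exec.Store[of B s i e a]] in simp_all)

lemma wp_Seq_then: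
  assumes "wp B c s T1 P" "\<And>s'. P s' \<Longrightarrow> wp B d s' (T - T1) Q"
  shows "wp B (Seq c d) s T Q"
proof -
  obtain t s' where 1: "exec B c s t s'" "real t \<le> T1" "P s'" using assms(1) by (auto simp: wp_def)
  with assms(2) obtain t' s'' where 2: "exec B d s' t' s''" "real t' \<le> T - T1" "Q s''"
    unfolding wp_def by blast
  have "exec B (Seq c d) s (t + t') s''" using 1 2 by (blast intro: exec.Seq)
  then show ?thesis using 1 2 unfolding wp_def by (intro exI[of _ "t+t'"] exI[of _ s'']) auto
qed

lemma wp_Seq:
  assumes "wp B c s T1 P" "bounded B s"
    and "\<And>s'. bounded B s' \<Longrightarrow> frame (written_regs c) (written_arrs c) s s' \<Longrightarrow> P s' \<Longrightarrow> wp B d s' (T - T1) Q"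
  shows "wp B (Seq c d) s T Q"
proof (rule wp_Seq_then)
  show "wp B c s T1 (\<lambda>s'. bounded B s' \<and> frame (written_regs c) (written_arrs c) s s' \<and> P s')"
    by (rule wp_conseq[OF assms(1,2)]) auto
qed (use assms(3) in blast)

lemma wp_Seq_Assign:
  assumes "bounded B s" "fits B s e"
    and "\<And>s'. bounded B s' \<Longrightarrow> reg s' = (reg s)(x := val s e) \<Longrightarrow> arr s' = arr s \<Longrightarrow> wp B d s' (T - 1) Q"
  shows "wp B (Seq (Assign x e) d) s T Q"
  by (rule wp_Seq[where ?T1.0 = 1 and P = "\<lambda>s'. reg s' = (reg s)(x := val s e) \<and> arr s' = arr s"],
      rule wp_Assign) (use assms in auto)

lemma wp_Seq_Store:
  assumes "bounded B s" "fits B s i" "fits B s e"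
    and "\<And>s'. bounded B s' \<Longrightarrow> reg s' = reg s \<Longrightarrow>
      arr s' = (arr s)(a := (arr s a)(val s i := val s e)) \<Longrightarrow> wp B d s' (T - 1) Q"
  shows "wp B (Seq (Store a i e) d) s T Q"
  by (rule wp_Seq[where ?T1.0 = 1 and P = "\<lambda>s'. reg s' = reg s \<and>
      arr s' = (arr s)(a := (arr s a)(val s i := val s e))"],
      rule wp_Store) (use assms in auto)

lemma wp_Cond:
  assumes "fits B s e"
    and "val s e \<noteq> 0 \<Longrightarrow> wp B c s (T - 1) Q"
    and "val s e = 0 \<Longrightarrow> wp B d s (T - 1) Q"
  shows "wp B (Cond e c d) s T Q"
proof (cases "val s e = 0")
  case True
  then obtain t s' where "exec B d s t s'" "real t \<le> T - 1" "Q s'" using assms(3) by (auto simp: wp_def)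
  then have "exec B (Cond e c d) s (Suc t) s' \<and> real (Suc t) \<le> T \<and> Q s'"
    using exec.CondFalse assms(1) True by auto
  then show ?thesis unfolding wp_def by blast
next
  case False
  then obtain t s' where "exec B c s t s'" "real t \<le> T - 1" "Q s'" using assms(2) by (auto simp: wp_def)
  then have "exec B (Cond e c d) s (Suc t) s' \<and> real (Suc t) \<le> T \<and> Q s'"
    using exec.CondTrue assms(1) False by auto
  then show ?thesis unfolding wp_def by blast
qed

lemma wp_While_False: "fits B s e \<Longrightarrow> val s e = 0 \<Longrightarrow> 1 \<le> T \<Longrightarrow> Q s \<Longrightarrow> wp B (While e c) s T Q"
  unfolding wp_def by (metis exec.WhileFalse of_nat_1)

lemma wp_While_True:
  assumes "fits B s e" "val s e \<noteq> 0" "wp B c s T1 P"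
    and "\<And>s'. P s' \<Longrightarrow> wp B (While e c) s' (T - T1 - 1) Q"
  shows "wp B (While e c) s T Q"
proof -
  obtain t s' where 1: "exec B c s t s'" "real t \<le> T1" "P s'" using assms(3) by (auto simp: wp_def)
  with assms(4) obtain t' s'' where
    2: "exec B (While e c) s' t' s''" "real t' \<le> T - T1 - 1" "Q s''"
    unfolding wp_def by blast
  have "exec B (While e c) s (Suc (t + t')) s''" using 1 2 assms by (blast intro: exec.WhileTrue)
  then show ?thesis using 1 2 unfolding wp_def by (intro exI[of _ "Suc (t+t')"] exI[of _ s'']) auto
qed

definition For :: "nat \<Rightarrow> nat \<Rightarrow> com \<Rightarrow> com" where
  "For x y c = Seq (Assign x (Const 0)) (While (Less (Reg x) (Reg y))
     (Seq c (Assign x (Add (Reg x) (Const 1)))))"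

lemma written_For [simp]:
  "written_regs (For x y c) = insert x (written_regs c)" "written_arrs (For x y c) = written_arrs c"
  by (auto simp: For_def)

text \<open>The 2 pays for the initial assignment and the final failing test; each round costs
  \<open>T1\<close> for the body and 2 for test and increment. The invariant is stated for the
  moment after the increment.\<close>

lemma wp_For_simple:
  assumes n: "reg s y = n" "n < B" "x \<noteq> y" and T: "2 + real n * (T1 + 2) \<le> T"
    and init: "P 0 (s\<lparr>reg := (reg s)(x := 0)\<rparr>)"
    and step: "\<And>i s'. i < n \<Longrightarrow> reg s' x = i \<Longrightarrow> reg s' y = n \<Longrightarrow> P i s' \<Longrightarrow>
      wp B c s' T1 (\<lambda>s''. reg s'' x = i \<and> reg s'' y = n \<and> P (Suc i) (s''\<lparr>reg := (reg s'')(x := Suc i)\<rparr>))"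
    and fin: "\<And>s'. P n s' \<Longrightarrow> Q s'" and B: "1 < B"
  shows "wp B (For x y c) s T Q"
proof -
  let ?W = "While (Less (Reg x) (Reg y)) (Seq c (Assign x (Add (Reg x) (Const 1))))"
  have loop: "i \<le> n \<Longrightarrow> reg s' x = i \<Longrightarrow> reg s' y = n \<Longrightarrow> P i s' \<Longrightarrow>
     wp B ?W s' (1 + real (n - i) * (T1 + 2)) Q" for i s'
  proof (induction "n - i" arbitrary: i s')
    case 0
    then have [simp]: "i = n" by simp
    show ?case using 0 fin n B by (intro wp_While_False) auto
  next
    case (Suc d)
    have i: "i < n" using Suc by simp
    have "wp B (Seq c (Assign x (Add (Reg x) (Const 1)))) s' (T1 + 1)
      (\<lambda>s''. reg s'' x = Suc i \<and> reg s'' y = n \<and> P (Suc i) s'')"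
      by (rule wp_Seq_then[OF step[OF i Suc.prems(2-4)]], rule wp_Assign_upd) (use i n B in auto)
    then show ?case
    proof (rule wp_While_True[rotated 2])
      fix s2 assume 2: "reg s2 x = Suc i \<and> reg s2 y = n \<and> P (Suc i) s2"
      have "real (n - i) = 1 + real (n - Suc i)" using i by simp
      then have e: "1 + real (n - i) * (T1 + 2) - (T1 + 1) - 1 = 1 + real (n - Suc i) * (T1 + 2)"
        by (simp add: algebra_simps)
      show "wp B ?W s2 (1 + real (n - i) * (T1 + 2) - (T1 + 1) - 1) Q"
        unfolding e by (rule Suc.hyps(1)) (use Suc 2 i in auto)
    qed (use Suc.prems i n B in auto)
  qed
  have "wp B ?W (s\<lparr>reg := (reg s)(x := 0)\<rparr>) (1 + real (n - 0) * (T1 + 2)) Q"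
    by (rule loop) (use n init in auto)
  then have w: "wp B ?W (s\<lparr>reg := (reg s)(x := 0)\<rparr>) (T - 1) Q"
    unfolding wp_def using T by fastforce
  show ?thesis unfolding For_def
    by (rule wp_Seq_then[where ?T1.0 = 1 and P = "\<lambda>s'. s' = s\<lparr>reg := (reg s)(x := 0)\<rparr>"], rule wp_Assign_upd)
      (use w B in auto)
qed

text \<open>The variant used for the solver: the frame relative to the start of the loop is part of
  the rule, so invariants speak only of what the body changes.\<close>

lemma wp_For:
  assumes bnd: "bounded B s" "1 < B" and x: "x \<notin> written_regs c" and y: "y \<notin> written_regs c" "x \<noteq> y"
    and n: "reg s y = n" and T: "2 + real n * (T1 + 2) \<le> T"
    and init: "\<And>s'. reg s' = (reg s)(x := 0) \<Longrightarrow> arr s' = arr s \<Longrightarrow> P 0 s'"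
    and step: "\<And>i s'. i < n \<Longrightarrow> bounded B s' \<Longrightarrow>
      frame (insert x (written_regs c)) (written_arrs c) s s' \<Longrightarrow> reg s' x = i \<Longrightarrow> P i s' \<Longrightarrow>
      wp B c s' T1 (\<lambda>s''. \<forall>s3. reg s3 = (reg s'')(x := Suc i) \<longrightarrow> arr s3 = arr s'' \<longrightarrow> P (Suc i) s3)"
    and fin: "\<And>s'. bounded B s' \<Longrightarrow> frame (insert x (written_regs c)) (written_arrs c) s s' \<Longrightarrow> P n s' \<Longrightarrow> Q s'"
  shows "wp B (For x y c) s T Q"
proof (rule wp_For_simple[OF n _ y(2) T, where P = "\<lambda>i s'. bounded B s' \<and>
     frame (insert x (written_regs c)) (written_arrs c) s s' \<and> P i s'"])
  show "n < B" using bnd(1) n by (auto simp: bounded_def)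
  show "bounded B (s\<lparr>reg := (reg s)(x := 0)\<rparr>) \<and>
    frame (insert x (written_regs c)) (written_arrs c) s (s\<lparr>reg := (reg s)(x := 0)\<rparr>) \<and>
    P 0 (s\<lparr>reg := (reg s)(x := 0)\<rparr>)"
    using bnd by (auto simp: bounded_def frame_def intro: init)
next
  fix i s' assume i: "i < n" "reg s' x = i" "reg s' y = n"
    and I: "bounded B s' \<and> frame (insert x (written_regs c)) (written_arrs c) s s' \<and> P i s'"
  have nB: "n < B" using bnd(1) n by (auto simp: bounded_def)
  have "wp B c s' T1 (\<lambda>s''. \<forall>s3. reg s3 = (reg s'')(x := Suc i) \<longrightarrow> arr s3 = arr s'' \<longrightarrow> P (Suc i) s3)"
    using step i I by blast
  then show "wp B c s' T1 (\<lambda>s''. reg s'' x = i \<and> reg s'' y = n \<and> bounded B (s''\<lparr>reg := (reg s'')(x := Suc i)\<rparr>) \<and>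
      frame (insert x (written_regs c)) (written_arrs c) s (s''\<lparr>reg := (reg s'')(x := Suc i)\<rparr>) \<and>
      P (Suc i) (s''\<lparr>reg := (reg s'')(x := Suc i)\<rparr>))"
    by (rule wp_conseq) (use i I x y nB in \<open>auto simp: frame_def bounded_def\<close>)
qed (use fin bnd in auto)

subsection \<open>Subroutines\<close>

text \<open>Subroutines work on their own registers and arrays, so that they cannot interfere with the
  memory of the caller.\<close>

fun shift_expr :: "nat \<Rightarrow> nat \<Rightarrow> expr \<Rightarrow> expr" where
  "shift_expr r a (Const k) = Const k"
| "shift_expr r a (Reg x) = Reg (x + r)"
| "shift_expr r a (Elem b e) = Elem (b + a) (shift_expr r a e)"
| "shift_expr r a (Add e f) = Add (shift_expr r a e) (shift_expr r a f)"
| "shift_expr r a (Sub e f) = Sub (shift_expr r a e) (shift_expr r a f)"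
| "shift_expr r a (Mult e f) = Mult (shift_expr r a e) (shift_expr r a f)"
| "shift_expr r a (Div e f) = Div (shift_expr r a e) (shift_expr r a f)"
| "shift_expr r a (Less e f) = Less (shift_expr r a e) (shift_expr r a f)"

fun shift_com :: "nat \<Rightarrow> nat \<Rightarrow> com \<Rightarrow> com" where
  "shift_com r a Skip = Skip"
| "shift_com r a (Assign x e) = Assign (x + r) (shift_expr r a e)"
| "shift_com r a (Store b i e) = Store (b + a) (shift_expr r a i) (shift_expr r a e)"
| "shift_com r a (Seq c d) = Seq (shift_com r a c) (shift_com r a d)"
| "shift_com r a (Cond e c d) = Cond (shift_expr r a e) (shift_com r a c) (shift_com r a d)"
| "shift_com r a (While e c) = While (shift_expr r a e) (shift_com r a c)"

definition view :: "nat \<Rightarrow> nat \<Rightarrow> mem \<Rightarrow> mem" where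
  "view r a s = \<lparr>reg = (\<lambda>x. reg s (x + r)), arr = (\<lambda>b. arr s (b + a))\<rparr>"

lemma val_shift [simp]: "val s (shift_expr r a e) = val (view r a s) e"
  by (induction e) (auto simp: view_def)

lemma fits_shift [simp]: "fits B s (shift_expr r a e) = fits B (view r a s) e"
  by (induction e) (auto simp: view_def)

lemma exec_shift:
  "exec B c v t v' \<Longrightarrow> view r a s = v \<Longrightarrow> \<exists>s'. exec B (shift_com r a c) s t s' \<and> view r a s' = v'"
proof (induction arbitrary: s rule: exec.induct)
  case (Skip v)
  then show ?case using exec.Skip by auto
next
  case (Assign v e x)
  then have "exec B (shift_com r a (Assign x e)) s 1 (s\<lparr>reg := (reg s)(x + r := val v e)\<rparr>)"
    using exec.Assign[of B s "shift_expr r a e"] by simp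
  moreover have "view r a (s\<lparr>reg := (reg s)(x + r := val v e)\<rparr>) = v\<lparr>reg := (reg v)(x := val v e)\<rparr>"
    using Assign.prems by (auto simp: view_def fun_eq_iff)
  ultimately show ?case by blast
next
  case (Store v i e b)
  let ?s = "s\<lparr>arr := (arr s)(b + a := (arr s (b + a))(val v i := val v e))\<rparr>"
  have "exec B (shift_com r a (Store b i e)) s 1 ?s"
    using Store exec.Store[of B s "shift_expr r a i" "shift_expr r a e"] by simp
  moreover have "view r a ?s = v\<lparr>arr := (arr v)(b := (arr v b)(val v i := val v e))\<rparr>"
    using Store.prems by (auto simp: view_def fun_eq_iff)
  ultimately show ?case by blast
next
  case (Seq c v t v' d t' v'')
  then show ?case by (metis exec.Seq shift_com.simps(4))
next
  case (CondTrue v e c t v' d)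
  then show ?case by (metis exec.CondTrue shift_com.simps(5) val_shift fits_shift)
next
  case (CondFalse v e d t v' c)
  then show ?case by (metis exec.CondFalse shift_com.simps(5) val_shift fits_shift)
next
  case (WhileFalse v e c)
  then show ?case by (metis exec.WhileFalse shift_com.simps(6) val_shift fits_shift)
next
  case (WhileTrue v e c t v' t' v'')
  then show ?case by (metis exec.WhileTrue shift_com.simps(6) val_shift fits_shift)
qed

lemma written_shift:
  "written_regs (shift_com r a c) = (\<lambda>x. x + r) ` written_regs c"
  "written_arrs (shift_com r a c) = (\<lambda>x. x + a) ` written_arrs c"
  by (induction c) auto

lemma not_written_shift:
  "x < r \<Longrightarrow> x \<notin> written_regs (shift_com r a c)"
  "b < a \<Longrightarrow> b \<notin> written_arrs (shift_com r a c)"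
  by (auto simp: written_shift)

text \<open>\<open>runs\<close> quantifies over arbitrary words outside the input, so a subroutine
  can be called repeatedly without clearing its memory.\<close>

lemma wp_shift:
  assumes "runs B c xs T ok" "bounded B s" "holds_input xs (view r a s)"
  shows "wp B (shift_com r a c) s T (\<lambda>s'. ok (arr s' (1 + a)))"
proof -
  have "(\<forall>x. reg (view r a s) x < B) \<and> (\<forall>b i. arr (view r a s) b i < B)"
    using assms(2) by (auto simp: bounded_def view_def)
  then obtain t v' where v': "exec B c (view r a s) t v'" "real t \<le> T" "ok (arr v' 1)"
    using assms(1,3) unfolding runs_def by blast
  from exec_shift[OF v'(1) refl] obtain s' where s': "exec B (shift_com r a c) s t s'" "view r a s' = v'"
    by blast
  have "arr s' (1 + a) = arr v' 1" unfolding s'(2)[symmetric] by (simp add: view_def)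
  with s'(1) v'(2,3) show ?thesis unfolding wp_def by metis
qed

section \<open>The program\<close>

lemma nth_concat_blocks:
  assumes "\<And>x. x \<in> set ys \<Longrightarrow> length (f x) = b" "i < length ys" "r < b"
  shows "concat (map f ys) ! (b * i + r) = f (ys ! i) ! r"
  using assms
proof (induction ys arbitrary: i)
  case (Cons y ys)
  show ?case
  proof (cases i)
    case 0
    then show ?thesis using Cons.prems by (simp add: nth_append)
  next
    case (Suc j)
    then have "concat (map f (y # ys)) ! (b * i + r) = concat (map f ys) ! (b * j + r)"
      using Cons.prems(1)[of y] by (simp add: nth_append)
    then show ?thesis using Cons.IH[of j] Cons.prems Suc by simp
  qed
qed simp

lemma length_concat_blocks:
  "(\<And>x. x \<in> set ys \<Longrightarrow> length (f x) = b) \<Longrightarrow> length (concat (map f ys)) = b * length ys"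
  by (induction ys) auto

lemma nth_append_blocks:
  assumes "\<And>x. x \<in> set ys \<Longrightarrow> length (f x) = b" "length h = c" "0 < b"
    and "\<And>i. i < c \<Longrightarrow> a i = h ! i"
    and "\<And>i r. i < length ys \<Longrightarrow> r < b \<Longrightarrow> a (c + (b * i + r)) = f (ys ! i) ! r"
    and "i < length (h @ concat (map f ys))"
  shows "a i = (h @ concat (map f ys)) ! i"
proof (cases "i < c")
  case True
  then show ?thesis using assms(2,4) by (simp add: nth_append)
next
  case False
  define j where "j = i - c"
  have "i = c + j" using False by (simp add: j_def)
  have "j < b * length ys"
    using assms(6) length_concat_blocks[of ys f b, OF assms(1)] assms(2) \<open>i = c + j\<close> by simp
  then have "j div b < length ys" by (simp add: less_mult_imp_div_less mult.commute)
  moreover have "j = b * (j div b) + j mod b" by simp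
  moreover have "j mod b < b" using assms(3) by simp
  ultimately have "a (c + j) = concat (map f ys) ! j"
    using assms(5) nth_concat_blocks[of ys f b "j div b" "j mod b", OF assms(1)] by metis
  then show ?thesis using \<open>i = c + j\<close> assms(2) by (simp add: nth_append)
qed

lemma sum_list_concat_blocks: "sum_list (concat (map f xs)) = (\<Sum>i<length xs. sum_list (f (xs ! i)))"
proof -
  have "sum_list (concat (map f xs)) = sum_list (map (\<lambda>x. sum_list (f x)) xs)" by (induction xs) auto
  then show ?thesis by (simp add: sum_list_sum_nth atLeast0LessThan)
qed

lemma fits_intros:
  "k < B \<Longrightarrow> fits B s (Const k)"
  "bounded B s \<Longrightarrow> fits B s (Reg x)"
  "bounded B s \<Longrightarrow> fits B s e \<Longrightarrow> fits B s (Elem a e)"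
  "fits B s e \<Longrightarrow> fits B s f \<Longrightarrow> val s e + val s f < B \<Longrightarrow> fits B s (Add e f)"
  "fits B s e \<Longrightarrow> fits B s f \<Longrightarrow> fits B s (Sub e f)"
  "fits B s e \<Longrightarrow> fits B s f \<Longrightarrow> val s e * val s f < B \<Longrightarrow> fits B s (Mult e f)"
  "fits B s e \<Longrightarrow> fits B s f \<Longrightarrow> fits B s (Div e f)"
  "1 < B \<Longrightarrow> fits B s e \<Longrightarrow> fits B s f \<Longrightarrow> fits B s (Less e f)"
  by (auto simp: boundedD)

text \<open>Registers 0 to 4 hold the parameters of the instance, register 5 the number of candidates,
  6 the successor of a candidate that suffices on its own, 7 the largest length bound of a
  candidate, and 8 tells whether the search goes on; the others are temporary. Array 2 lists the
  candidates and array 3 holds the digits of the current tuple. Arrays 4 and 5 are the input and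
  the output of the subroutines.\<close>

abbreviation (input) field :: "nat \<Rightarrow> nat \<Rightarrow> expr" where
  "field c x \<equiv> Elem 0 (Add (Const c) (Mult (Const 4) (Reg x)))"

text \<open>Output entry 0 is the decision, so the marks of the edges are offset by 1.\<close>

abbreviation (input) mark :: "nat \<Rightarrow> expr" where
  "mark x \<equiv> Elem 1 (Add (Reg x) (Const 1))"

definition setup_regs :: com where
  "setup_regs = Seq (Assign 0 (Elem 0 (Const 0))) (Seq (Assign 1 (Elem 0 (Const 1)))
     (Seq (Assign 2 (Elem 0 (Const 2))) (Seq (Assign 3 (Elem 0 (Const 3))) (Assign 4 (Elem 0 (Const 4))))))"

text \<open>The output array doubles as work space: the marks describe the edges kept under the
  current tuple, so that a successful tuple leaves its witness in place.\<close>

definition mark_all :: com where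
  "mark_all = For 12 1 (Store 1 (Add (Reg 12) (Const 1)) (Const 1))"

text \<open>\<open>c\<close> is the header length of the subroutine's input. The length expression
  is a parameter because detour tests lengthen the deleted edges.\<close>

definition load_edges :: "nat \<Rightarrow> expr \<Rightarrow> com" where
  "load_edges c e = For 14 1
     (Seq (Store 4 (Add (Const c) (Mult (Const 3) (Reg 14))) (field 5 14))
     (Seq (Store 4 (Add (Const (c + 1)) (Mult (Const 3) (Reg 14))) (field 6 14))
          (Store 4 (Add (Const (c + 2)) (Mult (Const 3) (Reg 14))) e)))"

lemma written_simple [simp]:
  "written_regs setup_regs = {0, 1, 2, 3, 4}" "written_arrs setup_regs = {}"
  "written_regs mark_all = {12}" "written_arrs mark_all = {1}"
  "written_regs (load_edges c e) = {14}" "written_arrs (load_edges c e) = {4}"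
  by (auto simp: setup_regs_def mark_all_def load_edges_def)

section \<open>Word size estimates, reading the input, and the instances passed to the
  subroutines\<close>

locale spanner_problem =
  fixes I :: spanner_instance and B S :: nat
  assumes valid: "valid_spanner_instance I"
    and S_def: "S = sum_list (enc_spanner I) + length (enc_spanner I) + 2"
    and S_le_B: "S ^ 5 \<le> B"
begin

abbreviation "n \<equiv> size_nodes I"
abbreviation "m \<equiv> size_edges I"
abbreviation "W \<equiv> goal I"
abbreviation "eu i \<equiv> fst (edge_list I ! i)"
abbreviation "ev i \<equiv> snd (edge_list I ! i)"
abbreviation "ew i \<equiv> weight I (edge_at I i)"
abbreviation "el i \<equiv> len I (edge_at I i)"

lemma vg: "valid_graph I" and st: "1 \<le> stretch I"
  using valid by (auto simp: valid_spanner_instance_def)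

lemma edge_at_pair: "edge_at I i = {eu i, ev i}"
  by (simp add: edge_at_def split: prod.splits)

lemma edge_facts:
  assumes "i < m"
  shows "eu i < n" "ev i < n" "eu i \<noteq> ev i" "{eu i, ev i} \<in> edges I" "1 \<le> el i"
  using valid_graph_edge[OF vg assms, of "eu i" "ev i"] by (auto simp: edge_at_pair)

lemma length_enc: "length (enc_spanner I) = 5 + 4 * m"
  unfolding enc_spanner_def by (subst length_append, subst length_concat_blocks[where b = 4])
    (auto simp: size_edges_def split: prod.splits)

lemma sum_enc: "sum_list (enc_spanner I) =
  n + m + W + stretch_num I + stretch_den I + (\<Sum>i<m. eu i + ev i + ew i + el i)"
  unfolding enc_spanner_def sum_list_append sum_list_concat_blocks
  by (auto simp: size_edges_def edge_at_def split_beta intro!: sum.cong)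

text \<open>\<open>7 \<le> S\<close> comes from the five header entries and the 2 in
  \<open>S_def\<close>; it absorbs the small constants in the estimates. The largest quantities, the
  candidate limit and the input of a detour test, are of order S^3, well below S^5.\<close>

lemma sizes:
  "n < S" "m < S" "W < S" "stretch_num I < S" "stretch_den I < S" "7 \<le> S" "4 * m + 7 \<le> S"
  "(\<Sum>i<m. eu i + ev i + ew i + el i) < S"
  by (simp_all add: S_def length_enc sum_enc)

lemma edge_sizes:
  assumes "i < m"
  shows "eu i < S" "ev i < S" "ew i < S" "el i < S"
  using member_le_sum[of i "{..<m}" "\<lambda>i. eu i + ev i + ew i + el i"] assms sizes(8) by auto

lemma S_power_le: "j \<le> 5 \<Longrightarrow> S ^ j \<le> B"
  using power_increasing[of j 5 S] sizes(6) S_le_B by linarith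

lemma S_le: "S \<le> B" "S * S \<le> B" "S * S * S \<le> B"
  using S_power_le[of 1] S_power_le[of 2] S_power_le[of 3]
  by (simp_all add: power2_eq_square power3_eq_cube)

lemma less_B: "x < S \<Longrightarrow> x < B"
  using S_le by linarith

lemma const_less_B: "1 < B" "Suc 0 < B" "2 < B" "3 < B" "4 < B" "5 < B" "6 < B" "7 < B" "8 < B" "0 < B"
proof -
  have "7 * 7 \<le> S * S" using sizes(6) by (intro mult_le_mono) auto
  then show "1 < B" "Suc 0 < B" "2 < B" "3 < B" "4 < B" "5 < B" "6 < B" "7 < B" "8 < B" "0 < B"
    using S_le(2) by auto
qed

lemma index_less_B:
  assumes "i < m"
  shows "4 * i < B" "5 + 4 * i < B" "6 + 4 * i < B" "7 + 4 * i < B" "8 + 4 * i < B" "Suc i < B" "i < B"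
    "i + 1 < B" "3 * i < B" "c \<le> 6 \<Longrightarrow> c + 3 * i < B" "c \<le> 5 \<Longrightarrow> Suc (c + 3 * i) < B" "c \<le> 4 \<Longrightarrow> Suc (Suc (c + 3 * i)) < B"
  using assms sizes(7) S_le(1) const_less_B by linarith+

lemma bound_le: "bound I i \<le> stretch_num I * el i"
  by (simp add: bound_def)

lemma mult_bound_less_B: "i < m \<Longrightarrow> stretch_num I * el i < S * S" 
  using sizes(4) edge_sizes(4)[of i] by (intro mult_strict_mono) auto

lemma bound_less: "i < m \<Longrightarrow> bound I i < S * S"
  using bound_le mult_bound_less_B le_less_trans by blast

definition env :: "mem \<Rightarrow> bool" where
  "env s \<longleftrightarrow> (\<forall>i<length (enc_spanner I). arr s 0 i = enc_spanner I ! i) \<and>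
     reg s 0 = n \<and> reg s 1 = m \<and> reg s 2 = W \<and> reg s 3 = stretch_num I \<and> reg s 4 = stretch_den I"

lemma env_frame:
  "frame R A s s' \<Longrightarrow> 0 \<notin> A \<Longrightarrow> (\<And>x. x < 5 \<Longrightarrow> x \<notin> R) \<Longrightarrow> env s \<Longrightarrow> env s'"
  by (auto simp: env_def frame_def)

lemma envD:
  assumes "env s"
  shows "reg s 0 = n" "reg s 1 = m" "reg s (Suc 0) = m" "reg s 2 = W" "reg s 3 = stretch_num I" "reg s 4 = stretch_den I"
  using assms by (auto simp: env_def)

lemma input_edge:
  assumes "env s" "i < m"
  shows "arr s 0 (5 + 4 * i) = eu i" "arr s 0 (6 + 4 * i) = ev i"
    "arr s 0 (7 + 4 * i) = ew i" "arr s 0 (8 + 4 * i) = el i"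
proof -
  let ?f = "\<lambda>(u, v). [u, v, weight I {u, v}, len I {u, v}]"
  have a: "arr s 0 (5 + (4 * i + r)) = ?f (edge_list I ! i) ! r" if "r < 4" for r
  proof -
    have "arr s 0 (5 + (4 * i + r)) = enc_spanner I ! (5 + (4 * i + r))"
      using assms that by (auto simp: env_def length_enc)
    also have "\<dots> = concat (map ?f (edge_list I)) ! (4 * i + r)"
      by (simp add: enc_spanner_def)
    also have "\<dots> = ?f (edge_list I ! i) ! r"
      using assms that by (intro nth_concat_blocks) (auto simp: size_edges_def)
    finally show ?thesis .
  qed
  show "arr s 0 (5 + 4 * i) = eu i" "arr s 0 (6 + 4 * i) = ev i"
    "arr s 0 (7 + 4 * i) = ew i" "arr s 0 (8 + 4 * i) = el i"
    using a[of 0] a[of 1] a[of 2] a[of 3] by (auto simp: split_beta edge_at_pair add_ac)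
qed

lemma wp_setup_regs:
  assumes "bounded B s" "holds_input (enc_spanner I) s"
  shows "wp B setup_regs s 5 env"
proof -
  have h: "arr s 0 i = enc_spanner I ! i" if "i < 5 + 4 * m" for i
    using assms(2) that by (auto simp: holds_input_def length_enc)
  show ?thesis unfolding setup_regs_def
    apply (rule wp_Seq_Assign wp_Assign, (assumption | rule assms), (intro fits_intros; (assumption | simp add: const_less_B assms)))+
     apply simp
    apply (simp add: env_def length_enc h)
    apply (simp add: h enc_spanner_def)
    done
qed

lemma wp_mark_all:
  assumes "bounded B s" "env s"
  shows "wp B mark_all s (2 + 3 * real m) (\<lambda>s'. \<forall>i. arr s' 1 i = (if 1 \<le> i \<and> i \<le> m then 1 else arr s 1 i))"
  unfolding mark_all_def
proof (rule wp_For[where n = m and ?T1.0 = 1 and P = "\<lambda>j s'. \<forall>i. arr s' 1 i = (if 1 \<le> i \<and> i \<le> j then 1 else arr s 1 i)"])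
  show "reg s 1 = m" using envD[OF assms(2)] by simp
next
  fix i s' assume i: "i < m" and b: "bounded B s'" and r: "reg s' 12 = i"
    and P: "\<forall>k. arr s' 1 k = (if 1 \<le> k \<and> k \<le> i then 1 else arr s 1 k)"
  show "wp B (Store 1 (Add (Reg 12) (Const 1)) (Const 1)) s' 1
    (\<lambda>s''. \<forall>s3. reg s3 = (reg s'')(12 := Suc i) \<longrightarrow> arr s3 = arr s'' \<longrightarrow>
       (\<forall>k. arr s3 1 k = (if 1 \<le> k \<and> k \<le> Suc i then 1 else arr s 1 k)))"
    apply (rule wp_Store, fact)
       apply (intro fits_intros; (rule b | simp add: const_less_B index_less_B r i))+
    using P r by auto
qed (use assms in \<open>auto simp: const_less_B\<close>)

lemma wp_load_edges:
  assumes s: "bounded B s" "env s" and c: "c \<le> 4"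
    and e: "\<And>i s'. i < m \<Longrightarrow> bounded B s' \<Longrightarrow> frame {14} {4} s s' \<Longrightarrow> reg s' 14 = i \<Longrightarrow> fits B s' e \<and> val s' e = l i"
  shows "wp B (load_edges c e) s (2 + 5 * real m) (\<lambda>s'. (\<forall>i<c. arr s' 4 i = arr s 4 i) \<and>
     (\<forall>i<m. arr s' 4 (c + 3 * i) = eu i \<and> arr s' 4 (c + 3 * i + 1) = ev i \<and> arr s' 4 (c + 3 * i + 2) = l i))"
  unfolding load_edges_def
proof (rule wp_For[where n = m and ?T1.0 = 3 and P = "\<lambda>j s'. (\<forall>i<c. arr s' 4 i = arr s 4 i) \<and>
     (\<forall>i<j. arr s' 4 (c + 3 * i) = eu i \<and> arr s' 4 (c + 3 * i + 1) = ev i \<and> arr s' 4 (c + 3 * i + 2) = l i)"], goal_cases)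
  case (9 i s')
  have f: "frame {14} {4} s s'" using 9(3) by simp
  note inp = input_edge[OF env_frame[OF f _ _ s(2)] 9(1), simplified]
  have c': "c < B" "Suc c < B" "Suc (Suc c) < B" "c \<le> 5" "c \<le> 6" using c const_less_B by auto
  show ?case
    apply (rule wp_Seq_Store, fact)
      apply (intro fits_intros; (rule 9 | simp add: const_less_B index_less_B 9 c c'))
     apply (intro fits_intros; (rule 9 | simp add: const_less_B index_less_B 9 c c'))
    subgoal for s1
      apply (rule wp_Seq_Store, assumption)
        apply (intro fits_intros; (assumption | simp add: const_less_B index_less_B 9 c c'))
       apply (intro fits_intros; (assumption | simp add: const_less_B index_less_B 9 c c'))
      subgoal premises p for s2
      proof -
        have f2: "frame {14} {4} s s2" using f p by (auto simp: frame_def)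
        have r2: "reg s2 14 = i" using p 9 by simp
        note e2 = e[OF 9(1) p(4) f2 r2]
        show ?thesis
          apply (rule wp_Store, fact)
             apply (intro fits_intros; (rule p | simp add: const_less_B index_less_B 9 c c' r2))
            apply (simp add: e2)
           apply simp
          using p 9 inp e2 r2 by (auto simp: less_Suc_eq)
      qed
      done
    done
qed (use s in \<open>auto simp: const_less_B envD\<close>)


text \<open>Deleted edges are made too long for a detour instead of being removed: since \<open>SPSP\<close> need not be
  monotone, the time of a call is only bounded in terms of \<open>SPSP n m\<close> if all \<open>m\<close> edges are kept.\<close>

definition sub_spsp :: "nat set \<Rightarrow> nat \<Rightarrow> spsp_instance" where
  "sub_spsp X i = \<lparr>size_nodes = n, edge_list = edge_list I,
     len = (\<lambda>e. if e \<in> edge_at I ` X then Suc (bound I i) else len I e),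
     source = eu i, target = ev i\<rparr>"

lemma sub_spsp_simps [simp]:
  "size_nodes (sub_spsp X i) = n" "size_edges (sub_spsp X i) = m" "edges (sub_spsp X i) = edges I"
  "edge_list (sub_spsp X i) = edge_list I" "source (sub_spsp X i) = eu i" "target (sub_spsp X i) = ev i"
  by (simp_all add: sub_spsp_def size_edges_def edges_def)

lemma valid_sub_spsp: "i < m \<Longrightarrow> valid_spsp (sub_spsp X i)"
  using vg edge_facts[of i] unfolding valid_spsp_def valid_graph_def
  by (simp add: nodes_def) (auto simp: sub_spsp_def)

lemma enc_sub_spsp:
  "enc_spsp (sub_spsp X i) = [n, m, eu i, ev i]
     @ concat (map (\<lambda>(u, v). [u, v, len (sub_spsp X i) {u, v}]) (edge_list I))"
  by (simp add: enc_spsp_def)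

lemma S_powers: "7 * S \<le> S * S" "7 * (S * S) \<le> S * S * S" "7 * (S * S * S) \<le> S ^ 4" "S ^ 4 \<le> S ^ 5"
  using sizes(6) by (simp_all add: power_numeral_reduce)

lemma size_sub_spsp:
  assumes "i < m"
  shows "sum_list (enc_spsp (sub_spsp X i)) + length (enc_spsp (sub_spsp X i)) + 2 \<le> S ^ 5"
proof -
  have l: "length (enc_spsp (sub_spsp X i)) = 4 + 3 * m"
    unfolding enc_sub_spsp by (subst length_append, subst length_concat_blocks[where b = 3])
      (auto simp: size_edges_def split: prod.splits)
  have "sum_list (enc_spsp (sub_spsp X i)) = n + m + eu i + ev i +
     (\<Sum>j<m. eu j + ev j + len (sub_spsp X i) (edge_at I j))"
    unfolding enc_sub_spsp sum_list_append sum_list_concat_blocks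
    by (auto simp: size_edges_def edge_at_def split_beta intro!: sum.cong)
  \<comment> \<open>A lengthened edge has length \<open>Suc (bound I i)\<close>, at most
    \<open>S * S\<close>.\<close>
  also have "(\<Sum>j<m. eu j + ev j + len (sub_spsp X i) (edge_at I j))
      \<le> (\<Sum>j<m. (eu j + ev j + ew j + el j) + S * S)"
    using bound_less[OF assms] by (intro sum_mono) (auto simp: sub_spsp_def)
  also have "\<dots> = (\<Sum>j<m. eu j + ev j + ew j + el j) + m * (S * S)" by (simp add: sum.distrib)
  finally have "sum_list (enc_spsp (sub_spsp X i)) \<le> 5 * S + m * (S * S)"
    using sizes(1,2,8) edge_sizes(1,2)[OF assms] by linarith
  moreover have "m * (S * S) \<le> S * S * S" using sizes(2) by (simp add: mult_le_mono)
  ultimately show ?thesis using l sizes(6,7) S_powers by linarith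
qed

text \<open>The direct edge, possibly lengthened, is still a path, so the subroutine reports a true
  length and never the default for missing paths.\<close>

lemma ok_sub_spsp:
  assumes i: "i < m" and ok: "ok_spsp (sub_spsp X i) out"
  shows "out 1 \<le> bound I i \<longleftrightarrow> replaceable I X i"
proof -
  have "is_path (edges I) (eu i) [eu i, ev i] (ev i)"
    using edge_facts[OF i] by (intro is_path_edge)
  then obtain p where p: "is_path (edges I) (eu i) p (ev i)" "out 1 = path_length (len (sub_spsp X i)) p"
     "\<And>q. is_path (edges I) (eu i) q (ev i) \<Longrightarrow>
       path_length (len (sub_spsp X i)) p \<le> path_length (len (sub_spsp X i)) q"
    using ok unfolding ok_spsp_def by (auto split: if_splits)
  have "out 1 \<le> bound I i \<longleftrightarrow>
      (\<exists>q. is_path (edges I - edge_at I ` X) (eu i) q (ev i) \<and> path_length (len I) q \<le> bound I i)"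
    unfolding p(2) by (rule shortest_path_avoiding[OF _ p(1,3)]) (auto simp: sub_spsp_def)
  then show ?thesis by (simp add: replaceable_def split_beta)
qed

definition sub_apsp :: lgraph where
  "sub_apsp = \<lparr>size_nodes = n, edge_list = edge_list I, len = len I\<rparr>"

lemma sub_apsp_simps [simp]:
  "size_nodes sub_apsp = n" "size_edges sub_apsp = m" "edges sub_apsp = edges I" "len sub_apsp = len I"
  by (simp_all add: sub_apsp_def size_edges_def edges_def)

lemma enc_sub_apsp:
  "enc_apsp2 sub_apsp = [n, m] @ concat (map (\<lambda>(u, v). [u, v, len I {u, v}]) (edge_list I))"
  by (simp add: enc_apsp2_def sub_apsp_def size_edges_def)

lemma size_sub_apsp: "sum_list (enc_apsp2 sub_apsp) + length (enc_apsp2 sub_apsp) + 2 \<le> S ^ 5"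
proof -
  have l: "length (enc_apsp2 sub_apsp) = 2 + 3 * m"
    unfolding enc_sub_apsp by (subst length_append, subst length_concat_blocks[where b = 3])
      (auto simp: size_edges_def split: prod.splits)
  have "sum_list (enc_apsp2 sub_apsp) = n + m + (\<Sum>j<m. eu j + ev j + el j)"
    unfolding enc_sub_apsp sum_list_append sum_list_concat_blocks
    by (auto simp: size_edges_def edge_at_def split_beta intro!: sum.cong)
  also have "(\<Sum>j<m. eu j + ev j + el j) \<le> (\<Sum>j<m. eu j + ev j + ew j + el j)"
    by (intro sum_mono) auto
  finally show ?thesis using l sizes S_powers by linarith
qed

lemma ok_yes:
  assumes "X \<subseteq> {..<m}" "W \<le> saved I X" "feasible I X" "out 0 = 1"
    and "\<And>i. i < m \<Longrightarrow> out (Suc i) = (if i \<in> X then 0 else 1)"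
  shows "ok_spanner I out"
proof -
  have "{{u, v} |u v i. i < m \<and> edge_list I ! i = (u, v) \<and> out (Suc i) = 1}
     = edge_at I ` {i. i < m \<and> out (Suc i) = 1}"
  proof (intro equalityI subsetI)
    fix e assume "e \<in> edge_at I ` {i. i < m \<and> out (Suc i) = 1}"
    then obtain i where "i < m" "out (Suc i) = 1" "e = {eu i, ev i}" by (auto simp: edge_at_pair)
    then show "e \<in> {{u, v} |u v i. i < m \<and> edge_list I ! i = (u, v) \<and> out (Suc i) = 1}"
      by (intro CollectI exI[of _ "eu i"] exI[of _ "ev i"] exI[of _ i]) simp
  next
    fix e assume "e \<in> {{u, v} |u v i. i < m \<and> edge_list I ! i = (u, v) \<and> out (Suc i) = 1}"
    then obtain u v i where "e = {u, v}" "i < m" "edge_list I ! i = (u, v)" "out (Suc i) = 1" by blast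
    then show "e \<in> edge_at I ` {i. i < m \<and> out (Suc i) = 1}"
      by (intro image_eqI[of _ _ i]) (auto simp: edge_at_def)
  qed
  also have "{i. i < m \<and> out (Suc i) = 1} = {..<m} - X"
    using assms(5) by (auto split: if_splits)
  also have "edge_at I ` ({..<m} - X) = edges I - edge_at I ` X"
    unfolding edges_conv using inj_on_image_set_diff[OF inj_on_edge_at[OF vg], of "{..<m}" X] assms(1) by auto
  finally show ?thesis using witness_iff[OF valid assms(1)] assms(2-4) by (auto simp: ok_spanner_def)
qed

lemma ok_no: "\<nexists>F. witness I F \<Longrightarrow> out 0 = 0 \<Longrightarrow> ok_spanner I out"
  by (auto simp: ok_spanner_def)

end

text \<open>Products of 0/1 values act as conjunctions and \<open>Sub (Const 1)\<close> as negation.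
  Adding the truncated difference of registers 16 and 7 to register 7 yields their maximum.\<close>

definition scan_edge :: com where
  "scan_edge =
     Seq (Assign 17 (Elem 5 (Add (Mult (Const 2) (Add (Mult (field 5 12) (Reg 0)) (field 6 12))) (Const 1))))
    (Seq (Assign 16 (Div (Mult (Reg 3) (field 8 12)) (Reg 4)))
    (Cond (Mult (Less (Const 0) (field 7 12)) (Mult (Less (Const 0) (Reg 17)) (Sub (Const 1) (Less (Reg 16) (Reg 17)))))
      (Seq (Store 2 (Reg 5) (Reg 12))
      (Seq (Assign 5 (Add (Reg 5) (Const 1)))
      (Seq (Assign 7 (Add (Reg 7) (Sub (Reg 16) (Reg 7))))
           (Assign 6 (Add (Mult (Less (field 7 12) (Reg 2)) (Reg 6))
             (Mult (Sub (Const 1) (Less (field 7 12) (Reg 2))) (Add (Reg 12) (Const 1))))))))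
      Skip))"

definition scan :: com where
  "scan = Seq (Assign 5 (Const 0)) (Seq (Assign 6 (Const 0)) (Seq (Assign 7 (Const 0)) (For 12 1 scan_edge)))"

text \<open>Register 6 is a position plus 1, with 0 for none. The nested truncated subtractions
  compute the minimum of the number of candidates and the limit.\<close>

definition choose_candidates :: com where
  "choose_candidates = Cond (Reg 6)
     (Seq (Store 2 (Const 0) (Sub (Reg 6) (Const 1))) (Assign 5 (Const 1)))
     (Assign 5 (Sub (Reg 5) (Sub (Reg 5) (Mult (Add (Mult (Const 2) (Reg 7)) (Const 1)) (Reg 2)))))"

definition zero_digits :: com where
  "zero_digits = For 13 2 (Store 3 (Reg 13) (Const 0))"

text \<open>The factor \<open>mark 15\<close> makes an entry that occurs twice in the tuple count
  once; the mark is cleared only after its use.\<close>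

definition delete_tuple :: com where
  "delete_tuple = Seq (Assign 10 (Const 0)) (For 13 2
     (Seq (Assign 15 (Elem 2 (Elem 3 (Reg 13))))
     (Seq (Assign 10 (Add (Reg 10) (Mult (field 7 15) (mark 15))))
          (Store 1 (Add (Reg 15) (Const 1)) (Const 0)))))"

text \<open>The initial carry 1 in register 11 adds one; a final carry 1 signals that all tuples
  have been tried. The number of the tuple itself is never stored, as it need not fit into a
  word.\<close>

definition next_tuple :: com where
  "next_tuple = Seq (Assign 11 (Const 1)) (For 13 2
     (Seq (Assign 17 (Add (Elem 3 (Reg 13)) (Reg 11)))
     (Seq (Assign 11 (Div (Reg 17) (Reg 5)))
          (Store 3 (Reg 13) (Sub (Reg 17) (Mult (Reg 11) (Reg 5)))))))"

lemma written_loops [simp]: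
  "written_regs scan = {5, 6, 7, 12, 16, 17}" "written_arrs scan = {2}"
  "written_regs scan_edge = {5, 6, 7, 16, 17}" "written_arrs scan_edge = {2}"
  "written_regs choose_candidates = {5}" "written_arrs choose_candidates = {2}"
  "written_regs zero_digits = {13}" "written_arrs zero_digits = {3}"
  "written_regs delete_tuple = {10, 13, 15}" "written_arrs delete_tuple = {1}"
  "written_regs next_tuple = {11, 13, 17}" "written_arrs next_tuple = {3}"
  by (auto simp: scan_def scan_edge_def choose_candidates_def zero_digits_def delete_tuple_def next_tuple_def)

section \<open>Correctness of the candidate scan and of the operations on tuples\<close>

context spanner_problem
begin

text \<open>Register 7 must not only bound the detours but be attained by a candidate: the number of
  candidates kept is then expressed by an actual edge, which links it to \<tau>. Register 6 at 0
  certifies that all candidates so far are lighter than the goal.\<close>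

definition scanned :: "nat \<Rightarrow> mem \<Rightarrow> bool" where
  "scanned i s \<longleftrightarrow> (let xs = filter (deletable I) [0..<i] in
     reg s 5 = length xs \<and> (\<forall>j<length xs. arr s 2 j = xs ! j) \<and>
     (\<forall>e\<in>set xs. bound I e \<le> reg s 7) \<and> (xs = [] \<and> reg s 7 = 0 \<or> (\<exists>e\<in>set xs. bound I e = reg s 7)) \<and>
     (if reg s 6 = 0 then \<forall>e\<in>set xs. ew e < W else reg s 6 - 1 \<in> set xs \<and> W \<le> ew (reg s 6 - 1)))"

lemma apsp_index_less:
  assumes "i < m"
  shows "2 * (eu i * n + ev i) + 1 < B"
proof -
  have "eu i * n \<le> S * S" using edge_sizes(1)[OF assms] sizes(1) by (simp add: mult_le_mono)
  moreover have "2 * (a + e) + 1 < 7 * t" if "a \<le> t" "e < S" "7 * S \<le> t" "7 \<le> S" for a e t :: nat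
    using that by auto
  ultimately have "2 * (eu i * n + ev i) + 1 < 7 * (S * S)"
    using edge_sizes(2)[OF assms] S_powers(1) sizes(6) by blast
  then show ?thesis using order_trans[OF S_powers(2) S_le(3)] by linarith
qed

lemma scanned_add:
  assumes s: "scanned i s" and del: "deletable I i"
    and r5: "reg s' 5 = Suc (reg s 5)" and a2: "arr s' 2 = (arr s 2)(reg s 5 := i)"
    and r7: "reg s' 7 = max (reg s 7) (bound I i)"
    and r6: "reg s' 6 = (if ew i < W then reg s 6 else Suc i)"
  shows "scanned (Suc i) s'"
proof -
  let ?xs = "filter (deletable I) [0..<i]"
  have len: "reg s 5 = length ?xs" and nth: "\<And>j. j < length ?xs \<Longrightarrow> arr s 2 j = ?xs ! j"
    and le: "\<And>e. e \<in> set ?xs \<Longrightarrow> bound I e \<le> reg s 7"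
    and max: "?xs = [] \<and> reg s 7 = 0 \<or> (\<exists>e\<in>set ?xs. bound I e = reg s 7)"
    and big: "if reg s 6 = 0 then \<forall>e\<in>set ?xs. ew e < W else reg s 6 - 1 \<in> set ?xs \<and> W \<le> ew (reg s 6 - 1)"
    using s unfolding scanned_def Let_def by blast+
  have xs: "filter (deletable I) [0..<Suc i] = ?xs @ [i]" using del by simp
  show ?thesis unfolding scanned_def Let_def xs
  proof (intro conjI allI impI ballI)
    show "reg s' 5 = length (?xs @ [i])" using r5 len by simp
    fix j assume "j < length (?xs @ [i])"
    then show "arr s' 2 j = (?xs @ [i]) ! j" using nth[of j] a2 len by (auto simp: nth_append)
  next
    fix e assume "e \<in> set (?xs @ [i])"
    then show "bound I e \<le> reg s' 7" using le[of e] r7 by auto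
  next
    have "\<exists>e\<in>set (?xs @ [i]). bound I e = reg s' 7"
    proof (cases "reg s 7 \<le> bound I i")
      case True
      then show ?thesis using r7 by (intro bexI[of _ i]) auto
    next
      case False
      then show ?thesis using r7 max by auto
    qed
    then show "?xs @ [i] = [] \<and> reg s' 7 = 0 \<or> (\<exists>e\<in>set (?xs @ [i]). bound I e = reg s' 7)" by blast
  next
    show "if reg s' 6 = 0 then \<forall>e\<in>set (?xs @ [i]). ew e < W
      else reg s' 6 - 1 \<in> set (?xs @ [i]) \<and> W \<le> ew (reg s' 6 - 1)"
      using big r6 by (cases "ew i < W"; cases "reg s 6 = 0") auto
  qed
qed

lemma scanned_skip:
  assumes "scanned i s" "\<not> deletable I i"
    and "\<And>x. x \<in> {5, 6, 7} \<Longrightarrow> reg s' x = reg s x" "arr s' 2 = arr s 2"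
  shows "scanned (Suc i) s'"
proof -
  have xs: "filter (deletable I) [0..<Suc i] = filter (deletable I) [0..<i]" using assms(2) by simp
  have regs: "reg s' 5 = reg s 5" "reg s' 6 = reg s 6" "reg s' 7 = reg s 7" using assms(3) by auto
  show ?thesis using assms(1) unfolding scanned_def xs regs assms(4) .
qed

lemma wp_scan_edge:
  assumes b: "bounded B s" and env: "env s" and i: "i < m" and r: "reg s 12 = i"
    and apsp: "ok_apsp2 sub_apsp (arr s 5)" and P: "scanned i s"
  shows "wp B scan_edge s 7 (scanned (Suc i))"
proof -
  note inp = input_edge[OF env i] and ed = envD[OF env]
  let ?x = "2 * (eu i * n + ev i)"
  let ?b = "arr s 5 (Suc ?x)"
  have "two_shortest (edges I) (len I) (eu i) (ev i) (arr s 5 ?x) ?b"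
    using apsp edge_facts[OF i] unfolding ok_apsp2_def by (auto simp: nodes_def)
  then have del: "deletable I i \<longleftrightarrow> 0 < ew i \<and> 0 < ?b \<and> ?b \<le> bound I i"
    using deletable_iff_two_shortest[OF vg st i, of "eu i" "ev i"] by simp
  have x: "Suc ?x < B" "?x < B" "eu i * n + ev i < B" "eu i * n < B"
    using apsp_index_less[OF i] by auto
  note x = x x[unfolded add_mult_distrib2]
  have pe: "stretch_num I * el i < B" using mult_bound_less_B[OF i] S_le by linarith
  have bd: "stretch_num I * el i div stretch_den I = bound I i" by (simp add: bound_def)
  have len5: "reg s 5 < B - 1"
  proof -
    have "reg s 5 \<le> i" using P length_filter_le[of "deletable I" "[0..<i]"] by (simp add: scanned_def Let_def)
    then show ?thesis using i sizes S_le by linarith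
  qed
  have r7: "reg s 7 < B" "bound I i < B" using b boundedD bound_less[OF i] S_le by (auto intro: less_le_trans)
  have r6: "reg s 6 < B" using b boundedD by auto
  note facts = const_less_B index_less_B i r inp ed x pe bd
  show ?thesis unfolding scan_edge_def
    apply (rule wp_Seq_Assign, fact)
     apply (intro fits_intros; (rule b | simp add: facts))
    apply (rule wp_Seq_Assign, assumption)
     apply (intro fits_intros; (assumption | simp add: facts))
    apply (rule wp_Cond)
      apply (intro fits_intros; (assumption | simp add: facts))
     apply (rule wp_Seq_Store, assumption)
       apply (intro fits_intros; (assumption | simp add: facts))
      apply (intro fits_intros; (assumption | simp add: facts))
     apply (rule wp_Seq_Assign, assumption)
      apply (intro fits_intros; (assumption | (simp add: facts; use len5 in linarith)))
     apply (rule wp_Seq_Assign, assumption)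
      apply (intro fits_intros; (assumption | (simp add: facts; use r7 in linarith)))
     apply (rule wp_Assign, assumption)
       apply (intro fits_intros; (assumption | (simp add: facts r6)))
      apply simp
    subgoal premises p for s1 s2 s3 s4 s5 s6
    proof -
      note eq = p(2,3,5,6,9,10,12,13,15,16,18,19)
      have "deletable I i" using p(7) unfolding del by (auto simp: facts eq split: if_splits)
      then show ?thesis
      proof (rule scanned_add[OF P])
      qed (auto simp: facts eq max_def)
    qed
    apply (rule wp_Skip, simp)
    subgoal premises p for s1 s2
    proof -
      note eq = p(2,3,5,6)
      have "\<not> deletable I i" using p(7) unfolding del by (auto simp: facts eq split: if_splits)
      then show ?thesis by (rule scanned_skip[OF P]) (auto simp: eq)
    qed
    done
qed



lemma scanned_cong:
  assumes "scanned i s" "\<And>x. x \<in> {5, 6, 7} \<Longrightarrow> reg s' x = reg s x" "arr s' 2 = arr s 2"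
  shows "scanned i s'"
proof -
  have regs: "reg s' 5 = reg s 5" "reg s' 6 = reg s 6" "reg s' 7 = reg s 7" using assms(2) by auto
  show ?thesis using assms(1) unfolding scanned_def regs assms(3) .
qed

lemma wp_scan:
  assumes b: "bounded B s" and env: "env s" and apsp: "ok_apsp2 sub_apsp (arr s 5)"
  shows "wp B scan s (5 + 9 * real m) (scanned m)"
  unfolding scan_def
  apply (rule wp_Seq_Assign, fact, (intro fits_intros; simp add: const_less_B))
  apply (rule wp_Seq_Assign, assumption, (intro fits_intros; simp add: const_less_B))
  apply (rule wp_Seq_Assign, assumption, (intro fits_intros; simp add: const_less_B))
  subgoal premises p for s1 s2 s3
  proof (rule wp_For[where n = m and ?T1.0 = 7 and P = scanned], goal_cases)
    case (9 i s')
    have f: "frame {5, 6, 7, 12, 16, 17} {2} s s'" using 9(3) p by (auto simp: frame_def)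
    have "env s'" by (rule env_frame[OF f _ _ env]) auto
    moreover have "arr s' 5 = arr s 5" using f by (simp add: frame_def)
    ultimately have "wp B scan_edge s' 7 (scanned (Suc i))" using wp_scan_edge[OF 9(2) _ 9(1,4) _ 9(5)] apsp by simp
    then show ?case
    proof (rule wp_conseq[OF _ 9(2)])
      fix t assume "scanned (Suc i) t"
      then show "\<forall>s3. reg s3 = (reg t)(12 := Suc i) \<longrightarrow> arr s3 = arr t \<longrightarrow> scanned (Suc i) s3"
        by (auto intro!: scanned_cong[of "Suc i" t])
    qed simp
  next
    case 1
    show ?case by fact
  next
    case 6
    show ?case using p envD[OF env] by simp
  next
    case (8 s')
    then show ?case using p by (simp add: scanned_def)
  qed (simp_all add: const_less_B)
  done

definition candidates :: "nat list \<Rightarrow> mem \<Rightarrow> bool" where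
  "candidates xs s \<longleftrightarrow> reg s 5 = length xs \<and> (\<forall>j<length xs. arr s 2 j = xs ! j)"

text \<open>What correctness and running time need to know about the candidate list. The length
  bound refers to an edge lighter than the goal, because only for such an edge do coupled instances
  bound the length. Length at most 1 covers an empty list and a single heavy candidate.\<close>

definition chosen :: "nat list \<Rightarrow> bool" where
  "chosen xs \<longleftrightarrow> set xs \<subseteq> {..<m} \<and> covers I xs \<and>
     (length xs \<le> 1 \<or> (\<exists>e<m. ew e < W \<and> length xs \<le> (2 * bound I e + 1) * W))"

lemma candidate_limit_less:
  assumes "d < S * S"
  shows "(2 * d + 1) * W < B" "2 * d + 1 < B"
proof -
  have "(2 * d + 1) * W \<le> (2 * (S * S)) * S" using assms sizes(3) by (intro mult_le_mono) auto
  also have "\<dots> = 2 * (S * S * S)" by simp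
  also have "\<dots> < 7 * (S * S * S)" using sizes(6) by simp
  also have "\<dots> \<le> S ^ 4" by (rule S_powers)
  also have "\<dots> \<le> B" by (rule S_power_le) simp
  finally show "(2 * d + 1) * W < B" .
  have "2 * d + 1 < 7 * (S * S)" using assms by linarith
  also have "\<dots> \<le> B" by (rule order_trans[OF S_powers(2) S_le(3)])
  finally show "2 * d + 1 < B" .
qed

lemma wp_choose_candidates:
  assumes b: "bounded B s" and env: "env s" and P: "scanned m s" and W: "1 \<le> W"
  shows "wp B choose_candidates s 3 (\<lambda>s'. \<exists>xs. candidates xs s' \<and> chosen xs)"
proof -
  note ed = envD[OF env]
  define xs where "xs = filter (deletable I) [0..<m]"
  have r5: "reg s 5 = length xs" and a2: "\<And>j. j < length xs \<Longrightarrow> arr s 2 j = xs ! j"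
    and le7: "\<And>e. e \<in> set xs \<Longrightarrow> bound I e \<le> reg s 7"
    and r7: "xs = [] \<and> reg s 7 = 0 \<or> (\<exists>e\<in>set xs. bound I e = reg s 7)"
    and r6: "if reg s 6 = 0 then \<forall>e\<in>set xs. ew e < W else reg s 6 - 1 \<in> set xs \<and> W \<le> ew (reg s 6 - 1)"
    using P unfolding scanned_def Let_def xs_def by blast+
  have xs: "\<And>i. i \<in> set xs \<Longrightarrow> i < m \<and> deletable I i" "distinct xs" by (auto simp: xs_def)
  have "reg s 7 < S * S" using r7 bound_less xs(1) sizes(6) by force
  note lim = candidate_limit_less[OF this]
  let ?l = "(2 * reg s 7 + 1) * W"
  show ?thesis unfolding choose_candidates_def
  proof (rule wp_Cond)
    assume "val s (Reg 6) \<noteq> 0"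
    then have e: "reg s 6 - 1 \<in> set xs" "W \<le> ew (reg s 6 - 1)" using r6 by auto
    have ch: "chosen [reg s 6 - 1]"
      using covers_single[OF W _ e(2)] xs(1)[OF e(1)] by (simp add: chosen_def)
    show "wp B (Seq (Store 2 (Const 0) (Sub (Reg 6) (Const 1))) (Assign 5 (Const 1))) s (3 - 1)
       (\<lambda>s'. \<exists>xs. candidates xs s' \<and> chosen xs)"
      apply (rule wp_Seq_Store, fact)
        apply (intro fits_intros; simp add: const_less_B)
       apply (intro fits_intros; (rule b | simp add: const_less_B))
      apply (rule wp_Assign, assumption)
        apply (intro fits_intros; simp add: const_less_B)
       apply simp
      apply (rule exI[of _ "[reg s 6 - 1]"])
      using ch by (simp add: candidates_def)
  next
    assume "val s (Reg 6) = 0"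
    then have small: "\<And>e. e \<in> set xs \<Longrightarrow> ew e < W" using r6 by auto
    let ?xs = "take ?l xs"
    have sub: "set ?xs \<subseteq> set xs" by (rule set_take_subset)
    \<comment> \<open>If the limit cuts nothing off, the list holds all candidates; otherwise it has
      exactly (2 d + 1) W of them, where \<open>d\<close> is register 7, and that many always
      suffice.\<close>
    have "covers I ?xs"
    proof (cases "length xs \<le> ?l")
      case True
      then show ?thesis using covers_deletable[OF valid W] by (simp add: xs_def)
    next
      case False
      then show ?thesis
        by (intro covers_many[where d = "reg s 7"] vg W) (use sub xs le7 in auto)
    qed
    moreover have "length ?xs \<le> 1 \<or> (\<exists>e<m. ew e < W \<and> length ?xs \<le> (2 * bound I e + 1) * W)"
      using r7
    proof
      assume "\<exists>e\<in>set xs. bound I e = reg s 7"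
      then obtain e where e: "e \<in> set xs" "bound I e = reg s 7" by blast
      then have "e < m" "ew e < W" "length ?xs \<le> (2 * bound I e + 1) * W" using xs(1) small by auto
      then show ?thesis by blast
    qed simp
    ultimately have ch: "chosen ?xs" using sub xs by (auto simp: chosen_def)
    show "wp B (Assign 5 (Sub (Reg 5) (Sub (Reg 5) (Mult (Add (Mult (Const 2) (Reg 7)) (Const 1)) (Reg 2))))) s (3 - 1)
       (\<lambda>s'. \<exists>xs. candidates xs s' \<and> chosen xs)"
      apply (rule wp_Assign, fact)
        apply (intro fits_intros; (rule b | use lim in \<open>simp add: const_less_B ed\<close>))
       apply simp
      apply (rule exI[of _ ?xs])
      using ch a2 by (auto simp: candidates_def ed r5)
  qed (use b in \<open>simp add: boundedD\<close>)
qed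

lemma wp_zero_digits:
  assumes b: "bounded B s" and env: "env s"
  shows "wp B zero_digits s (2 + 3 * real W) (\<lambda>s'. \<forall>j<W. arr s' 3 j = 0)"
  unfolding zero_digits_def
proof (rule wp_For[where n = W and ?T1.0 = 1 and P = "\<lambda>i s'. \<forall>j<i. arr s' 3 j = 0"], goal_cases)
  case (9 i s')
  show ?case
    apply (rule wp_Store, rule 9)
       apply (intro fits_intros; (rule 9 | simp add: const_less_B))
      apply (intro fits_intros; (rule 9 | simp add: const_less_B))
     apply simp
    using 9 by (auto simp: less_Suc_eq)
qed (use b env in \<open>auto simp: const_less_B envD\<close>)

text \<open>A set, since repeated entries are deleted once; the prefixes \<open>j < W\<close> occur
  in loop invariants.\<close>

definition tuple :: "nat list \<Rightarrow> nat \<Rightarrow> nat \<Rightarrow> nat set" where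
  "tuple xs k j = (\<lambda>i. xs ! digit (length xs) k i) ` {..<j}"

lemma tuple_Suc: "tuple xs k (Suc j) = insert (xs ! digit (length xs) k j) (tuple xs k j)"
  by (simp add: tuple_def lessThan_Suc)

lemma tuple_0: "tuple xs k 0 = {}"
  by (simp add: tuple_def)

lemma candidate_less:
  assumes "chosen xs" "0 < length xs"
  shows "digit (length xs) k j < length xs" "xs ! digit (length xs) k j < m"
proof -
  show d: "digit (length xs) k j < length xs" using assms by (simp add: digit_def)
  then show "xs ! digit (length xs) k j < m" using assms(1) nth_mem[OF d] by (meson chosen_def lessThan_iff subsetD)
qed

lemma tuple_subset: "chosen xs \<Longrightarrow> 0 < length xs \<Longrightarrow> tuple xs k j \<subseteq> {..<m}"
  using candidate_less by (auto simp: tuple_def)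

text \<open>Why register 10 does not overflow: as repeated entries count once, the saved weight is
  at most the total weight in the input.\<close>

lemma saved_less: "X \<subseteq> {..<m} \<Longrightarrow> saved I X < S"
proof -
  assume "X \<subseteq> {..<m}"
  then have "saved I X \<le> (\<Sum>i<m. ew i)" unfolding saved_def by (intro sum_mono2) auto
  also have "\<dots> \<le> (\<Sum>i<m. eu i + ev i + ew i + el i)" by (intro sum_mono) auto
  finally show ?thesis using sizes(8) by simp
qed

definition at_tuple :: "nat list \<Rightarrow> nat \<Rightarrow> mem \<Rightarrow> bool" where
  "at_tuple xs k s \<longleftrightarrow> env s \<and> candidates xs s \<and> (\<forall>j<W. arr s 3 j = digit (length xs) k j)"

lemma at_tuple_frame:
  "frame R A s s' \<Longrightarrow> A \<inter> {0, 2, 3} = {} \<Longrightarrow> R \<inter> {0, 1, 2, 3, 4, 5} = {} \<Longrightarrow> at_tuple xs k s \<Longrightarrow> at_tuple xs k s'"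
  by (auto simp: at_tuple_def env_def candidates_def frame_def)

definition marks :: "nat set \<Rightarrow> mem \<Rightarrow> bool" where
  "marks X s \<longleftrightarrow> (\<forall>i<m. arr s 1 (Suc i) = (if i \<in> X then 0 else 1))"

lemma wp_delete_tuple:
  assumes b: "bounded B s" and ch: "chosen xs" "0 < length xs" and at: "at_tuple xs k s" and mk: "marks {} s"
  shows "wp B delete_tuple s (3 + 5 * real W)
    (\<lambda>s'. arr s' 1 0 = arr s 1 0 \<and> reg s' 10 = saved I (tuple xs k W) \<and> marks (tuple xs k W) s')"
  unfolding delete_tuple_def
  apply (rule wp_Seq_Assign, fact, (intro fits_intros; simp add: const_less_B))
  subgoal premises p for s1
  proof (rule wp_For[where n = W and ?T1.0 = 3 and P = "\<lambda>j s'. arr s' 1 0 = arr s 1 0 \<and>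
     reg s' 10 = saved I (tuple xs k j) \<and> marks (tuple xs k j) s'"], goal_cases)
    case (9 j s')
    have f: "frame {10, 13, 15} {1} s s'" using 9(3) p by (auto simp: frame_def)
    have at': "at_tuple xs k s'" by (rule at_tuple_frame[OF f _ _ at]) auto
    let ?i = "xs ! digit (length xs) k j"
    note i = candidate_less[OF ch, of k j]
    have env: "env s'" and c: "arr s' 2 (arr s' 3 j) = ?i"
      using at' i 9(1) by (auto simp: at_tuple_def candidates_def)
    note inp = input_edge[OF env i(2)]
    let ?X = "tuple xs k j"
    have X: "tuple xs k (Suc j) = insert ?i ?X" by (rule tuple_Suc)
    have fin: "finite ?X" by (simp add: tuple_def)
    have mk': "arr s' 1 (Suc ?i) = (if ?i \<in> ?X then 0 else 1)" using 9 i by (simp add: marks_def)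
    have r10: "reg s' 10 = saved I ?X" and a10: "arr s' 1 0 = arr s 1 0" using 9 by auto
    \<comment> \<open>The mark of an entry deleted before is 0, so its weight is not added
      again.\<close>
    have sv: "saved I ?X + ew ?i * (if ?i \<in> ?X then 0 else 1) = saved I (insert ?i ?X)"
      using fin by (auto simp: saved_def insert_absorb)
    have svB: "saved I (insert ?i ?X) < B"
      using saved_less[OF tuple_subset[OF ch, of k "Suc j"]] less_B X by simp
    have svB: "saved I ?X < B" "?i \<notin> ?X \<Longrightarrow> saved I ?X + ew ?i < B" using svB sv by (auto split: if_splits)
    have ewB: "ew ?i < B" using edge_sizes[OF i(2)] less_B by auto
    note facts = const_less_B index_less_B[OF i(2)] inp c mk' mk'[unfolded One_nat_def] r10 svB ewB 9(4)
    show ?case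
      apply (rule wp_Seq_Assign, rule 9)
       apply (intro fits_intros; (rule 9 | simp add: facts))
      apply (rule wp_Seq_Assign, assumption)
       apply (intro fits_intros; (assumption | simp add: facts))
      apply (rule wp_Store, assumption)
         apply (intro fits_intros; (assumption | simp add: facts))
        apply (intro fits_intros; (assumption | simp add: facts))
       apply simp
      unfolding X using 9(5) sv a10 by (auto simp: facts marks_def saved_def)
  qed (use p mk envD at b in \<open>auto simp: const_less_B tuple_0 marks_def saved_def at_tuple_def\<close>)
  done

text \<open>During the loop the positions below \<open>j\<close> hold digits of
  \<open>Suc k\<close>, the others still those of \<open>k\<close>, and register 11 holds the carry
  of \<open>digit_Suc_carry\<close>.\<close>

lemma wp_next_tuple:
  assumes b: "bounded B s" and xs: "0 < length xs" and at: "at_tuple xs k s" and k: "k < length xs ^ W"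
  shows "wp B next_tuple s (3 + 5 * real W)
    (\<lambda>s'. (\<forall>j<W. arr s' 3 j = digit (length xs) (Suc k) j) \<and>
       reg s' 11 = (if Suc k < length xs ^ W then 0 else 1))"
  unfolding next_tuple_def
  apply (rule wp_Seq_Assign, fact, (intro fits_intros; simp add: const_less_B))
  subgoal premises p for s1
  proof (rule wp_For[where n = W and ?T1.0 = 3 and P = "\<lambda>j s'.
     (\<forall>i<W. arr s' 3 i = digit (length xs) (if i < j then Suc k else k) i) \<and>
     reg s' 11 = Suc k div length xs ^ j - k div length xs ^ j"], goal_cases)
    case (9 j s')
    let ?N = "length xs"
    define c where "c j = Suc k div ?N ^ j - k div ?N ^ j" for j
    have r5: "reg s' 5 = ?N" using 9(3) p at by (auto simp: frame_def at_tuple_def candidates_def)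
    have a3: "arr s' 3 j = digit ?N k j" and r11: "reg s' 11 = c j" using 9(1,5) by (auto simp: c_def)
    note carry = digit_Suc_carry[OF xs, of k j, folded c_def]
    have "(digit ?N k j + c j) - (digit ?N k j + c j) div ?N * ?N = (digit ?N k j + c j) mod ?N"
      by (simp add: minus_div_mult_eq_mod)
    then have md: "(digit ?N k j + c j) - c (Suc j) * ?N = digit ?N (Suc k) j" using carry by simp
    have c1: "c j \<le> 1"
    proof -
      have "Suc k div ?N ^ j \<le> Suc (k div ?N ^ j)" by (simp add: div_Suc)
      then show ?thesis by (simp add: c_def)
    qed
    have dB: "digit ?N k j < ?N" using xs by (simp add: digit_def)
    have "?N < B" using 9(2) r5 boundedD(1) by metis
    then have sB: "digit ?N k j + c j < B" using dB c1 by linarith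
    have "c (Suc j) * ?N \<le> digit ?N k j + c j" using carry by (metis div_times_less_eq_dividend)
    then have mB: "c (Suc j) * ?N < B" using sB by linarith
    note facts = const_less_B a3 r11 r5 9(4) carry md sB mB
    show ?case
      apply (rule wp_Seq_Assign, rule 9)
       apply (intro fits_intros; (rule 9 | simp add: facts))
      apply (rule wp_Seq_Assign, assumption)
       apply (intro fits_intros; (assumption | simp add: facts))
      apply (rule wp_Store, assumption)
         apply (intro fits_intros; (assumption | simp add: facts))
        apply (intro fits_intros; (assumption | simp add: facts))
       apply simp
      using 9(1,5) by (auto simp: facts less_Suc_eq c_def[of "Suc j", symmetric] simp del: power_Suc)
  next
    case (10 s')
    \<comment> \<open>The carry out of the last position is 1 exactly if \<open>k\<close> was the
      last tuple number.\<close>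
    have "Suc k div length xs ^ W = (if Suc k < length xs ^ W then 0 else 1)"
    proof (cases "Suc k < length xs ^ W")
      case False
      then have "length xs ^ W = Suc k" using k by simp
      then show ?thesis by simp
    qed simp
    then show ?case using 10 k by simp
  qed (use p envD at b k in \<open>auto simp: const_less_B at_tuple_def\<close>)
  done

end

text \<open>Arrays 4 and 5 are the subroutine's arrays 0 and 1. The marks select between the
  original length and one just above the limit in register 16; register 9 collects the conjunction
  of the tests as a product.\<close>

definition detour_edge :: "com \<Rightarrow> com" where
  "detour_edge spsp =
     Seq (Assign 15 (Elem 2 (Elem 3 (Reg 13))))
    (Seq (Assign 16 (Div (Mult (Reg 3) (field 8 15)) (Reg 4)))
    (Seq (Store 4 (Const 0) (Reg 0))
    (Seq (Store 4 (Const 1) (Reg 1))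
    (Seq (Store 4 (Const 2) (field 5 15))
    (Seq (Store 4 (Const 3) (field 6 15))
    (Seq (load_edges 4 (Add (Mult (mark 14) (field 8 14))
           (Mult (Sub (Const 1) (mark 14)) (Add (Reg 16) (Const 1)))))
    (Seq (shift_com 20 4 spsp)
         (Assign 9 (Mult (Reg 9) (Sub (Const 1) (Less (Reg 16) (Elem 5 (Const 1)))))))))))))"

definition check_tuple :: "com \<Rightarrow> com" where
  "check_tuple spsp = Seq (Assign 9 (Sub (Const 1) (Less (Reg 10) (Reg 2)))) (For 13 2 (detour_edge spsp))"

definition search_step :: "com \<Rightarrow> com" where
  "search_step spsp = Seq mark_all (Seq delete_tuple (Seq (check_tuple spsp)
     (Cond (Reg 9) (Assign 8 (Const 0))
       (Seq next_tuple (Cond (Reg 11) (Seq (Store 1 (Const 0) (Const 0)) (Assign 8 (Const 0))) Skip)))))"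

definition search :: "com \<Rightarrow> com" where
  "search spsp = Cond (Reg 5)
     (Seq zero_digits (Seq (Assign 8 (Const 1)) (While (Reg 8) (search_step spsp))))
     (Store 1 (Const 0) (Const 0))"

definition find_candidates :: "com \<Rightarrow> com" where
  "find_candidates apsp2 =
     Seq (Store 4 (Const 0) (Reg 0))
    (Seq (Store 4 (Const 1) (Reg 1))
    (Seq (load_edges 2 (field 8 14))
    (Seq (shift_com 20 4 apsp2)
    (Seq scan choose_candidates))))"

text \<open>Goal 0 is handled apart, since \<open>covers\<close> is established only for positive
  goals: deleting nothing is then a solution, and all marks are already set. The decision starts as
  1 and is overwritten only when the search fails.\<close>

definition solver :: "com \<Rightarrow> com \<Rightarrow> com" where
  "solver spsp apsp2 = Seq setup_regs (Seq mark_all (Seq (Store 1 (Const 0) (Const 1))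
     (Cond (Reg 2) (Seq (find_candidates apsp2) (search spsp)) Skip)))"

lemma written_detour_edge:
  "x < 20 \<Longrightarrow> x \<in> written_regs (detour_edge spsp) \<longleftrightarrow> x \<in> {9, 14, 15, 16}"
  "a < 4 \<Longrightarrow> a \<notin> written_arrs (detour_edge spsp)"
  by (auto simp: detour_edge_def not_written_shift)

lemma written_check_tuple:
  "x < 20 \<Longrightarrow> x \<in> written_regs (check_tuple spsp) \<longleftrightarrow> x \<in> {9, 13, 14, 15, 16}"
  "a < 4 \<Longrightarrow> a \<notin> written_arrs (check_tuple spsp)"
  by (auto simp: check_tuple_def written_detour_edge)

section \<open>Correctness and cost of the detour tests, the tuple search and the whole
  program\<close>

locale spanner_solver = spanner_problem +
  fixes SPSP APSP2 :: "nat \<Rightarrow> nat \<Rightarrow> real" and spsp apsp2 :: com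
  assumes runs_spsp: "\<And>J. valid_spsp J \<Longrightarrow> sum_list (enc_spsp J) + length (enc_spsp J) + 2 \<le> S ^ 5 \<Longrightarrow>
      runs B spsp (enc_spsp J) (SPSP (size_nodes J) (size_edges J)) (ok_spsp J)"
    and runs_apsp2: "\<And>G. valid_graph G \<Longrightarrow> sum_list (enc_apsp2 G) + length (enc_apsp2 G) + 2 \<le> S ^ 5 \<Longrightarrow>
      runs B apsp2 (enc_apsp2 G) (APSP2 (size_nodes G) (size_edges G)) (ok_apsp2 G)"
    and SPSP_nonneg: "0 \<le> SPSP (size_nodes I) (size_edges I)"
begin

lemma at_tuple_frame_low:
  assumes "frame R A s s'" "\<And>a. a < 4 \<Longrightarrow> a \<noteq> 1 \<Longrightarrow> a \<notin> A" "\<And>x. x < 6 \<Longrightarrow> x \<notin> R" "at_tuple xs k s"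
  shows "at_tuple xs k s'"
  by (rule at_tuple_frame[OF assms(1) _ _ assms(4)]) (use assms(2,3) in auto)

text \<open>The 9 consists of six writes, 2 for the loop that loads the edges, and the final
  test.\<close>

lemma wp_detour_edge:
  assumes b: "bounded B s" and ch: "chosen xs" "0 < length xs" and at: "at_tuple xs k s"
    and X: "X \<subseteq> {..<m}" and mk: "marks X s" and j: "j < W" "reg s 13 = j"
    and r9: "reg s 9 = (if P then 1 else 0)"
  shows "wp B (detour_edge spsp) s (SPSP n m + 5 * real m + 9)
    (\<lambda>s'. reg s' 9 = (if P \<and> replaceable I X (xs ! digit (length xs) k j) then 1 else 0))"
proof -
  define i where "i = xs ! digit (length xs) k j"
  have env: "env s" and c: "arr s 2 (arr s 3 j) = i"
    using at candidate_less[OF ch, of k j] j(1) by (auto simp: at_tuple_def candidates_def i_def)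
  have i: "i < m" using candidate_less[OF ch, of k j] by (simp add: i_def)
  note inp = input_edge[OF env i] and ed = envD[OF env]
  have pe: "stretch_num I * el i < B" using mult_bound_less_B[OF i] S_le by linarith
  have bd: "stretch_num I * el i div stretch_den I = bound I i" by (simp add: bound_def)
  note facts = const_less_B index_less_B[OF i] inp c j ed pe bd
  let ?e = "Add (Mult (mark 14) (field 8 14)) (Mult (Sub (Const 1) (mark 14)) (Add (Reg 16) (Const 1)))"
  show ?thesis unfolding detour_edge_def i_def[symmetric]
    apply (rule wp_Seq_Assign, fact, (intro fits_intros; (rule b | simp add: facts)))
    apply (rule wp_Seq_Assign, assumption, (intro fits_intros; (assumption | simp add: facts)))
    apply (rule wp_Seq_Store, assumption, (intro fits_intros; (assumption | simp add: facts)), (intro fits_intros; (assumption | simp add: facts)))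
    apply (rule wp_Seq_Store, assumption, (intro fits_intros; (assumption | simp add: facts)), (intro fits_intros; (assumption | simp add: facts)))
    apply (rule wp_Seq_Store, assumption, (intro fits_intros; (assumption | simp add: facts)), (intro fits_intros; (assumption | simp add: facts)))
    apply (rule wp_Seq_Store, assumption, (intro fits_intros; (assumption | simp add: facts)), (intro fits_intros; (assumption | simp add: facts)))
    subgoal premises p for s1 s2 s3 s4 s5 s6
    proof -
      have b6: "bounded B s6" by fact
      have f6: "frame {15, 16} {4} s s6" using p by (auto simp: frame_def)
      have r6: "reg s6 16 = bound I i" using p(2,3,5,6,8,9,11,12,14,15,17,18) by (simp add: facts)
      have a6: "arr s6 4 0 = n" "arr s6 4 1 = m" "arr s6 4 2 = eu i" "arr s6 4 3 = ev i"
        using p(2,3,5,6,8,9,11,12,14,15,17,18) by (simp_all add: facts)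
      have env6: "env s6" by (rule env_frame[OF f6 _ _ env]) auto
      let ?l = "\<lambda>l. len (sub_spsp X i) (edge_at I l)"
      have "wp B (load_edges 4 ?e) s6 (2 + 5 * real m) (\<lambda>s'. (\<forall>l<4. arr s' 4 l = arr s6 4 l) \<and>
        (\<forall>l<m. arr s' 4 (4 + 3 * l) = eu l \<and> arr s' 4 (4 + 3 * l + 1) = ev l \<and> arr s' 4 (4 + 3 * l + 2) = ?l l))"
      proof (rule wp_load_edges[OF b6 env6])
        fix l s' assume l: "l < m" and b': "bounded B s'" and f': "frame {14} {4} s6 s'" and r14: "reg s' 14 = l"
        have f: "frame {14, 15, 16} {4} s s'" using f6 f' by (auto simp: frame_def)
        have "env s'" by (rule env_frame[OF f _ _ env]) auto
        note inp' = input_edge[OF this l]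
        have m1: "arr s' 1 (Suc l) = (if l \<in> X then 0 else 1)" using mk l f by (simp add: marks_def frame_def)
        have L: "reg s' 16 = bound I i" using f' r6 by (simp add: frame_def)
        \<comment> \<open>Marks refer to positions, lengths to edges; injectivity of
          \<open>edge_at\<close> identifies the two.\<close>
        have mem: "edge_at I l \<in> edge_at I ` X \<longleftrightarrow> l \<in> X"
          using inj_on_image_mem_iff[OF inj_on_edge_at[OF vg] _ X] l by auto
        have SB: "Suc (bound I i) < B" "el l < B"
          using bound_less[OF i] S_powers(1) S_le edge_sizes[OF l] sizes(6) candidate_limit_less(2)[OF bound_less[OF i]] by auto
        note facts' = const_less_B index_less_B[OF l] inp' m1 m1[unfolded One_nat_def] L r14 SB
        show "fits B s' ?e \<and> val s' ?e = ?l l"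
          apply (rule conjI)
           apply (intro fits_intros; (rule b' | simp add: facts'))
          by (simp add: facts' sub_spsp_def mem)
      qed simp
      then show ?thesis
      proof (rule wp_Seq[OF _ b6])
        fix s7 assume b7: "bounded B s7"
          and f7: "frame (written_regs (load_edges 4 ?e)) (written_arrs (load_edges 4 ?e)) s6 s7"
          and a7: "(\<forall>l<4. arr s7 4 l = arr s6 4 l) \<and>
            (\<forall>l<m. arr s7 4 (4 + 3 * l) = eu l \<and> arr s7 4 (4 + 3 * l + 1) = ev l \<and> arr s7 4 (4 + 3 * l + 2) = ?l l)"
        have inp7: "holds_input (enc_spsp (sub_spsp X i)) (view 20 4 s7)"
          unfolding holds_input_def enc_sub_spsp
        proof (intro allI impI, rule nth_append_blocks[where b = 3 and c = 4])
          fix l assume "l < (4::nat)"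
          then have "l = 0 \<or> l = 1 \<or> l = 2 \<or> l = 3" by auto
          then show "arr (view 20 4 s7) 0 l = [n, m, eu i, ev i] ! l"
            using a7 a6 by (auto simp: view_def)
        next
          fix l r assume "l < length (edge_list I)" "r < (3::nat)"
          then have "l < m" "r = 0 \<or> r = 1 \<or> r = 2" by (auto simp: size_edges_def)
          then show "arr (view 20 4 s7) 0 (4 + (3 * l + r)) =
              (\<lambda>(u, v). [u, v, len (sub_spsp X i) {u, v}]) (edge_list I ! l) ! r"
            using a7 by (auto simp: view_def split_beta edge_at_pair)
        qed auto
        have "wp B (shift_com 20 4 spsp) s7 (SPSP n m) (\<lambda>s'. ok_spsp (sub_spsp X i) (arr s' 5))"
          using wp_shift[OF runs_spsp[OF valid_sub_spsp[OF i] size_sub_spsp[OF i]] b7 inp7] by simp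
        then show "wp B (Seq (shift_com 20 4 spsp)
            (Assign 9 (Mult (Reg 9) (Sub (Const 1) (Less (Reg 16) (Elem 5 (Const 1))))))) s7
            (SPSP n m + 5 * real m + 9 - 1 - 1 - 1 - 1 - 1 - 1 - (2 + 5 * real m))
            (\<lambda>s'. reg s' 9 = (if P \<and> replaceable I X i then 1 else 0))"
        proof (rule wp_Seq[OF _ b7])
          fix s8 assume b8: "bounded B s8"
            and f8: "frame (written_regs (shift_com 20 4 spsp)) (written_arrs (shift_com 20 4 spsp)) s7 s8"
            and ok: "ok_spsp (sub_spsp X i) (arr s8 5)"
          have r8: "reg s8 9 = (if P then 1 else 0)" "reg s8 16 = bound I i"
            using frameD(1)[OF f8] frameD(1)[OF f7] frameD(1)[OF f6] r6 r9 by (simp_all add: not_written_shift)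
          show "wp B (Assign 9 (Mult (Reg 9) (Sub (Const 1) (Less (Reg 16) (Elem 5 (Const 1)))))) s8
            (SPSP n m + 5 * real m + 9 - 1 - 1 - 1 - 1 - 1 - 1 - (2 + 5 * real m) - SPSP n m)
            (\<lambda>s'. reg s' 9 = (if P \<and> replaceable I X i then 1 else 0))"
            apply (rule wp_Assign, fact)
              apply (intro fits_intros; (rule b8 | simp add: const_less_B r8))
             apply simp
            using ok_sub_spsp[OF i ok] by (auto simp: r8)
        qed
      qed
    qed
    done
qed

text \<open>Every entry is tested with the whole tuple deleted, not only the prefix examined so far;
  hence all its marks are cleared beforehand.\<close>

lemma wp_check_tuple:
  assumes b: "bounded B s" and ch: "chosen xs" "0 < length xs" and at: "at_tuple xs k s"
    and mk: "marks (tuple xs k W) s" and r10: "reg s 10 = saved I (tuple xs k W)"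
  shows "wp B (check_tuple spsp) s (3 + real W * (SPSP n m + 5 * real m + 11))
    (\<lambda>s'. reg s' 9 = (if W \<le> saved I (tuple xs k W) \<and> feasible I (tuple xs k W) then 1 else 0))"
  unfolding check_tuple_def
  apply (rule wp_Seq_Assign, fact, (intro fits_intros; (rule b | simp add: const_less_B)))
  subgoal premises p for s1
  proof (rule wp_For[where n = W and ?T1.0 = "SPSP n m + 5 * real m + 9" and P = "\<lambda>j s'.
     reg s' 9 = (if W \<le> saved I (tuple xs k W) \<and> (\<forall>i\<in>tuple xs k j. replaceable I (tuple xs k W) i) then 1 else 0)"], goal_cases)
    case (9 j s')
    have f: "frame (insert 9 (insert 13 (written_regs (detour_edge spsp)))) (written_arrs (detour_edge spsp)) s s'"
      using 9(3) p by (auto simp: frame_def)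
    have at': "at_tuple xs k s'"
      by (rule at_tuple_frame_low[OF f _ _ at]) (auto simp: written_detour_edge)
    have mk': "marks (tuple xs k W) s'" using mk f by (simp add: marks_def frame_def written_detour_edge)
    note w = wp_detour_edge[OF 9(2) ch at' tuple_subset[OF ch] mk' 9(1,4,5)]
    show ?case by (rule wp_conseq[OF w 9(2)]) (auto simp: tuple_Suc)
  next
    case (10 s')
    then show ?case by (simp add: feasible_def)
  next
    case 7
    show ?case by (simp add: algebra_simps)
  qed (use p b SPSP_nonneg envD at r10 in \<open>auto simp: const_less_B at_tuple_def tuple_0 written_detour_edge\<close>)
  done


definition good :: "nat set \<Rightarrow> bool" where
  "good X \<longleftrightarrow> W \<le> saved I X \<and> feasible I X"

text \<open>The sum of 2 + 3 m for the marks, 3 + 5 W for the deletions, 3 + W (SPSP + 5 m + 11) for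
  the tests, and 7 + 5 W for the evaluation and the next tuple.\<close>

abbreviation step_time :: real where
  "step_time \<equiv> 15 + 3 * real m + real W * (SPSP n m + 5 * real m + 21)"

lemma wp_search_step:
  assumes b: "bounded B s" and ch: "chosen xs" "0 < length xs" and at: "at_tuple xs k s"
    and k: "k < length xs ^ W" and r8: "reg s 8 = 1" and out: "arr s 1 0 = 1"
  shows "wp B (search_step spsp) s step_time (\<lambda>s'.
    if good (tuple xs k W) then reg s' 8 = 0 \<and> ok_spanner I (arr s' 1)
    else if Suc k < length xs ^ W then at_tuple xs (Suc k) s' \<and> reg s' 8 = 1 \<and> arr s' 1 0 = 1
    else reg s' 8 = 0 \<and> arr s' 1 0 = 0)"
  (is "wp B _ s _ ?Q")
proof -
  let ?X = "tuple xs k W"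
  have env: "env s" using at by (simp add: at_tuple_def)
  let ?next = "Seq next_tuple (Cond (Reg 11) (Seq (Store 1 (Const 0) (Const 0)) (Assign 8 (Const 0))) Skip)"
  let ?test = "Cond (Reg 9) (Assign 8 (Const 0)) ?next"
  show ?thesis unfolding search_step_def
  proof (rule wp_Seq[OF wp_mark_all[OF b env] b])
    fix s1 assume b1: "bounded B s1" and f1: "frame (written_regs mark_all) (written_arrs mark_all) s s1"
      and m1: "\<forall>i. arr s1 1 i = (if 1 \<le> i \<and> i \<le> m then 1 else arr s 1 i)"
    have at1: "at_tuple xs k s1" by (rule at_tuple_frame[OF f1 _ _ at]) auto
    have mk1: "marks {} s1" and o1: "arr s1 1 0 = 1" using m1 out by (auto simp: marks_def)
    have r81: "reg s1 8 = 1" using r8 f1 by (simp add: frame_def)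
    show "wp B (Seq delete_tuple (Seq (check_tuple spsp) ?test)) s1
       (step_time - (2 + 3 * real m)) ?Q"
    proof (rule wp_Seq[OF wp_delete_tuple[OF b1 ch at1 mk1] b1], elim conjE)
      fix s2 assume b2: "bounded B s2" and f2: "frame (written_regs delete_tuple) (written_arrs delete_tuple) s1 s2"
        and o2: "arr s2 1 0 = arr s1 1 0" and r102: "reg s2 10 = saved I ?X" and mk2: "marks ?X s2"
      have at2: "at_tuple xs k s2" by (rule at_tuple_frame[OF f2 _ _ at1]) auto
      show "wp B (Seq (check_tuple spsp) ?test) s2
         (step_time - (2 + 3 * real m) - (3 + 5 * real W)) ?Q"
      proof (rule wp_Seq[OF wp_check_tuple[OF b2 ch at2 mk2 r102] b2])
        fix s3 assume b3: "bounded B s3"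
          and f3: "frame (written_regs (check_tuple spsp)) (written_arrs (check_tuple spsp)) s2 s3"
          and r93: "reg s3 9 = (if W \<le> saved I ?X \<and> feasible I ?X then 1 else 0)"
        have at3: "at_tuple xs k s3" by (rule at_tuple_frame_low[OF f3 _ _ at2]) (auto simp: written_check_tuple)
        have mk3: "marks ?X s3" and o3: "arr s3 1 0 = 1"
          using mk2 frameD(2)[OF f3, of 1] o1 o2 by (simp_all add: marks_def written_check_tuple)
        have r83: "reg s3 8 = 1"
          using frameD(1)[OF f3, of 8] frameD(1)[OF f2, of 8] r81 by (simp add: written_check_tuple)
        have time: "step_time - (2 + 3 * real m) - (3 + 5 * real W) - (3 + real W * (SPSP n m + 5 * real m + 11))
          = 7 + 5 * real W" by (simp add: algebra_simps)
        show "wp B ?test s3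
         (step_time - (2 + 3 * real m) - (3 + 5 * real W) - (3 + real W * (SPSP n m + 5 * real m + 11))) ?Q"
          unfolding time
        proof (rule wp_Cond)
          show "fits B s3 (Reg 9)" using b3 by (simp add: boundedD)
        next
          assume "val s3 (Reg 9) \<noteq> 0"
          then have g: "good ?X" using r93 by (simp add: good_def split: if_splits)
          have "ok_spanner I (arr s3 1)"
            by (rule ok_yes[OF tuple_subset[OF ch, of k W]]) (use g o3 mk3 in \<open>auto simp: good_def marks_def\<close>)
          then show "wp B (Assign 8 (Const 0)) s3 (7 + 5 * real W - 1) ?Q"
            by (intro wp_Assign b3) (use g in \<open>auto simp: const_less_B\<close>)
        next
          assume "val s3 (Reg 9) = 0"
          then have g: "\<not> good ?X" using r93 by (simp add: good_def split: if_splits)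
          show "wp B ?next s3
            (7 + 5 * real W - 1) ?Q"
          proof (rule wp_Seq[OF wp_next_tuple[OF b3 ch(2) at3 k] b3], elim conjE)
            fix s4 assume b4: "bounded B s4" and f4: "frame (written_regs next_tuple) (written_arrs next_tuple) s3 s4"
              and d4: "\<forall>j<W. arr s4 3 j = digit (length xs) (Suc k) j"
              and r114: "reg s4 11 = (if Suc k < length xs ^ W then 0 else 1)"
            have at4: "at_tuple xs (Suc k) s4"
              using at3 f4 d4 by (auto simp: at_tuple_def env_def candidates_def frame_def)
            have r84: "reg s4 8 = 1" and o4: "arr s4 1 0 = 1" using f4 r83 o3 by (simp_all add: frame_def)
            show "wp B (Cond (Reg 11) (Seq (Store 1 (Const 0) (Const 0)) (Assign 8 (Const 0))) Skip) s4
              (7 + 5 * real W - 1 - (3 + 5 * real W)) ?Q"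
            proof (rule wp_Cond)
              show "fits B s4 (Reg 11)" using b4 by (simp add: boundedD)
            next
              assume "val s4 (Reg 11) \<noteq> 0"
              then have nk: "\<not> Suc k < length xs ^ W" using r114 by auto
              show "wp B (Seq (Store 1 (Const 0) (Const 0)) (Assign 8 (Const 0))) s4
                (7 + 5 * real W - 1 - (3 + 5 * real W) - 1) ?Q"
                apply (rule wp_Seq_Store, fact)
                  apply (simp add: const_less_B)
                 apply (simp add: const_less_B)
                apply (rule wp_Assign, assumption)
                  apply (simp add: const_less_B)
                 apply simp
                using g nk by simp
            next
              assume "val s4 (Reg 11) = 0"
              then have "Suc k < length xs ^ W" using r114 by (auto split: if_splits)
              then show "wp B Skip s4 (7 + 5 * real W - 1 - (3 + 5 * real W) - 1) ?Q"
                by (intro wp_Skip) (use g at4 r84 o4 in auto)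
            qed
          qed
        qed
      qed
    qed
  qed
qed

text \<open>Induction on the number of tuples left. All earlier tuples have failed, so reaching the
  end means that no tuple is good, which by \<open>covers\<close> excludes a witness.\<close>

lemma wp_search_loop:
  assumes "bounded B s" "chosen xs" "0 < length xs" "at_tuple xs k s" "k < length xs ^ W"
    "reg s 8 = 1" "arr s 1 0 = 1" "\<And>k'. k' < k \<Longrightarrow> \<not> good (tuple xs k' W)"
  shows "wp B (While (Reg 8) (search_step spsp)) s
    (1 + real (length xs ^ W - k) * (step_time + 1)) (\<lambda>s'. ok_spanner I (arr s' 1))"
  using assms
proof (induction "length xs ^ W - k" arbitrary: k s)
  case 0
  then show ?case by simp
next
  case (Suc d)
  note ch = Suc.prems(2,3)
  have time: "1 + real (length xs ^ W - k) * (step_time + 1) - step_time - 1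
    = 1 + real (length xs ^ W - Suc k) * (step_time + 1)"
  proof -
    have "real (length xs ^ W - k) = 1 + real (length xs ^ W - Suc k)" using Suc.prems(5) by linarith
    then show ?thesis by (simp only: distrib_right) simp
  qed
  have nonneg: "0 \<le> real (length xs ^ W - Suc k) * (step_time + 1)" using SPSP_nonneg by simp
  note step = wp_conseq[OF wp_search_step[OF Suc.prems(1) ch Suc.prems(4-7)] Suc.prems(1) order_refl conjI]
  show ?case
  proof (rule wp_While_True)
    show "wp B (search_step spsp) s step_time (\<lambda>s'. bounded B s' \<and>
     (if good (tuple xs k W) then reg s' 8 = 0 \<and> ok_spanner I (arr s' 1)
      else if Suc k < length xs ^ W then at_tuple xs (Suc k) s' \<and> reg s' 8 = 1 \<and> arr s' 1 0 = 1
      else reg s' 8 = 0 \<and> arr s' 1 0 = 0))"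
      by (rule step)
    fix s' assume s': "bounded B s' \<and>
     (if good (tuple xs k W) then reg s' 8 = 0 \<and> ok_spanner I (arr s' 1)
      else if Suc k < length xs ^ W then at_tuple xs (Suc k) s' \<and> reg s' 8 = 1 \<and> arr s' 1 0 = 1
      else reg s' 8 = 0 \<and> arr s' 1 0 = 0)"
    then have b': "bounded B s'" by blast
    show "wp B (While (Reg 8) (search_step spsp)) s'
      (1 + real (length xs ^ W - k) * (step_time + 1) - step_time - 1) (\<lambda>s'. ok_spanner I (arr s' 1))"
      unfolding time
    proof (cases "good (tuple xs k W)")
      case True
      then show "wp B (While (Reg 8) (search_step spsp)) s'
        (1 + real (length xs ^ W - Suc k) * (step_time + 1)) (\<lambda>s'. ok_spanner I (arr s' 1))"
        using s' nonneg by (intro wp_While_False) (auto simp: boundedD const_less_B)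
    next
      case False
      then have bad: "\<not> good (tuple xs k' W)" if "k' < Suc k" for k'
        using that Suc.prems(8) by (auto simp: less_Suc_eq)
      show "wp B (While (Reg 8) (search_step spsp)) s'
        (1 + real (length xs ^ W - Suc k) * (step_time + 1)) (\<lambda>s'. ok_spanner I (arr s' 1))"
      proof (cases "Suc k < length xs ^ W")
        case True
        then show ?thesis
          using s' False bad Suc.hyps(2) by (intro Suc.hyps(1)[OF _ b' ch]) auto
      next
        case no: False
        have "\<nexists>F. witness I F"
        proof
          assume "\<exists>F. witness I F"
          then obtain k' where k': "k' < length xs ^ W" "good (tuple xs k' W)"
            using ch(1) unfolding chosen_def covers_def Let_def good_def tuple_def by blast
          then have "k' < Suc k" using no by simp
          with k'(2) bad show False by blast
        qed
        then show ?thesis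
          using s' False no nonneg by (intro wp_While_False) (auto simp: boundedD const_less_B intro: ok_no)
      qed
    qed
  qed (use Suc.prems(1,6) in \<open>auto simp: boundedD const_less_B\<close>)
qed


lemma apsp_input:
  assumes "arr s 4 0 = n" "arr s 4 1 = m"
    and "\<And>l. l < m \<Longrightarrow> arr s 4 (2 + 3 * l) = eu l \<and> arr s 4 (2 + 3 * l + 1) = ev l \<and> arr s 4 (2 + 3 * l + 2) = el l"
  shows "holds_input (enc_apsp2 sub_apsp) (view 20 4 s)"
  unfolding holds_input_def enc_sub_apsp
proof (intro allI impI, rule nth_append_blocks[where b = 3 and c = 2])
  fix l assume "l < (2::nat)"
  then have "l = 0 \<or> l = 1" by auto
  then show "arr (view 20 4 s) 0 l = [n, m] ! l" using assms by (auto simp: view_def)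
next
  fix l r assume "l < length (edge_list I)" "r < (3::nat)"
  then have "l < m" "r = 0 \<or> r = 1 \<or> r = 2" by (auto simp: size_edges_def)
  then show "arr (view 20 4 s) 0 (2 + (3 * l + r)) = (\<lambda>(u, v). [u, v, len I {u, v}]) (edge_list I ! l) ! r"
    using assms(3)[of l] by (auto simp: view_def split_beta edge_at_pair)
qed auto

lemma valid_sub_apsp: "valid_graph sub_apsp"
  using vg by (simp add: valid_graph_def nodes_def sub_apsp_def edges_def)

lemma wp_search:
  assumes b: "bounded B s" and env: "env s" and o: "arr s 1 0 = 1" and ch: "chosen xs" and cand: "candidates xs s"
    and W: "1 \<le> W" and T: "0 < length xs \<Longrightarrow> 3 * real W + 4 + real (length xs ^ W) * (step_time + 1) \<le> T" "0 \<le> T"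
  shows "wp B (search spsp) s (T + 2) (\<lambda>s'. ok_spanner I (arr s' 1))"
  unfolding search_def
proof (rule wp_Cond)
  assume "val s (Reg 5) \<noteq> 0"
  then have xs: "0 < length xs" using cand by (simp add: candidates_def)
  show "wp B (Seq zero_digits (Seq (Assign 8 (Const 1)) (While (Reg 8) (search_step spsp)))) s (T + 2 - 1)
    (\<lambda>s'. ok_spanner I (arr s' 1))"
  proof (rule wp_Seq[OF wp_zero_digits[OF b env] b])
    fix s1 assume b1: "bounded B s1" and f1: "frame (written_regs zero_digits) (written_arrs zero_digits) s s1"
      and z: "\<forall>j<W. arr s1 3 j = 0"
    have at1: "at_tuple xs 0 s1"
      using env cand f1 z by (auto simp: at_tuple_def env_def candidates_def frame_def digit_def)
    have o1: "arr s1 1 0 = 1" using o f1 by (simp add: frame_def)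
    show "wp B (Seq (Assign 8 (Const 1)) (While (Reg 8) (search_step spsp))) s1 (T + 2 - 1 - (2 + 3 * real W))
      (\<lambda>s'. ok_spanner I (arr s' 1))"
    proof (rule wp_Seq_Assign[OF b1])
      fix s2 assume b2: "bounded B s2" and s2: "reg s2 = (reg s1)(8 := val s1 (Const 1))" "arr s2 = arr s1"
      have at2: "at_tuple xs 0 s2" using at1 s2 by (simp add: at_tuple_def env_def candidates_def)
      have "wp B (While (Reg 8) (search_step spsp)) s2 (1 + real (length xs ^ W - 0) * (step_time + 1))
        (\<lambda>s'. ok_spanner I (arr s' 1))"
        by (rule wp_search_loop[OF b2 ch xs at2]) (use xs s2 o1 in auto)
      then show "wp B (While (Reg 8) (search_step spsp)) s2 (T + 2 - 1 - (2 + 3 * real W) - 1)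
        (\<lambda>s'. ok_spanner I (arr s' 1))"
        by (rule wp_conseq[OF _ b2]) (use T(1)[OF xs] in auto)
    qed (simp add: const_less_B)
  qed
next
  assume "val s (Reg 5) = 0"
  then have xs: "xs = []" using cand by (simp add: candidates_def)
  show "wp B (Store 1 (Const 0) (Const 0)) s (T + 2 - 1) (\<lambda>s'. ok_spanner I (arr s' 1))"
  proof (rule wp_Store[OF b])
    fix s1 assume s1: "arr s1 = (arr s)(1 := (arr s 1)(val s (Const 0) := val s (Const 0)))"
    \<comment> \<open>For the empty list \<open>covers\<close> offers \<open>0 ^ W\<close> tuples,
      that is none, as \<open>W\<close> is at least 1.\<close>
    have "\<nexists>F. witness I F" using ch W unfolding chosen_def covers_def xs by (auto simp: power_0_left)
    then show "ok_spanner I (arr s1 1)" using s1 by (intro ok_no) auto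
  qed (use T in \<open>auto simp: const_less_B\<close>)
qed (use b in \<open>simp add: boundedD\<close>)

lemma wp_find_candidates:
  assumes b: "bounded B s" and env: "env s" and W: "1 \<le> W"
  shows "wp B (find_candidates apsp2) s (12 + 14 * real m + APSP2 n m)
    (\<lambda>s'. env s' \<and> arr s' 1 = arr s 1 \<and> (\<exists>xs. candidates xs s' \<and> chosen xs))"
  (is "wp B _ s ?T ?Q")
  unfolding find_candidates_def
  apply (rule wp_Seq_Store[OF b], (intro fits_intros; (rule b | simp add: const_less_B)), (intro fits_intros; (rule b | simp add: const_less_B)))
  apply (rule wp_Seq_Store, assumption, (intro fits_intros; (assumption | simp add: const_less_B)), (intro fits_intros; (assumption | simp add: const_less_B)))
  subgoal premises p for s1 s2
  proof -
    have f2: "frame {} {4} s s2" using p by (auto simp: frame_def)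
    have env2: "env s2" by (rule env_frame[OF f2 _ _ env]) auto
    have a2: "arr s2 4 0 = n" "arr s2 4 1 = m" using p envD[OF env] by simp_all
    have b2: "bounded B s2" by fact
    have e: "fits B s' (field 8 14) \<and> val s' (field 8 14) = el l"
      if l: "l < m" "bounded B s'" "frame {14} {4} s2 s'" "reg s' 14 = l" for l s'
    proof -
      have "env s'" by (rule env_frame[OF l(3) _ _ env2]) auto
      note inp' = input_edge[OF this l(1)]
      show ?thesis
        apply (rule conjI)
         apply (intro fits_intros; (rule l | simp add: const_less_B index_less_B[OF l(1)] l(4)))
        by (simp add: l(4) inp')
    qed
    show ?thesis
    proof (rule wp_Seq[OF wp_load_edges[OF b2 env2 _ e] b2], simp, assumption, assumption, assumption, assumption)
      fix s3 assume b3: "bounded B s3"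
        and f3: "frame (written_regs (load_edges 2 (field 8 14))) (written_arrs (load_edges 2 (field 8 14))) s2 s3"
        and a3: "(\<forall>i<2. arr s3 4 i = arr s2 4 i) \<and>
         (\<forall>i<m. arr s3 4 (2 + 3 * i) = eu i \<and> arr s3 4 (2 + 3 * i + 1) = ev i \<and> arr s3 4 (2 + 3 * i + 2) = el i)"
      have f3': "frame {14} {4} s s3" using f2 f3 by (simp add: frame_def)
      have "holds_input (enc_apsp2 sub_apsp) (view 20 4 s3)"
        by (rule apsp_input) (use a2 a3 in auto)
      from wp_shift[OF runs_apsp2[OF valid_sub_apsp size_sub_apsp] b3 this]
      have w: "wp B (shift_com 20 4 apsp2) s3 (APSP2 n m) (\<lambda>s'. ok_apsp2 sub_apsp (arr s' 5))" by simp
      show "wp B (Seq (shift_com 20 4 apsp2) (Seq scan choose_candidates)) s3 (?T - 1 - 1 - (2 + 5 * real m)) ?Q"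
      proof (rule wp_Seq[OF w b3])
        fix s4 assume b4: "bounded B s4" and ok: "ok_apsp2 sub_apsp (arr s4 5)"
          and f4: "frame (written_regs (shift_com 20 4 apsp2)) (written_arrs (shift_com 20 4 apsp2)) s3 s4"
        have r4: "reg s4 x = reg s x" if "x < 5" for x
          using frameD(1)[OF f4, of x] frameD(1)[OF f3', of x] that by (simp add: not_written_shift)
        have a4: "arr s4 a = arr s a" if "a < 4" for a
          using frameD(2)[OF f4, of a] frameD(2)[OF f3', of a] that by (simp add: not_written_shift)
        have env4: "env s4" using env r4 a4 by (simp add: env_def)
        show "wp B (Seq scan choose_candidates) s4 (?T - 1 - 1 - (2 + 5 * real m) - APSP2 n m) ?Q"
        proof (rule wp_Seq[OF wp_scan[OF b4 env4 ok] b4])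
          fix s5 assume b5: "bounded B s5" and sc: "scanned m s5"
            and f5: "frame (written_regs scan) (written_arrs scan) s4 s5"
          have env5: "env s5" by (rule env_frame[OF f5 _ _ env4]) auto
          show "wp B choose_candidates s5 (?T - 1 - 1 - (2 + 5 * real m) - APSP2 n m - (5 + 9 * real m)) ?Q"
          proof (rule wp_conseq[OF wp_choose_candidates[OF b5 env5 sc W] b5])
            fix s6 assume ex: "\<exists>xs. candidates xs s6 \<and> chosen xs"
              and f6: "frame (written_regs choose_candidates) (written_arrs choose_candidates) s5 s6"
            have "env s6" by (rule env_frame[OF f6 _ _ env5]) auto
            moreover have "arr s6 1 = arr s 1" using f6 f5 a4[of 1] by (simp add: frame_def)
            ultimately show "?Q s6" using ex by blast
          qed simp
        qed
      qed
    qed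
  qed
  done

text \<open>The search budget \<open>T\<close> is constrained only for lists that the selection can
  produce, so that the length bound in \<open>chosen\<close> is available for choosing
  \<open>T\<close>.\<close>

lemma wp_solver:
  assumes b: "bounded B s" and inp: "holds_input (enc_spanner I) s" and A: "0 \<le> APSP2 n m"
    and T: "\<And>xs. 1 \<le> W \<Longrightarrow> chosen xs \<Longrightarrow> 0 < length xs \<Longrightarrow>
      3 * real W + 4 + real (length xs ^ W) * (step_time + 1) \<le> T" "0 \<le> T"
  shows "wp B (solver spsp apsp2) s (23 + 17 * real m + APSP2 n m + T) (\<lambda>s'. ok_spanner I (arr s' 1))"
  (is "wp B _ s ?T ?Q")
  unfolding solver_def
proof (rule wp_Seq[OF wp_setup_regs[OF b inp] b])
  let ?main = "Cond (Reg 2) (Seq (find_candidates apsp2) (search spsp)) Skip"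
  fix s1 assume b1: "bounded B s1" and env1: "env s1"
  show "wp B (Seq mark_all (Seq (Store 1 (Const 0) (Const 1)) ?main)) s1 (?T - 5) ?Q"
  proof (rule wp_Seq[OF wp_mark_all[OF b1 env1] b1])
    fix s2 assume b2: "bounded B s2" and f2: "frame (written_regs mark_all) (written_arrs mark_all) s1 s2"
      and m2: "\<forall>i. arr s2 1 i = (if 1 \<le> i \<and> i \<le> m then 1 else arr s1 1 i)"
    have env2: "env s2" by (rule env_frame[OF f2 _ _ env1]) auto
    show "wp B (Seq (Store 1 (Const 0) (Const 1)) ?main) s2 (?T - 5 - (2 + 3 * real m)) ?Q"
    proof (rule wp_Seq_Store[OF b2])
      fix s3 assume b3: "bounded B s3" and s3: "reg s3 = reg s2"
        "arr s3 = (arr s2)(1 := (arr s2 1)(val s2 (Const 0) := val s2 (Const 1)))"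
      have env3: "env s3" using env2 s3 by (simp add: env_def)
      have o3: "arr s3 1 0 = 1" using s3 by simp
      have mk3: "marks {} s3" using s3 m2 by (simp add: marks_def)
      show "wp B ?main s3 (?T - 5 - (2 + 3 * real m) - 1) ?Q"
      proof (rule wp_Cond)
        assume "val s3 (Reg 2) = 0"
        then have W: "W = 0" using envD[OF env3] by simp
        have "ok_spanner I (arr s3 1)"
          by (rule ok_yes[of "{}"]) (use W o3 mk3 in \<open>auto simp: feasible_def marks_def\<close>)
        then show "wp B Skip s3 (?T - 5 - (2 + 3 * real m) - 1 - 1) ?Q"
          by (intro wp_Skip) (use A T(2) in auto)
      next
        assume "val s3 (Reg 2) \<noteq> 0"
        then have W: "1 \<le> W" using envD[OF env3] by simp
        show "wp B (Seq (find_candidates apsp2) (search spsp)) s3 (?T - 5 - (2 + 3 * real m) - 1 - 1) ?Q"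
        proof (rule wp_Seq[OF wp_find_candidates[OF b3 env3 W] b3], elim exE conjE)
          fix s4 xs assume b4: "bounded B s4" and env4: "env s4" and o4: "arr s4 1 = arr s3 1"
            and xs: "candidates xs s4" "chosen xs"
          have "arr s4 1 0 = 1" using o3 o4 by simp
          from wp_search[OF b4 env4 this xs(2,1) W T(1)[OF W xs(2)] T(2)]
          show "wp B (search spsp) s4 (?T - 5 - (2 + 3 * real m) - 1 - 1 - (12 + 14 * real m + APSP2 n m)) ?Q"
            by (rule wp_conseq[OF _ b4]) auto
        qed
      qed (use b3 in \<open>simp add: boundedD\<close>)
    qed (auto simp: const_less_B)
  qed
qed

end

section \<open>Parameter dependence\<close>

text \<open>With s = 1 + the sum of the parameters, W < s and \<tau> \<le> s^2 give W^(2W+1)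
  \<tau>^(2W) \<le> s^(6W+1), and 6 W + 1 \<le> 6 s. Depending on the sum alone, one function serves
  both parameter lists.\<close>

definition power_bound :: "nat list \<Rightarrow> nat" where
  "power_bound xs = Suc (sum_list xs) ^ (6 * Suc (sum_list xs))"

definition power_bound_com :: com where
  "power_bound_com = Seq (Assign 0 (Elem 0 (Const 0))) (Seq (Assign 1 (Const 1))
    (Seq (For 2 0 (Assign 1 (Add (Reg 1) (Elem 0 (Add (Reg 2) (Const 1))))))
    (Seq (Assign 4 (Mult (Const 6) (Reg 1))) (Seq (Assign 3 (Const 1))
    (Seq (For 2 4 (Assign 3 (Mult (Reg 3) (Reg 1)))) (Store 1 (Const 0) (Reg 3)))))))"

lemma computable_power_bound: "computable power_bound"
  unfolding computable_def
proof (rule exI[of _ power_bound_com], intro allI impI)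
  fix xs s assume inp: "holds_input (length xs # xs) s"
  let ?s = "Suc (sum_list xs)"
  \<comment> \<open>\<open>computable\<close> lets the word size depend on the argument, so it can
    be chosen to exceed the result.\<close>
  define B where "B = Suc (power_bound xs + 6 * ?s + length xs + 7)"
  have a: "arr s 0 0 = length xs" "\<And>i. i < length xs \<Longrightarrow> arr s 0 (Suc i) = xs ! i"
    using inp by (auto simp: holds_input_def)
  have small: "sum_list (take i xs) \<le> sum_list xs" for i
    using sum_list_append[of "take i xs" "drop i xs"] by (simp only: append_take_drop_id)
  have B: "1 < B" "6 < B" "length xs < B" "6 * ?s < B" "?s < B" "power_bound xs < B" by (simp_all add: B_def)
  have pw: "?s ^ i < B" if "i \<le> 6 * ?s" for i
    using power_increasing[OF that, of ?s] B(6) unfolding power_bound_def by linarith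
  have "\<exists>T. wp B power_bound_com s T (\<lambda>s'. arr s' 1 0 = power_bound xs)"
    unfolding power_bound_com_def
    apply (rule exI[of _ "9 + real (length xs) * (1 + 2) + real (6 * ?s) * (1 + 2)"])
    apply (rule wp_Seq_then[where ?T1.0 = 1 and P = "\<lambda>s'. reg s' 0 = length xs \<and> arr s' 0 = arr s 0"])
    subgoal by (rule wp_Assign_upd) (use B a in auto)
    apply (rule wp_Seq_then[where ?T1.0 = 1 and
        P = "\<lambda>s'. reg s' 0 = length xs \<and> reg s' 1 = 1 \<and> arr s' 0 = arr s 0"])
    subgoal by (rule wp_Assign_upd) (use B in auto)
    apply (rule wp_Seq_then[where ?T1.0 = "2 + real (length xs) * (1 + 2)" and P = "\<lambda>s'. reg s' 1 = ?s"])
    subgoal for s1 s2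
    proof (rule wp_For_simple[where n = "length xs" and ?T1.0 = 1 and
        P = "\<lambda>i s'. reg s' 1 = Suc (sum_list (take i xs)) \<and> arr s' 0 = arr s 0"], goal_cases)
      case (6 i s')
      have "Suc (sum_list (take i xs)) + xs ! i < B" "xs ! i < B"
        using small[of "Suc i"] 6(3) B(5) by (auto simp: take_Suc_conv_app_nth)
      then show ?case
        by (intro wp_Assign_upd) (use 6 B a in \<open>auto simp: take_Suc_conv_app_nth dest: less_trans\<close>)
    qed (use B in auto)
    apply (rule wp_Seq_then[where ?T1.0 = 1 and P = "\<lambda>s'. reg s' 1 = ?s \<and> reg s' 4 = 6 * ?s"])
    subgoal by (rule wp_Assign_upd) (use B in auto)
    apply (rule wp_Seq_then[where ?T1.0 = 1 and P = "\<lambda>s'. reg s' 1 = ?s \<and> reg s' 4 = 6 * ?s \<and> reg s' 3 = 1"])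
    subgoal by (rule wp_Assign_upd) (use B in auto)
    apply (rule wp_Seq_then[where ?T1.0 = "2 + real (6 * ?s) * (1 + 2)" and P = "\<lambda>s'. reg s' 3 = power_bound xs"])
    subgoal for s1 s2 s3 s4 s5
    proof (rule wp_For_simple[where n = "6 * ?s" and ?T1.0 = 1 and
        P = "\<lambda>i s'. reg s' 3 = ?s ^ i \<and> reg s' 1 = ?s"], goal_cases)
      case (6 i s')
      have "?s ^ i < B" "?s ^ i * ?s < B" using pw[of i] pw[of "Suc i"] 6(6) by (simp_all add: mult.commute)
      then show ?case by (intro wp_Assign_upd) (use 6 B(5) in \<open>auto simp: mult.commute\<close>)
    qed (use B in \<open>auto simp: power_bound_def\<close>)
    by (rule wp_Store_upd) (use B in auto)
  then show "\<exists>B t s'. exec B power_bound_com s t s' \<and> arr s' 1 0 = power_bound xs"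
    unfolding wp_def by blast
qed

text \<open>From 3 on the base \<open>r\<close> itself dominates 3; the constant 27 takes care of 1
  and 2.\<close>

lemma three_power_le: "1 \<le> r \<Longrightarrow> (3::real) ^ r \<le> 27 * real r ^ r"
proof (cases "3 \<le> r")
  case True
  then have "(3::real) ^ r \<le> real r ^ r" by (intro power_mono) auto
  also have "\<dots> \<le> 27 * real r ^ r" by simp
  finally show ?thesis .
next
  case False
  moreover assume "1 \<le> r"
  ultimately have "r = 1 \<or> r = 2" by auto
  then show ?thesis by auto
qed

text \<open>Where the exponents of the theorem arise: (3 \<tau> r)^r tuples with r calls each, where
  3^r is traded for r^r and this for (\<tau> r)^r.\<close>

lemma tuples_le:
  fixes \<tau> :: real
  assumes "1 \<le> \<tau>" "1 \<le> r" "real b \<le> 3 * \<tau> * real r"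
  shows "real b ^ r * real r \<le> 27 * (real r ^ (2 * r + 1) * \<tau> ^ (2 * r))"
proof -
  let ?x = "\<tau> * real r"
  have le: "real r \<le> ?x" using assms(1) by (simp add: mult_le_cancel_right1)
  have "real b ^ r \<le> (3 * ?x) ^ r" using assms(3) by (intro power_mono) (auto simp: mult_ac)
  also have "\<dots> = 3 ^ r * ?x ^ r" by (simp add: power_mult_distrib)
  also have "\<dots> \<le> (27 * real r ^ r) * ?x ^ r"
    using assms(1) three_power_le[OF assms(2)] by (intro mult_right_mono) auto
  also have "\<dots> \<le> (27 * ?x ^ r) * ?x ^ r"
    using assms(1) le by (intro mult_right_mono mult_left_mono power_mono) auto
  also have "\<dots> = 27 * (real r ^ (2 * r) * \<tau> ^ (2 * r))"
    by (simp add: power_mult_distrib power_add mult_2)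
  finally have "real b ^ r * real r \<le> 27 * (real r ^ (2 * r) * \<tau> ^ (2 * r)) * real r"
    by (intro mult_right_mono) auto
  then show ?thesis by (simp add: mult_ac)
qed

section \<open>Running time of the solver in terms of \<tau>\<close>

context spanner_solver
begin

text \<open>The bound by \<open>\<tau>\<close> is asked only for edges lighter than the goal, which
  is what coupled instances can guarantee; a heavier candidate leaves a list with a single
  entry.\<close>

lemma runs_solver:
  assumes \<tau>: "0 \<le> \<tau>" "\<And>e. e < m \<Longrightarrow> ew e < W \<Longrightarrow> real (bound I e) \<le> \<tau>" "0 < m \<Longrightarrow> 1 \<le> W \<Longrightarrow> 1 \<le> \<tau>"
    and \<delta>: "0 < \<delta>" "\<delta> * real (n + m) \<le> SPSP n m" and \<epsilon>: "0 < \<epsilon>" "\<epsilon> * real (n + m) \<le> APSP2 n m"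
  shows "runs B (solver spsp apsp2) (enc_spanner I)
    ((27 * (1 + 44 / \<delta>) + (1 + 23 / \<epsilon>)) * running_time SPSP APSP2 \<tau> I) (ok_spanner I)"
  unfolding runs_def
proof (intro allI impI, elim conjE)
  fix s assume "\<forall>x. reg s x < B" "\<forall>a i. arr s a i < B" and inp: "holds_input (enc_spanner I) s"
  then have b: "bounded B s" by (simp add: bounded_def)
  let ?P = "SPSP n m" and ?A = "APSP2 n m" and ?R = "real W ^ (2 * W + 1) * \<tau> ^ (2 * W)"
  have n1: "1 \<le> n" using vg by (simp add: valid_graph_def)
  have S: "real (n + m) \<le> ?P / \<delta>" using \<delta> by (simp add: pos_le_divide_eq mult.commute)
  have A: "real (n + m) \<le> ?A / \<epsilon>" using \<epsilon> by (simp add: pos_le_divide_eq mult.commute)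
  have A0: "0 \<le> ?A" using \<epsilon> by (meson mult_nonneg_nonneg of_nat_0_le_iff less_imp_le order_trans)
  define T where "T = 27 * (1 + 44 / \<delta>) * (?R * ?P)"
  have R0: "0 \<le> ?R * ?P" using \<tau>(1) SPSP_nonneg by simp
  have T0: "0 \<le> T" using R0 \<delta>(1) by (simp add: T_def)
  have T: "3 * real W + 4 + real (length xs ^ W) * (step_time + 1) \<le> T"
    if W: "1 \<le> W" and ch: "chosen xs" and xs: "0 < length xs" for xs
  proof -
    have "hd xs \<in> set xs" using xs by simp
    then have "hd xs < m" using ch unfolding chosen_def by blast
    then have t1: "1 \<le> \<tau>" using \<tau>(3) W by simp
    have N: "real (length xs) \<le> 3 * \<tau> * real W"
    proof -
      have "1 \<le> \<tau> * real W" using mult_mono[of 1 \<tau> 1 "real W"] t1 W by simp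
      moreover have "real (length xs) \<le> 3 * \<tau> * real W"
        if e: "e < m" "ew e < W" "length xs \<le> (2 * bound I e + 1) * W" for e
      proof -
        have "real (length xs) \<le> real ((2 * bound I e + 1) * W)" using e(3) by (simp only: of_nat_le_iff)
        also have "\<dots> = (2 * real (bound I e) + 1) * real W" by (simp add: distrib_right)
        \<comment> \<open>\<open>1 \<le> \<tau>\<close> absorbs the summand 1 into a third
          \<tau>.\<close>
        also have "\<dots> \<le> (3 * \<tau>) * real W" using \<tau>(2)[OF e(1,2)] t1 by (intro mult_right_mono) auto
        finally show ?thesis .
      qed
      ultimately show ?thesis using ch unfolding chosen_def by force
    qed
    have N1: "1 \<le> real (length xs ^ W)" using xs by (simp add: Suc_le_eq)
    have W1: "1 \<le> real W" using W by simp
    have "step_time + 1 \<le> real W * (16 + 3 * real m) + real W * (?P + 5 * real m + 21)"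
      using mult_right_mono[OF W1, of "16 + 3 * real m"] by simp
    also have "\<dots> = real W * (?P + 8 * real m + 37)" by (simp add: algebra_simps)
    finally have "real (length xs ^ W) * (step_time + 1) \<le> real (length xs ^ W) * (real W * (?P + 8 * real m + 37))"
      by (intro mult_left_mono) auto
    moreover have "3 * real W + 4 \<le> real (length xs ^ W) * (real W * 7)"
    proof -
      have "3 * real W + 4 \<le> 1 * (real W * 7)" using W by simp
      also have "\<dots> \<le> real (length xs ^ W) * (real W * 7)" using N1 by (intro mult_right_mono) auto
      finally show ?thesis .
    qed
    ultimately have "3 * real W + 4 + real (length xs ^ W) * (step_time + 1)
      \<le> (real (length xs) ^ W * real W) * (?P + 8 * real m + 44)"
      by (simp add: algebra_simps)
    also have "\<dots> \<le> (27 * ?R) * (?P + 44 * (?P / \<delta>))"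
    proof (rule mult_mono)
      show "real (length xs) ^ W * real W \<le> 27 * ?R" by (rule tuples_le[OF t1 W N])
      \<comment> \<open>As n is at least 1, the overhead 8 m + 44 is at most 44 (n + m); 44 is 37
        from the rounds plus 7 from starting the search.\<close>
      show "?P + 8 * real m + 44 \<le> ?P + 44 * (?P / \<delta>)" using S n1 by simp
    qed (use SPSP_nonneg \<tau>(1) in auto)
    also have "\<dots> = T" by (simp add: T_def algebra_simps)
    finally show ?thesis .
  qed
  have time: "23 + 17 * real m + ?A + T \<le> (27 * (1 + 44 / \<delta>) + (1 + 23 / \<epsilon>)) * running_time SPSP APSP2 \<tau> I"
  proof -
    have "23 + 17 * real m \<le> 23 * real (n + m)" using n1 by simp
    also have "\<dots> \<le> 23 * (?A / \<epsilon>)" using A by simp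
    finally have "23 + 17 * real m + ?A + T \<le> 27 * (1 + 44 / \<delta>) * (?R * ?P) + (1 + 23 / \<epsilon>) * ?A"
      by (simp add: T_def algebra_simps)
    \<comment> \<open>Nonnegative cross terms are added so that one constant multiplies both
      summands of the running time.\<close>
    also have "\<dots> \<le> 27 * (1 + 44 / \<delta>) * (?R * ?P) + (1 + 23 / \<epsilon>) * ?A
      + (1 + 23 / \<epsilon>) * (?R * ?P) + 27 * (1 + 44 / \<delta>) * ?A"
      using R0 A0 \<delta>(1) \<epsilon>(1) by simp
    also have "\<dots> = (27 * (1 + 44 / \<delta>) + (1 + 23 / \<epsilon>)) * running_time SPSP APSP2 \<tau> I"
      by (simp add: running_time_def algebra_simps)
    finally show ?thesis .
  qed
  have w: "wp B (solver spsp apsp2) s (23 + 17 * real m + ?A + T) (\<lambda>s'. ok_spanner I (arr s' 1))"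
    by (rule wp_solver[OF b inp A0 _ T0]) (rule T)
  have "wp B (solver spsp apsp2) s ((27 * (1 + 44 / \<delta>) + (1 + 23 / \<epsilon>)) * running_time SPSP APSP2 \<tau> I)
    (\<lambda>s'. ok_spanner I (arr s' 1))"
    by (rule wp_conseq[OF w b time])
  then show "\<exists>t s'. exec B (solver spsp apsp2) s t s' \<and>
      real t \<le> (27 * (1 + 44 / \<delta>) + (1 + 23 / \<epsilon>)) * running_time SPSP APSP2 \<tau> I \<and> ok_spanner I (arr s' 1)"
    unfolding wp_def .
qed

end


text \<open>Subroutine inputs of size at most S^5 ask for words of size S^(5 k1) and S^(5 k2); the
  extra 1 in the exponent provides \<open>S ^ 5 \<le> B\<close> for the solver itself.\<close>

lemma spanner_solver_intro:
  assumes valid: "valid_spanner_instance I"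
    and spsp: "\<forall>J\<in>{I. valid_spsp I}. \<forall>B \<ge> (sum_list (enc_spsp J) + length (enc_spsp J) + 2) ^ k1.
        runs B spsp (enc_spsp J) (SPSP (size_nodes J) (size_edges J)) (ok_spsp J)"
    and apsp2: "\<forall>G\<in>{G. valid_graph G}. \<forall>B \<ge> (sum_list (enc_apsp2 G) + length (enc_apsp2 G) + 2) ^ k2.
        runs B apsp2 (enc_apsp2 G) (APSP2 (size_nodes G) (size_edges G)) (ok_apsp2 G)"
    and B: "(sum_list (enc_spanner I) + length (enc_spanner I) + 2) ^ (5 * (k1 + k2 + 1)) \<le> B"
    and nonneg: "0 \<le> SPSP (size_nodes I) (size_edges I)"
  shows "spanner_solver I B (sum_list (enc_spanner I) + length (enc_spanner I) + 2) SPSP APSP2 spsp apsp2"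
proof -
  let ?S = "sum_list (enc_spanner I) + length (enc_spanner I) + 2"
  have pow: "x ^ k \<le> B" if "x \<le> ?S ^ 5" "k \<le> k1 + k2 + 1" for x k
  proof -
    have "x ^ k \<le> (?S ^ 5) ^ k" using that(1) by (rule power_mono) simp
    also have "\<dots> = ?S ^ (5 * k)" by (rule power_mult[symmetric])
    also have "\<dots> \<le> ?S ^ (5 * (k1 + k2 + 1))" using that(2) by (intro power_increasing) auto
    finally show ?thesis using B by linarith
  qed
  show ?thesis
  proof
    show "?S ^ 5 \<le> B" using pow[of "?S ^ 5" 1] by simp
  qed (use valid nonneg spsp apsp2 pow in auto)
qed

text \<open>\<open>inst\<close> strips the bound \<open>lmax\<close> where an instance carries one,
  so that both parts of the result are cases of this lemma.\<close>

lemma solver_solves_in_time: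
  assumes spsp: "solves_in_time spsp {I. valid_spsp I} enc_spsp ok_spsp (\<lambda>I. SPSP (size_nodes I) (size_edges I))"
    and apsp2: "solves_in_time apsp2 {G. valid_graph G} enc_apsp2 ok_apsp2 (\<lambda>G. APSP2 (size_nodes G) (size_edges G))"
    and \<delta>: "0 < \<delta>" "\<And>n m. \<delta> * real (n + m) \<le> SPSP n m"
    and \<epsilon>: "0 < \<epsilon>" "\<And>n m. \<epsilon> * real (n + m) \<le> APSP2 n m"
    and D: "\<And>x. x \<in> D \<Longrightarrow> valid_spanner_instance (inst x)"
    and \<tau>: "\<And>x. x \<in> D \<Longrightarrow> 0 \<le> \<tau> x"
      "\<And>x e. x \<in> D \<Longrightarrow> e < size_edges (inst x) \<Longrightarrow> weight (inst x) (edge_at (inst x) e) < goal (inst x) \<Longrightarrow>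
        real (bound (inst x) e) \<le> \<tau> x"
      "\<And>x. x \<in> D \<Longrightarrow> 0 < size_edges (inst x) \<Longrightarrow> 1 \<le> goal (inst x) \<Longrightarrow> 1 \<le> \<tau> x"
  shows "solves_in_time (solver spsp apsp2) D (\<lambda>x. enc_spanner (inst x)) (\<lambda>x. ok_spanner (inst x))
    (\<lambda>x. (27 * (1 + 44 / \<delta>) + (1 + 23 / \<epsilon>)) * running_time SPSP APSP2 (\<tau> x) (inst x))"
proof -
  obtain k1 where k1: "\<forall>J\<in>{I. valid_spsp I}. \<forall>B \<ge> (sum_list (enc_spsp J) + length (enc_spsp J) + 2) ^ k1.
      runs B spsp (enc_spsp J) (SPSP (size_nodes J) (size_edges J)) (ok_spsp J)"
    using spsp unfolding solves_in_time_def by blast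
  obtain k2 where k2: "\<forall>G\<in>{G. valid_graph G}. \<forall>B \<ge> (sum_list (enc_apsp2 G) + length (enc_apsp2 G) + 2) ^ k2.
      runs B apsp2 (enc_apsp2 G) (APSP2 (size_nodes G) (size_edges G)) (ok_apsp2 G)"
    using apsp2 unfolding solves_in_time_def by blast
  show ?thesis unfolding solves_in_time_def
  proof (intro exI[of _ "5 * (k1 + k2 + 1)"] ballI allI impI)
    fix x B
    assume x: "x \<in> D"
      and B: "(sum_list (enc_spanner (inst x)) + length (enc_spanner (inst x)) + 2) ^ (5 * (k1 + k2 + 1)) \<le> B"
    have "0 \<le> SPSP (size_nodes (inst x)) (size_edges (inst x))"
      using \<delta>(2)[of "size_nodes (inst x)" "size_edges (inst x)"] \<delta>(1) by (meson mult_nonneg_nonneg of_nat_0_le_iff less_imp_le order_trans)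
    from spanner_solver_intro[OF D[OF x] k1 k2 B this]
    interpret spanner_solver "inst x" B "sum_list (enc_spanner (inst x)) + length (enc_spanner (inst x)) + 2"
      SPSP APSP2 spsp apsp2 .
    show "runs B (solver spsp apsp2) (enc_spanner (inst x))
      ((27 * (1 + 44 / \<delta>) + (1 + 23 / \<epsilon>)) * running_time SPSP APSP2 (\<tau> x) (inst x)) (ok_spanner (inst x))"
      by (rule runs_solver) (use \<tau> \<delta> \<epsilon> x in auto)
  qed
qed

section \<open>From the running time to fixed-parameter tractability\<close>

lemma solves_in_time_mono:
  assumes "solves_in_time c D enc ok T" "\<And>x. x \<in> D \<Longrightarrow> T x \<le> T' x"
  shows "solves_in_time c D enc ok T'"
  using assms unfolding solves_in_time_def runs_def by (meson order_trans)

lemma length_le_encoding_length: "length xs \<le> encoding_length xs"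
  unfolding encoding_length_def by (induction xs) auto

text \<open>In a connected graph on two or more nodes every node is an end of an edge. As the number
  of nodes is encoded in binary, this is what keeps it polynomial in the encoding length.\<close>

lemma nodes_le_edges:
  assumes "valid_graph G" "connected_graph G"
  shows "size_nodes G \<le> 2 * size_edges G + 1"
proof (cases "size_nodes G = 1")
  case False
  have n: "2 \<le> size_nodes G" using False assms(1) by (simp add: valid_graph_def)
  have "nodes G \<subseteq> fst ` set (edge_list G) \<union> snd ` set (edge_list G)"
  proof
    fix u assume u: "u \<in> nodes G"
    \<comment> \<open>Any second node serves: a path to it starts with an edge at
      \<open>u\<close>.\<close>
    define v :: nat where "v = (if u = 0 then 1 else 0)"
    have v: "v \<in> nodes G" "v \<noteq> u" using n by (auto simp: v_def nodes_def)
    then obtain p where p: "is_path (edges G) u p v" using assms(2) u unfolding connected_graph_def by blast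
    then obtain y q where "p = u # y # q" using v by (cases p; cases "tl p") (auto simp: is_path_walk)
    then have "{u, y} \<in> edges G" using p by (simp add: is_path_walk)
    then obtain a b where "(a, b) \<in> set (edge_list G)" "{u, y} = {a, b}" by (auto simp: edges_def)
    then show "u \<in> fst ` set (edge_list G) \<union> snd ` set (edge_list G)" by (force simp: doubleton_eq_iff)
  qed
  then have "card (nodes G) \<le> card (fst ` set (edge_list G) \<union> snd ` set (edge_list G))"
    by (intro card_mono) auto
  also have "\<dots> \<le> card (fst ` set (edge_list G)) + card (snd ` set (edge_list G))" by (rule card_Un_le)
  also have "\<dots> \<le> card (set (edge_list G)) + card (set (edge_list G))"
    by (intro add_mono card_image_le) auto
  also have "\<dots> \<le> 2 * size_edges G" using card_length[of "edge_list G"] by (simp add: size_edges_def)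
  finally show ?thesis by (simp add: nodes_def)
qed simp

lemma size_le_encoding_length:
  assumes "valid_spanner_instance I"
  shows "size_nodes I + size_edges I \<le> encoding_length (enc_spanner I)" "1 \<le> encoding_length (enc_spanner I)"
proof -
  have "length (enc_spanner I) = 5 + 4 * size_edges I"
    unfolding enc_spanner_def by (subst length_append, subst length_concat_blocks[where b = 4])
      (auto simp: size_edges_def split: prod.splits)
  then have "5 + 4 * size_edges I \<le> encoding_length (enc_spanner I)"
    using length_le_encoding_length[of "enc_spanner I"] by simp
  moreover have "size_nodes I \<le> 2 * size_edges I + 1"
    using nodes_le_edges assms by (auto simp: valid_spanner_instance_def)
  ultimately show "size_nodes I + size_edges I \<le> encoding_length (enc_spanner I)"
    "1 \<le> encoding_length (enc_spanner I)" by linarith+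
qed

lemma single_node_no_edges:
  assumes "valid_graph G" "size_nodes G = 1"
  shows "size_edges G = 0"
proof (rule ccontr)
  assume "size_edges G \<noteq> 0"
  moreover obtain u v where "edge_list G ! 0 = (u, v)" by (cases "edge_list G ! 0")
  ultimately show False using valid_graph_edge(1-3)[OF assms(1), of 0 u v] assms(2) by simp
qed

lemma polynomial_bound:
  fixes SPSP APSP2 :: "nat \<Rightarrow> nat \<Rightarrow> real"
  assumes "\<exists>K d. \<forall>n m. SPSP n m \<le> K * real (n + m) ^ d"
    and "\<exists>K. \<forall>n\<ge>2. \<forall>m. APSP2 n m \<le> K * (real n * real m + (real n)\<^sup>2 * log 2 (real n))"
  shows "\<exists>p :: nat poly. \<forall>I. valid_spanner_instance I \<longrightarrow>
    SPSP (size_nodes I) (size_edges I) + APSP2 (size_nodes I) (size_edges I)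
      \<le> real (poly p (encoding_length (enc_spanner I)))"
proof -
  obtain K1 d where K1: "\<And>n m. SPSP n m \<le> K1 * real (n + m) ^ d" using assms(1) by blast
  obtain K2 where K2: "\<And>n m. 2 \<le> n \<Longrightarrow> APSP2 n m \<le> K2 * (real n * real m + (real n)\<^sup>2 * log 2 (real n))"
    using assms(2) by blast
  obtain C1 :: nat where C1: "\<bar>K1\<bar> \<le> real C1" using real_arch_simple by blast
  obtain C2 :: nat where C2: "2 * \<bar>K2\<bar> + \<bar>APSP2 1 0\<bar> \<le> real C2" using real_arch_simple by blast
  define p where "p = monom C1 d + monom C2 3"
  have "SPSP (size_nodes I) (size_edges I) + APSP2 (size_nodes I) (size_edges I)
      \<le> real (poly p (encoding_length (enc_spanner I)))" if valid: "valid_spanner_instance I" for I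
  proof -
    let ?n = "size_nodes I" and ?m = "size_edges I" and ?E = "real (encoding_length (enc_spanner I))"
    have E: "real (?n + ?m) \<le> ?E" "1 \<le> ?E" using size_le_encoding_length[OF valid] by simp_all
    have vg: "valid_graph I" using valid by (simp add: valid_spanner_instance_def)
    have "SPSP ?n ?m \<le> K1 * real (?n + ?m) ^ d" by (rule K1)
    also have "\<dots> \<le> real C1 * ?E ^ d" using C1 E by (intro mult_mono power_mono) auto
    finally have 1: "SPSP ?n ?m \<le> real C1 * ?E ^ d" .
    have E3: "1 \<le> ?E ^ 3" using E(2) by simp
    have 2: "APSP2 ?n ?m \<le> real C2 * ?E ^ 3"
    \<comment> \<open>The upper bound on \<open>APSP2\<close> starts at two nodes. A single node
      admits no edges, so only the constant \<open>APSP2 1 0\<close> remains.\<close>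
    proof (cases "?n = 1")
      case True
      then have "APSP2 ?n ?m = APSP2 1 0" using single_node_no_edges[OF vg] by simp
      also have "\<dots> \<le> real C2" using C2 by linarith
      also have "\<dots> \<le> real C2 * ?E ^ 3" using mult_left_mono[OF E3, of "real C2"] by simp
      finally show ?thesis .
    next
      case False
      then have n: "2 \<le> ?n" using vg by (simp add: valid_graph_def)
      have l0: "0 \<le> log 2 (real ?n)" using n by simp
      have l: "log 2 (real ?n) \<le> real ?n" using n log2_of_power_less[of ?n ?n] less_exp[of ?n] by simp
      have "real ?n * real ?m \<le> ?E * ?E" using E by (intro mult_mono) auto
      also have "\<dots> \<le> ?E ^ 3" using power_increasing[of 2 3 ?E] E(2) by (simp add: power2_eq_square)
      finally have "real ?n * real ?m \<le> ?E ^ 3" .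
      moreover have "(real ?n)\<^sup>2 * log 2 (real ?n) \<le> ?E ^ 3"
      proof -
        have "(real ?n)\<^sup>2 * log 2 (real ?n) \<le> ?E\<^sup>2 * ?E"
          using E l l0 by (intro mult_mono power_mono) auto
        then show ?thesis by (simp add: power3_eq_cube power2_eq_square)
      qed
      ultimately have le: "real ?n * real ?m + (real ?n)\<^sup>2 * log 2 (real ?n) \<le> 2 * ?E ^ 3" by simp
      have "APSP2 ?n ?m \<le> K2 * (real ?n * real ?m + (real ?n)\<^sup>2 * log 2 (real ?n))" by (rule K2[OF n])
      also have "\<dots> \<le> \<bar>K2\<bar> * (2 * ?E ^ 3)" using le l0 by (intro mult_mono) auto
      also have "\<dots> = (2 * \<bar>K2\<bar>) * ?E ^ 3" by simp
      also have "\<dots> \<le> real C2 * ?E ^ 3" using C2 by (intro mult_right_mono) auto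
      finally show ?thesis .
    qed
    show ?thesis using 1 2 by (simp add: p_def poly_monom)
  qed
  then show ?thesis by blast
qed

lemma running_time_le_power_bound:
  assumes W: "goal I \<le> sum_list xs" and \<tau>: "0 \<le> \<tau>" "\<tau> \<le> (real (Suc (sum_list xs)))\<^sup>2"
    and nonneg: "0 \<le> SPSP (size_nodes I) (size_edges I)" "0 \<le> APSP2 (size_nodes I) (size_edges I)"
  shows "running_time SPSP APSP2 \<tau> I
    \<le> real (power_bound xs) * (SPSP (size_nodes I) (size_edges I) + APSP2 (size_nodes I) (size_edges I))"
proof -
  let ?s = "real (Suc (sum_list xs))" and ?W = "goal I"
  have s1: "1 \<le> ?s" by simp
  have "real ?W ^ (2 * ?W + 1) \<le> ?s ^ (2 * ?W + 1)" using W by (intro power_mono) auto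
  moreover have "\<tau> ^ (2 * ?W) \<le> ?s ^ (4 * ?W)"
  proof -
    have "\<tau> ^ (2 * ?W) \<le> (?s\<^sup>2) ^ (2 * ?W)" using \<tau> by (intro power_mono) auto
    also have "\<dots> = ?s ^ (4 * ?W)" by (simp flip: power_mult)
    finally show ?thesis .
  qed
  ultimately have "real ?W ^ (2 * ?W + 1) * \<tau> ^ (2 * ?W) \<le> ?s ^ (2 * ?W + 1) * ?s ^ (4 * ?W)"
    using \<tau>(1) by (intro mult_mono) auto
  also have "\<dots> = ?s ^ (6 * ?W + 1)" by (simp flip: power_add)
  also have "\<dots> \<le> ?s ^ (6 * Suc (sum_list xs))" using W by (intro power_increasing s1) auto
  also have "\<dots> = real (power_bound xs)" by (simp add: power_bound_def)
  finally have "real ?W ^ (2 * ?W + 1) * \<tau> ^ (2 * ?W) \<le> real (power_bound xs)" .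
  moreover have "1 \<le> real (power_bound xs)" unfolding power_bound_def by (simp add: Suc_le_eq)
  ultimately show ?thesis unfolding running_time_def distrib_left
    using nonneg mult_right_mono[of 1 "real (power_bound xs)" "APSP2 (size_nodes I) (size_edges I)"]
    by (intro add_mono mult_right_mono) auto
qed

lemma fpt_algorithm_solver:
  assumes solves: "solves_in_time c D (\<lambda>x. enc_spanner (inst x)) ok (\<lambda>x. K * running_time SPSP APSP2 (\<tau> x) (inst x))"
    and K: "0 \<le> K" and D: "\<And>x. x \<in> D \<Longrightarrow> valid_spanner_instance (inst x)"
    and W: "\<And>x. x \<in> D \<Longrightarrow> goal (inst x) \<le> sum_list (par x)"
    and \<tau>: "\<And>x. x \<in> D \<Longrightarrow> 0 \<le> \<tau> x \<and> \<tau> x \<le> (real (Suc (sum_list (par x))))\<^sup>2"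
    and nonneg: "\<And>n m. 0 \<le> SPSP n m" "\<And>n m. 0 \<le> APSP2 n m"
    and upper: "\<exists>K d. \<forall>n m. SPSP n m \<le> K * real (n + m) ^ d"
      "\<exists>K. \<forall>n\<ge>2. \<forall>m. APSP2 n m \<le> K * (real n * real m + (real n)\<^sup>2 * log 2 (real n))"
  shows "fpt_algorithm c D (\<lambda>x. enc_spanner (inst x)) ok par"
proof -
  obtain p :: "nat poly" where p: "\<And>I. valid_spanner_instance I \<Longrightarrow>
    SPSP (size_nodes I) (size_edges I) + APSP2 (size_nodes I) (size_edges I)
      \<le> real (poly p (encoding_length (enc_spanner I)))"
    using polynomial_bound[OF upper] by blast
  obtain k :: nat where k: "K \<le> real k" using real_arch_simple by blast
  \<comment> \<open>The constant factor goes into the polynomial, so that \<open>power_bound\<close>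
    depends on the parameters alone.\<close>
  have "solves_in_time c D (\<lambda>x. enc_spanner (inst x)) ok
    (\<lambda>x. real (power_bound (par x)) * real (poly (smult k p) (encoding_length (enc_spanner (inst x)))))"
  proof (rule solves_in_time_mono[OF solves])
    fix x assume x: "x \<in> D"
    let ?I = "inst x"
    let ?P = "SPSP (size_nodes ?I) (size_edges ?I) + APSP2 (size_nodes ?I) (size_edges ?I)"
    have "K * running_time SPSP APSP2 (\<tau> x) ?I \<le> K * (real (power_bound (par x)) * ?P)"
      using running_time_le_power_bound[of ?I "par x" "\<tau> x" SPSP APSP2] W \<tau> nonneg x K by (intro mult_left_mono) auto
    also have "\<dots> \<le> real k * (real (power_bound (par x)) * real (poly p (encoding_length (enc_spanner ?I))))"
      using k K p[OF D[OF x]] nonneg by (intro mult_mono) auto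
    finally show "K * running_time SPSP APSP2 (\<tau> x) ?I \<le> real (power_bound (par x)) *
        real (poly (smult k p) (encoding_length (enc_spanner ?I)))" by (simp add: mult_ac)
  qed
  then show ?thesis unfolding fpt_algorithm_def using computable_power_bound by blast
qed

lemma stretch_le_num: "1 \<le> stretch I \<Longrightarrow> (of_rat (stretch I) :: real) \<le> real (stretch_num I)"
  using stretch_quotient[of I] by (simp add: divide_le_eq mult_le_cancel_left1)

theorem corollary4:
  fixes SPSP APSP2 :: "nat \<Rightarrow> nat \<Rightarrow> real" and spsp apsp2 :: com
  assumes spsp: "solves_in_time spsp {I. valid_spsp I} enc_spsp ok_spsp
                   (\<lambda>I. SPSP (size_nodes I) (size_edges I))"
    and apsp2: "solves_in_time apsp2 {G. valid_graph G} enc_apsp2 ok_apsp2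
                   (\<lambda>G. APSP2 (size_nodes G) (size_edges G))"
    and SPSP_lower: "\<exists>\<delta>>0. \<forall>n m. \<delta> * real (n + m) \<le> SPSP n m"
    and APSP2_lower: "\<exists>\<delta>>0. \<forall>n m. \<delta> * real (n + m) \<le> APSP2 n m"
    and SPSP_upper: "\<exists>K d. \<forall>n m. SPSP n m \<le> K * real (n + m) ^ d"
    and APSP2_upper: "\<exists>K. \<forall>n\<ge>2. \<forall>m.
                        APSP2 n m \<le> K * (real n * real m + (real n)\<^sup>2 * log 2 (real n))"
  shows "(\<exists>c K.
            solves_in_time c bounded_spanner_instances
              (\<lambda>(I, lmax). enc_spanner I) (\<lambda>(I, lmax). ok_spanner I)
              (\<lambda>(I, lmax). K * running_time SPSP APSP2 (of_rat (stretch I) * real lmax) I)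
          \<and> fpt_algorithm c bounded_spanner_instances
              (\<lambda>(I, lmax). enc_spanner I) (\<lambda>(I, lmax). ok_spanner I)
              (\<lambda>(I, lmax). [goal I, lmax, stretch_num I, stretch_den I]))
       \<and> (\<exists>c K.
            solves_in_time c coupled_spanner_instances enc_spanner ok_spanner
              (\<lambda>I. K * running_time SPSP APSP2 (of_rat (stretch I) * real (goal I)) I)
          \<and> fpt_algorithm c coupled_spanner_instances enc_spanner ok_spanner
              (\<lambda>I. [goal I, stretch_num I, stretch_den I]))"
proof -
  obtain \<delta> where \<delta>: "0 < \<delta>" "\<And>n m. \<delta> * real (n + m) \<le> SPSP n m" using SPSP_lower by blast
  obtain \<epsilon> where \<epsilon>: "0 < \<epsilon>" "\<And>n m. \<epsilon> * real (n + m) \<le> APSP2 n m" using APSP2_lower by blast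
  have nonneg: "0 \<le> SPSP n m" "0 \<le> APSP2 n m" for n m
    using order_trans[OF _ \<delta>(2)[of n m]] order_trans[OF _ \<epsilon>(2)[of n m]] \<delta>(1) \<epsilon>(1) by auto
  define K where "K = 27 * (1 + 44 / \<delta>) + (1 + 23 / \<epsilon>)"
  have K: "0 \<le> K" using \<delta>(1) \<epsilon>(1) by (simp add: K_def)
  have st: "1 \<le> stretch I" "(1::real) \<le> of_rat (stretch I)" "(0::real) \<le> of_rat (stretch I)"
    if "valid_spanner_instance I" for I
    using that by (auto simp: valid_spanner_instance_def intro: order_trans[OF zero_le_one])
  have bound: "real (bound I e) \<le> of_rat (stretch I) * real c"
    if "valid_spanner_instance I" "len I (edge_at I e) \<le> c" for I e c
  proof -
    have "real (bound I e) \<le> of_rat (stretch I) * real (len I (edge_at I e))"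
      using le_bound_iff[OF st(1)[OF that(1)], of "bound I e" e] by simp
    also have "\<dots> \<le> of_rat (stretch I) * real c" using that st(3)[OF that(1)] by (intro mult_left_mono) auto
    finally show ?thesis .
  qed
  have one: "1 \<le> of_rat (stretch I) * real c" if "valid_spanner_instance I" "1 \<le> c" for I c
    using mult_mono[of 1 "of_rat (stretch I)" 1 "real c"] st[OF that(1)] that(2) by simp
  \<comment> \<open>Both factors are bounded by the sum of the parameters, the stretch because it is
    at most its numerator; hence the square in \<open>running_time_le_power_bound\<close>.\<close>
  have square: "of_rat (stretch I) * real c \<le> (real (Suc t))\<^sup>2"
    if "valid_spanner_instance I" "stretch_num I \<le> t" "c \<le> t" for I c t
  proof -
    have "of_rat (stretch I) \<le> real (Suc t)" using stretch_le_num[OF st(1)[OF that(1)]] that(2) by simp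
    then show ?thesis unfolding power2_eq_square using that(3) by (intro mult_mono) auto
  qed
  have "solves_in_time (solver spsp apsp2) bounded_spanner_instances
    (\<lambda>x. enc_spanner (fst x)) (\<lambda>x. ok_spanner (fst x))
    (\<lambda>x. K * running_time SPSP APSP2 (of_rat (stretch (fst x)) * real (snd x)) (fst x))"
    unfolding K_def
  proof (rule solver_solves_in_time[OF spsp apsp2 \<delta> \<epsilon>])
    fix x assume x: "x \<in> bounded_spanner_instances"
    then have v: "valid_spanner_instance (fst x)" and l: "\<And>e. e \<in> edges (fst x) \<Longrightarrow> len (fst x) e \<le> snd x"
      by (auto simp: bounded_spanner_instances_def)
    then show "valid_spanner_instance (fst x)" "0 \<le> (of_rat (stretch (fst x)) :: real) * real (snd x)"
      using st(3) by simp_all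
    fix e assume "e < size_edges (fst x)"
    then have "len (fst x) (edge_at (fst x) e) \<le> snd x" using l by (simp add: edges_conv)
    then show "real (bound (fst x) e) \<le> of_rat (stretch (fst x)) * real (snd x)" using bound[OF v] by simp
  next
    fix x assume x: "x \<in> bounded_spanner_instances" and m: "0 < size_edges (fst x)"
    then have v: "valid_spanner_instance (fst x)" and l: "\<And>e. e \<in> edges (fst x) \<Longrightarrow> len (fst x) e \<le> snd x"
      by (auto simp: bounded_spanner_instances_def)
    \<comment> \<open>An edge has length at least 1, so \<open>lmax\<close> is positive once there
      is an edge.\<close>
    have "edge_at (fst x) 0 \<in> edges (fst x)" using m by (simp add: edges_conv)
    then have "1 \<le> snd x" using l v by (force simp: valid_spanner_instance_def valid_graph_def)
    then show "1 \<le> (of_rat (stretch (fst x)) :: real) * real (snd x)" using one[OF v] by simp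
  qed
  moreover from this have "fpt_algorithm (solver spsp apsp2) bounded_spanner_instances
    (\<lambda>x. enc_spanner (fst x)) (\<lambda>x. ok_spanner (fst x))
    (\<lambda>x. [goal (fst x), snd x, stretch_num (fst x), stretch_den (fst x)])"
  proof (rule fpt_algorithm_solver[OF _ K _ _ _ nonneg SPSP_upper APSP2_upper])
    fix x assume "x \<in> bounded_spanner_instances"
    then have v: "valid_spanner_instance (fst x)" by (auto simp: bounded_spanner_instances_def)
    then show "valid_spanner_instance (fst x)" .
    let ?t = "sum_list [goal (fst x), snd x, stretch_num (fst x), stretch_den (fst x)]"
    show "0 \<le> (of_rat (stretch (fst x)) :: real) * real (snd x) \<and>
        of_rat (stretch (fst x)) * real (snd x) \<le> (real (Suc ?t))\<^sup>2"
      using square[OF v, of ?t "snd x"] st(3)[OF v] by simp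
  qed simp
  moreover have "solves_in_time (solver spsp apsp2) coupled_spanner_instances enc_spanner ok_spanner
    (\<lambda>I. K * running_time SPSP APSP2 (of_rat (stretch I) * real (goal I)) I)"
    unfolding K_def
  proof (rule solver_solves_in_time[OF spsp apsp2 \<delta> \<epsilon>, where inst = "\<lambda>I. I"])
    fix I assume I: "I \<in> coupled_spanner_instances"
    then have v: "valid_spanner_instance I" and c: "coupled I" by (auto simp: coupled_spanner_instances_def)
    then show "valid_spanner_instance I" "0 \<le> (of_rat (stretch I) :: real) * real (goal I)"
      using st(3) by simp_all
    fix e assume "e < size_edges I" "weight I (edge_at I e) < goal I"
    \<comment> \<open>Coupling turns the weight bound into a length bound, so that the goal can
      replace \<open>lmax\<close> in \<tau>.\<close>
    then have "len I (edge_at I e) \<le> goal I" using c by (simp add: coupled_def edges_conv)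
    then show "real (bound I e) \<le> of_rat (stretch I) * real (goal I)" using bound[OF v] by simp
  qed (use one in \<open>auto simp: coupled_spanner_instances_def\<close>)
  moreover from this have "fpt_algorithm (solver spsp apsp2) coupled_spanner_instances enc_spanner ok_spanner
    (\<lambda>I. [goal I, stretch_num I, stretch_den I])"
  proof (rule fpt_algorithm_solver[where inst = "\<lambda>I. I", OF _ K _ _ _ nonneg SPSP_upper APSP2_upper])
    fix I assume "I \<in> coupled_spanner_instances"
    then have v: "valid_spanner_instance I" by (auto simp: coupled_spanner_instances_def)
    then show "valid_spanner_instance I" .
    let ?t = "sum_list [goal I, stretch_num I, stretch_den I]"
    show "0 \<le> (of_rat (stretch I) :: real) * real (goal I) \<and>
        of_rat (stretch I) * real (goal I) \<le> (real (Suc ?t))\<^sup>2"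
      using square[OF v, of ?t "goal I"] st(3)[OF v] by simp
  qed simp
  ultimately show ?thesis unfolding case_prod_unfold by blast
qed

end
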